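(* Let $k\ge1$ be an integer. For any $0\le i\le k$ and $r\in\{1,2\}$, we have the following decomposition into inequivalent irreducible $L(k,0)^{\mathbb{Z}_3}$-modules: $$L(k,i)^{T_r}=\bigoplus_{j=0}^{2}L(k,i)^{T_r,j}.$$
   Context: $\{h,e,f\}$ is a standard Chevalley basis of $\mathfrak{sl}_2(\mathbb{C})$ with $[h,e]=2e$, $[h,f]=-2f$, $[e,f]=h$. $L(k,0)=L_{\widehat{\mathfrak{sl}_2}}(k,0)$ is the simple affine vertex operator algebra of level $k$; $a\in\mathfrak{sl}_2$ is identified with $a(-1)\mathbf{1}$, and on any untwisted module $Y(a(-1)\mathbf{1},z)=\sum_{n\in\mathbb{Z}}a(n)z^{-n-1}$. For $0\le i\le k$, $L(k,i)$ is the irreducible (integrable highest weight) $L(k,0)$-module whose lowest weight space is the $(i+1)$-dimensional irreducible $\mathfrak{sl}_2$-module with basis $v^{i,0},\dots,v^{i,i}$ and action $h(0)v^{i,j}=(i-2j)v^{i,j}$; $e(0)v^{i,0}=0$, $e(0)v^{i,j}=(i-j+1)v^{i,j-1}$ for $1\le j\le i$; $f(0)v^{i,i}=0$, $f(0)v^{i,j}=(j+1)v^{i,j+1}$ for $0\le j\le i-1$; $a(n)v^{i,j}=0$ for $a\in\{h,e,f\}$, $n\ge1$; $v^{0,0}=\mathbf{1}$. The automorphism $\sigma$ of $\mathfrak{sl}_2(\mathbb{C})$ defined by $\sigma(h)=h$, $\sigma(e)=\frac{-1+\sqrt{-3}}{2}e$, $\sigma(f)=\frac{-1-\sqrt{-3}}{2}f$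 lifts to an automorphism of $L(k,0)$ generating $\mathbb{Z}_3=\{1,\sigma,\sigma^2\}$, and $L(k,0)^{\mathbb{Z}_3}$ is the fixed point vertex operator subalgebra. For $r\in\mathbb{Z}_{\ge0}$ let $h^{(r)}=\frac r6h$ and $\Delta(h^{(r)},z)=z^{h^{(r)}(0)}\exp\left(\sum_{n\ge1}\frac{h^{(r)}(n)}{-n}(-z)^{-n}\right)$. For $r=1,2$, $L(k,i)^{T_r}$ denotes the vector space $L(k,i)$ with vertex operator map $Y_{\sigma^r}(v,z)=Y(\Delta(h^{(r)},z)v,z)$; it is an irreducible $\sigma^r$-twisted $L(k,0)$-module (convention: for a $g$-twisted module with $g$ of order $T$, $Y_M(u,z)\in z^{-s/T}(\mathrm{End}\,M)[[z,z^{-1}]]$ if $gu=e^{-2\pi\sqrt{-1}s/T}u$), and these are all the irreducible $\sigma^r$-twisted modules. $L(k,i)^{T_r,j}$ ($j=0,1,2$) is the $L(k,0)^{\mathbb{Z}_3}$-submodule of $L(k,i)^{T_r}$ generated by $u_{k,i}^{T_r,j}$, where (the modes $e(n),f(n)$ are the untwisted ones on $L(k,i)$): $u_{k,i}^{T_1,0}=v^{i,i}$ for $0\le i\le k$; $u_{k,0}^{T_1,1}=e(-1)\mathbf{1}$, and $u_{k,i}^{T_1,1}=v^{i,i-1}$ for $0<i\le k$; $u_{k,0}^{T_1,2}=f(-1)\mathbf{1}$, $u_{1,1}^{T_1,2}=f(-2)v^{1,1}$, $u_{k,1}^{T_1,2}=f(-1)v^{1,1}$ for $k>1$, $u_{k,i}^{T_1,2}=v^{i,i-2}$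 for $1<i\le k$; $u_{k,i}^{T_2,0}=v^{i,i}$ for $0\le i\le k$; $u_{k,i}^{T_2,1}=f(-1)v^{i,i}$ for $0\le i<k$, and $u_{k,k}^{T_2,1}=f(-2)v^{k,k}$; $u_{1,0}^{T_2,2}=e(-1)\mathbf{1}$, $u_{k,0}^{T_2,2}=f(-1)^2\mathbf{1}$ for $k>1$, $u_{k,i}^{T_2,2}=v^{i,i-1}$ for $1\le i\le k$. *)

theory Defs
  imports "HOL-Analysis.Analysis" "HOL-Library.Groups_Big_Fun"
begin

section \<open>Complex vector spaces\<close>

class complex_vector = ab_group_add +
  fixes scaleC :: "complex \<Rightarrow> 'a \<Rightarrow> 'a"  (infixr "*\<^sub>C" 75)
  assumes scaleC_add_right: "c *\<^sub>C (x + y) = c *\<^sub>C x + c *\<^sub>C y"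
    and scaleC_add_left: "(c + d) *\<^sub>C x = c *\<^sub>C x + d *\<^sub>C x"
    and scaleC_scaleC: "c *\<^sub>C d *\<^sub>C x = (c * d) *\<^sub>C x"
    and scaleC_one: "1 *\<^sub>C x = x"

global_interpretation cvec: vector_space "scaleC :: complex \<Rightarrow> 'a \<Rightarrow> 'a::complex_vector"
  by unfold_locales
    (simp_all add: scaleC_add_right scaleC_add_left scaleC_scaleC scaleC_one)

definition linear_on :: "'a::complex_vector set \<Rightarrow> ('a \<Rightarrow> 'b::complex_vector) \<Rightarrow> bool" where
  "linear_on S f \<longleftrightarrow>
     (\<forall>x\<in>S. \<forall>y\<in>S. f (x + y) = f x + f y) \<and> (\<forall>c. \<forall>x\<in>S. f (c *\<^sub>C x) = c *\<^sub>C f x)"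

definition eigenspace :: "'a::complex_vector set \<Rightarrow> ('a \<Rightarrow> 'a) \<Rightarrow> complex \<Rightarrow> 'a set" where
  "eigenspace S T c = {x \<in> S. T x = c *\<^sub>C x}"

definition finite_dim :: "'a::complex_vector set \<Rightarrow> bool" where
  "finite_dim S \<longleftrightarrow> (\<exists>B. finite B \<and> S \<subseteq> cvec.span B)"

definition direct_sum :: "'a::complex_vector set \<Rightarrow> 'i set \<Rightarrow> ('i \<Rightarrow> 'a set) \<Rightarrow> bool" where
  "direct_sum S J W \<longleftrightarrow>
     (\<forall>j\<in>J. cvec.subspace (W j) \<and> W j \<subseteq> S) \<and>
     (\<forall>x\<in>S. \<exists>!c. c \<in> (\<Pi>\<^sub>E j\<in>J. W j) \<and> x = (\<Sum>j\<in>J. c j))"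

section \<open>Vertex operator algebras and their modules\<close>

text \<open>
  A vertex operator map is given by its modes: \<open>Y u n\<close> is the coefficient of \<open>z\<^bsup>-n-1\<^esup>\<close> in
  \<open>Y(u,z)\<close>. Algebras and modules live on subspaces \<open>U\<close> and \<open>W\<close> of ambient vector spaces, so that
  subalgebras and submodules share the vertex operators of the ambient structure.

  \<open>borcherds_identity\<close> is the coefficient of \<open>z\<^sub>0\<^bsup>-r-1\<^esup> z\<^sub>1\<^bsup>-p-1\<^esup> z\<^sub>2\<^bsup>-q-1\<^esup>\<close> in the Jacobi identity
  for \<open>Y\<close> acting on itself and \<open>YW\<close> on \<open>W\<close>. The truncation conditions imposed below make both sums
  finite (\<open>Sum_any\<close> is the sum over the finite support).
\<close>

definition borcherds_identity ::
  "'v::complex_vector set \<Rightarrow> ('v \<Rightarrow> int \<Rightarrow> 'v \<Rightarrow> 'v) \<Rightarrow>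
   'm::complex_vector set \<Rightarrow> ('v \<Rightarrow> int \<Rightarrow> 'm \<Rightarrow> 'm) \<Rightarrow> bool" where
  "borcherds_identity U Y W YW \<longleftrightarrow>
     (\<forall>u\<in>U. \<forall>v\<in>U. \<forall>w\<in>W. \<forall>p q r :: int.
        Sum_any (\<lambda>i::nat. ((of_int p :: complex) gchoose i) *\<^sub>C
                   YW (Y u (r + int i) v) (p + q - int i) w) =
        Sum_any (\<lambda>i::nat. ((-1) ^ i * ((of_int r :: complex) gchoose i)) *\<^sub>C
                   (YW u (p + r - int i) (YW v (q + int i) w)
                    - ((-1) powi r) *\<^sub>C YW v (q + r - int i) (YW u (p + int i) w))))"

locale vertex_operators =
  fixes U :: "'v::complex_vector set" and W :: "'m::complex_vector set"
    and YW :: "'v \<Rightarrow> int \<Rightarrow> 'm \<Rightarrow> 'm"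
  assumes subspace_U: "cvec.subspace U"
    and subspace_W: "cvec.subspace W"
    and mode_closed: "u \<in> U \<Longrightarrow> w \<in> W \<Longrightarrow> YW u n w \<in> W"
    and linear_state: "w \<in> W \<Longrightarrow> linear_on U (\<lambda>u. YW u n w)"
    and linear_mode: "u \<in> U \<Longrightarrow> linear_on W (YW u n)"
    and truncation: "u \<in> U \<Longrightarrow> w \<in> W \<Longrightarrow> \<exists>N. \<forall>n\<ge>N. YW u n w = 0"

locale vertex_operator_algebra = vertex_operators U U Y
  for U :: "'v::complex_vector set" and Y :: "'v \<Rightarrow> int \<Rightarrow> 'v \<Rightarrow> 'v" +
  fixes vac conf :: 'v
  assumes vac_in: "vac \<in> U" and conf_in: "conf \<in> U"
    and vacuum: "u \<in> U \<Longrightarrow> Y vac n u = (if n = -1 then u else 0)"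
    and creation: "u \<in> U \<Longrightarrow> Y u (-1) vac = u"
                  "u \<in> U \<Longrightarrow> n \<ge> 0 \<Longrightarrow> Y u n vac = 0"
    and jacobi: "borcherds_identity U Y U Y"
    and virasoro: "\<exists>c::complex. \<forall>m n. \<forall>u\<in>U.
          Y conf (m + 1) (Y conf (n + 1) u) - Y conf (n + 1) (Y conf (m + 1) u) =
          of_int (m - n) *\<^sub>C Y conf (m + n + 1) u
          + (if m + n = 0 then (of_int (m ^ 3 - m) / 12 * c) *\<^sub>C u else 0)"
    and translation: "u \<in> U \<Longrightarrow> w \<in> U \<Longrightarrow> Y (Y conf 0 u) n w = - of_int n *\<^sub>C Y u (n - 1) w"
    and grading: "U \<subseteq> cvec.span (\<Union>n::int. eigenspace U (Y conf 1) (of_int n))"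
    and weight_finite_dim: "finite_dim (eigenspace U (Y conf 1) (of_int n))"
    and weight_bounded: "\<exists>N::int. \<forall>n<N. eigenspace U (Y conf 1) (of_int n) = {0}"

text \<open>
  These are ordinary modules: direct sums of finite-dimensional \<open>L(0)\<close>-eigenspaces, the eigenvalues
  being bounded below in every coset of the integers. Every subspace stable under all modes is graded,
  because \<open>L(0)\<close> is itself a mode.
\<close>

locale voa_module = vertex_operators U W YW
  for U :: "'v::complex_vector set" and Y :: "'v \<Rightarrow> int \<Rightarrow> 'v \<Rightarrow> 'v" and vac conf :: 'v
    and W :: "'m::complex_vector set" and YW :: "'v \<Rightarrow> int \<Rightarrow> 'm \<Rightarrow> 'm" +
  assumes algebra: "vertex_operator_algebra U Y vac conf"
    and vacuum: "w \<in> W \<Longrightarrow> YW vac n w = (if n = -1 then w else 0)"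
    and jacobi: "borcherds_identity U Y W YW"
    and grading: "W \<subseteq> cvec.span (\<Union>c. eigenspace W (YW conf 1) c)"
    and weight_finite_dim: "finite_dim (eigenspace W (YW conf 1) c)"
    and weight_bounded: "\<exists>N::int. \<forall>n<N. eigenspace W (YW conf 1) (c + of_int n) = {0}"

definition stable_subspace ::
  "'v set \<Rightarrow> ('v \<Rightarrow> int \<Rightarrow> 'm \<Rightarrow> 'm) \<Rightarrow> 'm::complex_vector set \<Rightarrow> bool" where
  "stable_subspace U YW S \<longleftrightarrow> cvec.subspace S \<and> (\<forall>u\<in>U. \<forall>n. \<forall>w\<in>S. YW u n w \<in> S)"

definition generated_submodule ::
  "'v set \<Rightarrow> ('v \<Rightarrow> int \<Rightarrow> 'm \<Rightarrow> 'm) \<Rightarrow> 'm::complex_vector \<Rightarrow> 'm set" where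
  "generated_submodule U YW w = stable_subspace U YW hull {w}"

definition irreducible_module ::
  "'v::complex_vector set \<Rightarrow> ('v \<Rightarrow> int \<Rightarrow> 'v \<Rightarrow> 'v) \<Rightarrow> 'v \<Rightarrow> 'v \<Rightarrow>
   'm::complex_vector set \<Rightarrow> ('v \<Rightarrow> int \<Rightarrow> 'm \<Rightarrow> 'm) \<Rightarrow> bool" where
  "irreducible_module U Y vac conf W YW \<longleftrightarrow>
     voa_module U Y vac conf W YW \<and> W \<noteq> {0} \<and>
     (\<forall>S. S \<subseteq> W \<longrightarrow> stable_subspace U YW S \<longrightarrow> S = {0} \<or> S = W)"

definition equivalent_modules ::
  "'v set \<Rightarrow> 'm::complex_vector set \<Rightarrow> ('v \<Rightarrow> int \<Rightarrow> 'm \<Rightarrow> 'm) \<Rightarrow>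
   'n::complex_vector set \<Rightarrow> ('v \<Rightarrow> int \<Rightarrow> 'n \<Rightarrow> 'n) \<Rightarrow> bool" where
  "equivalent_modules U W YW X YX \<longleftrightarrow>
     (\<exists>\<phi>. linear_on W \<phi> \<and> bij_betw \<phi> W X \<and>
          (\<forall>u\<in>U. \<forall>n. \<forall>w\<in>W. \<phi> (YW u n w) = YX u n (\<phi> w)))"

definition simple_voa ::
  "'v::complex_vector set \<Rightarrow> ('v \<Rightarrow> int \<Rightarrow> 'v \<Rightarrow> 'v) \<Rightarrow> 'v \<Rightarrow> 'v \<Rightarrow> bool" where
  "simple_voa U Y vac conf \<longleftrightarrow>
     vertex_operator_algebra U Y vac conf \<and> irreducible_module U Y vac conf U Y"

definition voa_automorphism ::
  "'v::complex_vector set \<Rightarrow> ('v \<Rightarrow> int \<Rightarrow> 'v \<Rightarrow> 'v) \<Rightarrow> 'v \<Rightarrow> 'v \<Rightarrow> ('v \<Rightarrow> 'v) \<Rightarrow> bool" where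
  "voa_automorphism U Y vac conf g \<longleftrightarrow>
     linear_on U g \<and> bij_betw g U U \<and> g vac = vac \<and> g conf = conf \<and>
     (\<forall>u\<in>U. \<forall>n. \<forall>v\<in>U. g (Y u n v) = Y (g u) n (g v))"

definition fixed_points :: "('v \<Rightarrow> 'v) set \<Rightarrow> 'v set \<Rightarrow> 'v set" where
  "fixed_points G U = {v \<in> U. \<forall>g\<in>G. g v = v}"

section \<open>The simple affine vertex operator algebra of \<open>sl\<^sub>2\<close> and its modules\<close>

type_synonym mat2 = "complex^2^2"

definition sl2 :: "mat2 set" where "sl2 = {a. trace a = 0}"

definition mat_h :: mat2 where "mat_h = vector [vector [1, 0], vector [0, -1]]"
definition mat_e :: mat2 where "mat_e = vector [vector [0, 1], vector [0, 0]]"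
definition mat_f :: mat2 where "mat_f = vector [vector [0, 0], vector [1, 0]]"

definition lie_bracket :: "mat2 \<Rightarrow> mat2 \<Rightarrow> mat2" where
  "lie_bracket a b = a ** b - b ** a"

lemma chevalley_relations:
  "lie_bracket mat_h mat_e = mat_e + mat_e"
  "lie_bracket mat_h mat_f = - (mat_f + mat_f)"
  "lie_bracket mat_e mat_f = mat_h"
  by (simp_all add: lie_bracket_def mat_h_def mat_e_def mat_f_def vec_eq_iff forall_2
      matrix_matrix_mult_def sum_2 vector_2)

text \<open>
  \<open>\<iota> a\<close> is the state \<open>a(-1)1\<close>, so \<open>Y (\<iota> a) n\<close> is the operator \<open>a(n)\<close>. The invariant form is the
  trace form, normalised by \<open>(h, h) = 2\<close>. A vertex operator algebra generated by a level \<open>k\<close> action of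
  the affine algebra on the vacuum, with the Sugawara conformal vector, is a quotient of the universal
  affine vertex operator algebra; being simple, it is \<open>L(k,0)\<close>.
\<close>

locale simple_affine_sl2_voa =
  fixes k :: nat and Y :: "'v::complex_vector \<Rightarrow> int \<Rightarrow> 'v \<Rightarrow> 'v" and vac conf :: 'v
    and \<iota> :: "mat2 \<Rightarrow> 'v"
  assumes simple: "simple_voa UNIV Y vac conf"
    and current_add: "a \<in> sl2 \<Longrightarrow> b \<in> sl2 \<Longrightarrow> \<iota> (a + b) = \<iota> a + \<iota> b"
    and current_scale: "a \<in> sl2 \<Longrightarrow> \<iota> (mat c ** a) = c *\<^sub>C \<iota> a"
    and affine_commutator: "a \<in> sl2 \<Longrightarrow> b \<in> sl2 \<Longrightarrow>
          Y (\<iota> a) m (Y (\<iota> b) n v) - Y (\<iota> b) n (Y (\<iota> a) m v) =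
          Y (\<iota> (lie_bracket a b)) (m + n) v
          + (if m + n = 0 then (of_int m * trace (a ** b) * of_nat k) *\<^sub>C v else 0)"
    and affine_generated: "stable_subspace (\<iota> ` sl2) Y hull {vac} = UNIV"
    and sugawara: "conf = (1 / (2 * (of_nat k + 2))) *\<^sub>C
          ((1/2) *\<^sub>C Y (\<iota> mat_h) (-1) (\<iota> mat_h)
           + Y (\<iota> mat_e) (-1) (\<iota> mat_f) + Y (\<iota> mat_f) (-1) (\<iota> mat_e))"

text \<open>
  \<open>YM\<close> on the whole space \<open>'m\<close> is \<open>L(k,i)\<close>, and \<open>v j\<close> is the vector \<open>v\<^bsup>i,j\<^esup>\<close> for \<open>j \<le> i\<close>. For \<open>i = 0\<close>
  this is a copy of the adjoint module, \<open>v 0\<close> corresponding to the vacuum vector.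
\<close>

locale affine_sl2_module =
  fixes Y :: "'v::complex_vector \<Rightarrow> int \<Rightarrow> 'v \<Rightarrow> 'v" and vac conf :: 'v and \<iota> :: "mat2 \<Rightarrow> 'v"
    and YM :: "'v \<Rightarrow> int \<Rightarrow> 'm::complex_vector \<Rightarrow> 'm" and i :: nat and v :: "nat \<Rightarrow> 'm"
  assumes irreducible: "irreducible_module UNIV Y vac conf (UNIV :: 'm set) YM"
    and top_basis: "inj_on v {..i}" "\<not> cvec.dependent (v ` {..i})"
    and lowest_weight_space: "\<exists>\<kappa>.
          eigenspace UNIV (YM conf 1) \<kappa> = cvec.span (v ` {..i}) \<and>
          (\<forall>\<mu>. eigenspace UNIV (YM conf 1) \<mu> \<noteq> {0} \<longrightarrow> (\<exists>n::nat. \<mu> = \<kappa> + of_nat n))"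
    and h_top: "j \<le> i \<Longrightarrow> YM (\<iota> mat_h) 0 (v j) = of_int (int i - 2 * int j) *\<^sub>C v j"
    and e_top: "YM (\<iota> mat_e) 0 (v 0) = 0"
      "1 \<le> j \<Longrightarrow> j \<le> i \<Longrightarrow> YM (\<iota> mat_e) 0 (v j) = of_nat (i - j + 1) *\<^sub>C v (j - 1)"
    and f_top: "YM (\<iota> mat_f) 0 (v i) = 0"
      "j < i \<Longrightarrow> YM (\<iota> mat_f) 0 (v j) = of_nat (j + 1) *\<^sub>C v (j + 1)"
    and positive_modes: "a \<in> {mat_h, mat_e, mat_f} \<Longrightarrow> n \<ge> 1 \<Longrightarrow> j \<le> i \<Longrightarrow> YM (\<iota> a) n (v j) = 0"

definition lifts_sigma ::
  "('v::complex_vector \<Rightarrow> int \<Rightarrow> 'v \<Rightarrow> 'v) \<Rightarrow> 'v \<Rightarrow> 'v \<Rightarrow> (mat2 \<Rightarrow> 'v) \<Rightarrow> ('v \<Rightarrow> 'v) \<Rightarrow> bool" where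
  "lifts_sigma Y vac conf \<iota> \<sigma> \<longleftrightarrow>
     voa_automorphism UNIV Y vac conf \<sigma> \<and>
     \<sigma> (\<iota> mat_h) = \<iota> mat_h \<and>
     \<sigma> (\<iota> mat_e) = ((-1 + \<i> * of_real (sqrt 3)) / 2) *\<^sub>C \<iota> mat_e \<and>
     \<sigma> (\<iota> mat_f) = ((-1 - \<i> * of_real (sqrt 3)) / 2) *\<^sub>C \<iota> mat_f"

section \<open>The twisted modules\<close>

text \<open>
  \<open>exp_coeff H m\<close> is the coefficient of \<open>z\<^bsup>-m\<^esup>\<close> in \<open>exp(\<Sum>n\<ge>1. H(n)/(-n) (-z)\<^bsup>-n\<^esup>)\<close>: expanding the
  exponential, its term of degree \<open>p\<close> contributes one summand for each list of \<open>p\<close> positive integers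
  with sum \<open>m\<close>.
\<close>

definition exp_coeff :: "(int \<Rightarrow> 'v \<Rightarrow> 'v) \<Rightarrow> nat \<Rightarrow> 'v::complex_vector \<Rightarrow> 'v" where
  "exp_coeff H m x =
     (\<Sum>ns\<in>{ns::nat list. sum_list ns = m \<and> 0 \<notin> set ns}.
        (1 / fact (length ns)) *\<^sub>C
        foldr (\<lambda>n y. ((-1) ^ n / - of_nat n) *\<^sub>C H (int n) y) ns x)"

text \<open>
  For \<open>T\<close> diagonalisable with rational eigenvalues, \<open>eigen_component T x q\<close> is the component of \<open>x\<close>
  of eigenvalue \<open>q\<close>, that is, the coefficient of \<open>z\<^bsup>q\<^esup>\<close> in \<open>z\<^bsup>T\<^esup> x\<close>.
\<close>

definition eigen_component :: "('v \<Rightarrow> 'v) \<Rightarrow> 'v::complex_vector \<Rightarrow> rat \<Rightarrow> 'v" where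
  "eigen_component T x =
     (THE c. finite {q. c q \<noteq> 0} \<and> (\<forall>q. T (c q) = of_rat q *\<^sub>C c q) \<and> x = Sum_any c)"

text \<open>
  With \<open>hr = h\<^bsup>(r)\<^esup>\<close>, \<open>delta_coeff Y hr x q\<close> is the coefficient of \<open>z\<^bsup>q\<^esup>\<close> in \<open>\<Delta>(h\<^bsup>(r)\<^esup>,z) x\<close>, and
  \<open>twisted_mode Y hr YM x t\<close> is the coefficient of \<open>z\<^bsup>-t-1\<^esup>\<close> in \<open>Y(\<Delta>(h\<^bsup>(r)\<^esup>,z) x, z)\<close>, where \<open>t\<close> is
  rational: \<open>z\<^bsup>q\<^esup> z\<^bsup>-n-1\<^esup> = z\<^bsup>-t-1\<^esup>\<close> for the integer \<open>n = t + q\<close>.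
\<close>

definition delta_coeff ::
  "('v \<Rightarrow> int \<Rightarrow> 'v \<Rightarrow> 'v) \<Rightarrow> 'v \<Rightarrow> 'v::complex_vector \<Rightarrow> rat \<Rightarrow> 'v" where
  "delta_coeff Y hr x q =
     Sum_any (\<lambda>m::nat. eigen_component (Y hr 0) (exp_coeff (Y hr) m x) (q + of_nat m))"

definition twisted_mode ::
  "('v \<Rightarrow> int \<Rightarrow> 'v \<Rightarrow> 'v) \<Rightarrow> 'v \<Rightarrow> ('v \<Rightarrow> int \<Rightarrow> 'm \<Rightarrow> 'm) \<Rightarrow>
   'v::complex_vector \<Rightarrow> rat \<Rightarrow> 'm::complex_vector \<Rightarrow> 'm" where
  "twisted_mode Y hr YM x t w =
     Sum_any (\<lambda>q::rat. if t + q \<in> \<int> then YM (delta_coeff Y hr x q) \<lfloor>t + q\<rfloor> w else 0)"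

definition h_twist :: "(mat2 \<Rightarrow> 'v::complex_vector) \<Rightarrow> nat \<Rightarrow> 'v" where
  "h_twist \<iota> r = (of_nat r / 6) *\<^sub>C \<iota> mat_h"

text \<open>
  On \<open>\<sigma>\<close>-fixed states \<open>x\<close> the eigenvalues of \<open>h\<^bsup>(r)\<^esup>(0)\<close> are integers, so only integral modes of
  \<open>Y(\<Delta>(h\<^bsup>(r)\<^esup>,z) x, z)\<close> occur; these are the vertex operators of the fixed point subalgebra on
  the twisted module.
\<close>

definition integral_twisted_mode ::
  "('v \<Rightarrow> int \<Rightarrow> 'v \<Rightarrow> 'v) \<Rightarrow> 'v \<Rightarrow> ('v \<Rightarrow> int \<Rightarrow> 'm \<Rightarrow> 'm) \<Rightarrow>
   'v::complex_vector \<Rightarrow> int \<Rightarrow> 'm::complex_vector \<Rightarrow> 'm" where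
  "integral_twisted_mode Y hr YM x n = twisted_mode Y hr YM x (of_int n)"

text \<open>
  \<open>twisted_generator k i r j E F v\<close> is \<open>u\<^sub>k\<^sub>,\<^sub>i\<close> with superscript \<open>T\<^sub>r, j\<close> (for \<open>r = 1, 2\<close> and \<open>j = 0, 1, 2\<close>);
  \<open>E n\<close> and \<open>F n\<close> are the untwisted operators \<open>e(n)\<close> and \<open>f(n)\<close>.
\<close>

definition twisted_generator ::
  "nat \<Rightarrow> nat \<Rightarrow> nat \<Rightarrow> nat \<Rightarrow> (int \<Rightarrow> 'm \<Rightarrow> 'm) \<Rightarrow> (int \<Rightarrow> 'm \<Rightarrow> 'm) \<Rightarrow> (nat \<Rightarrow> 'm) \<Rightarrow> 'm" where
  "twisted_generator k i r j E F v =
     (if r = 1 then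
        (if j = 0 then v i
         else if j = 1 then (if i = 0 then E (-1) (v 0) else v (i - 1))
         else (if i = 0 then F (-1) (v 0)
               else if i = 1 then (if k = 1 then F (-2) (v 1) else F (-1) (v 1))
               else v (i - 2)))
      else
        (if j = 0 then v i
         else if j = 1 then (if i < k then F (-1) (v i) else F (-2) (v k))
         else (if i = 0 then (if k = 1 then E (-1) (v 0) else F (-1) (F (-1) (v 0)))
               else v (i - 1))))"

end

theory Submission
  imports Defs
begin

text \<open>
The proof separates two questions: that the twisted modes form a module for the fixed point algebra,
and how this module decomposes. The second question is answered for the \<^emph>\<open>untwisted\<close> modes, because
both actions of the fixed point algebra have the same stable subspaces.

\<^emph>\<open>The twisted action.\<close> Let \<open>E\<^sub>m\<close> be the coefficients of the exponential in Li's operator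
\<open>\<Delta>(h\<^bsup>(r)\<^esup>,z)\<close>. Applying \<open>z d/dz\<close> to the exponential gives a recurrence for them
(\<open>exp_coeff_recurrence\<close>). Together with the commutator formula for \<open>h(n)\<close> and Vandermonde's identity
it yields, for \<open>h\<^bsup>(r)\<^esup>(0) u = \<alpha> u\<close>,
\<open>E\<^sub>s (u\<^sub>n v) = \<Sum> binom(\<alpha> - m, i) (E\<^sub>m u)\<^bsub>n+i\<^esub> (E\<^sub>l v)\<close>, the sum being over \<open>m + l + i = s\<close>
(\<open>exp_coeff_mode\<close>). This is Li's conjugation formula
\<open>\<Delta>(z\<^sub>2) Y(u,z\<^sub>0) = Y(\<Delta>(z\<^sub>2 + z\<^sub>0) u, z\<^sub>0) \<Delta>(z\<^sub>2)\<close> in coefficients. Inserted into the Borcherds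
identity of the untwisted module it gives the Borcherds identity of the twisted modes
(\<open>twisted_borcherds\<close>), by one more Vandermonde convolution. As \<open>E\<^sub>0\<close> is the identity and \<open>E\<^sub>m\<close> lowers
the conformal weight by \<open>m\<close>, twisted and untwisted modes determine each other by a triangular system;
hence the equality of stable subspaces (\<open>stable_fixed_iff\<close>).

\<^emph>\<open>The decomposition.\<close> The automorphism is \<open>\<omega>\<close> to the power \<open>h(0)/2\<close>, where \<open>\<omega>\<close> is a primitive cube
root of unity. So the fixed point algebra is the sum of the \<open>h(0)\<close>-weight spaces with weight in \<open>6\<int>\<close>,
and its modes preserve \<open>h(0)\<close>-weights modulo 6. The weights of \<open>L(k,i)\<close> are congruent to \<open>i\<close> modulo 2,
which leaves three classes: the spaces \<open>charge d\<close>, which form a direct sum. Each of them is irreducible.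
Indeed, for \<open>w \<noteq> 0\<close> the vectors \<open>u(n) w\<close> span the irreducible module \<open>L(k,i)\<close>, by associativity, and a
vector in the class of \<open>w\<close> can only involve the components of \<open>u\<close> that are fixed by \<open>\<sigma>\<close>
(\<open>charge_irreducible\<close>). The classes are inequivalent because the twisted zero mode of \<open>h\<close> is \<open>h(0)\<close> plus
a constant, so that an equivalence would preserve \<open>h(0)\<close>-weights. The generators lie in the three
classes. They are nonzero because they are basis vectors of the lowest weight space or are mapped by
suitable positive modes to nonzero multiples of nonzero vectors (\<open>twisted_generator_charge\<close>).

\<^emph>\<open>The grading.\<close> The twisted \<open>L(0)\<close> is \<open>L(0) + (r/6) h(0)\<close> plus a constant. Since \<open>L(k,i)\<close> is spanned
by words in negative modes applied to the lowest weight space, \<open>h(0)\<close>-weights at level \<open>N\<close> are at most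
\<open>i + 2N\<close> in absolute value. For \<open>r \<le> 2\<close> the correction is therefore too small to destroy lower
boundedness or finite-dimensionality (\<open>twisted_weight_bound\<close>).
\<close>

section \<open>Eigenvectors of a linear map\<close>

lemma linear_on_UNIV:
  assumes "linear_on UNIV T"
  shows "T (x + y) = T x + T y" "T (c *\<^sub>C x) = c *\<^sub>C T x" "T 0 = 0" "T (- x) = - T x"
    "T (x - y) = T x - T y" "T (sum g A) = (\<Sum>a\<in>A. T (g a))"
proof -
  show add: "T (x + y) = T x + T y" for x y using assms by (simp add: linear_on_def)
  show sc: "T (c *\<^sub>C x) = c *\<^sub>C T x" for c x using assms by (simp add: linear_on_def)
  show zero: "T 0 = 0" using sc[of 0 0] by simp
  show neg: "T (- x) = - T x" for x using sc[of "-1" x] by simp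
  show "T (x - y) = T x - T y" using add[of x "-y"] neg[of y] by simp
  show "T (sum g A) = (\<Sum>a\<in>A. T (g a))"
    by (induction A rule: infinite_finite_induct) (simp_all add: zero add)
qed

lemma eigenvectors_independent:
  fixes l :: "'i \<Rightarrow> complex"
  assumes T: "linear_on UNIV T" and "finite A" and "inj_on l A"
    and "\<And>a. a \<in> A \<Longrightarrow> T (c a) = l a *\<^sub>C c a" and "(\<Sum>a\<in>A. c a) = 0"
  shows "\<forall>a\<in>A. c a = 0"
  using assms(2-)
proof (induction A arbitrary: c)
  case empty
  then show ?case by simp
next
  case (insert a A)
  have s: "c a + (\<Sum>b\<in>A. c b) = 0" using insert by simp
  have "T (c a + (\<Sum>b\<in>A. c b)) = 0" using s by (simp add: linear_on_UNIV[OF T])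
  then have "l a *\<^sub>C c a + (\<Sum>b\<in>A. l b *\<^sub>C c b) = 0"
    using insert by (simp add: linear_on_UNIV[OF T])
  moreover have "l a *\<^sub>C c a + (\<Sum>b\<in>A. l a *\<^sub>C c b) = 0"
    using arg_cong[OF s, of "\<lambda>x. l a *\<^sub>C x"]
    by (simp add: cvec.scale_right_distrib cvec.scale_sum_right)
  ultimately have "(\<Sum>b\<in>A. l b *\<^sub>C c b) - (\<Sum>b\<in>A. l a *\<^sub>C c b) = 0"
    by (metis add_left_cancel diff_self)
  then have "(\<Sum>b\<in>A. (l b - l a) *\<^sub>C c b) = 0"
    by (simp add: sum_subtractf cvec.scale_left_diff_distrib)
  moreover have "T ((l b - l a) *\<^sub>C c b) = l b *\<^sub>C (l b - l a) *\<^sub>C c b" if "b \<in> A" for b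
    using insert.prems(2)[of b] that by (simp add: linear_on_UNIV[OF T] mult.commute)
  ultimately have "\<forall>b\<in>A. (l b - l a) *\<^sub>C c b = 0"
    using insert.IH[of "\<lambda>b. (l b - l a) *\<^sub>C c b"] insert.prems(1) by simp
  then have "\<forall>b\<in>A. c b = 0"
    using insert.prems(1) insert.hyps(2) by (auto simp: inj_on_def)
  with s show ?case by simp
qed

lemma span_eigenvectors_sum:
  assumes T: "linear_on UNIV T" and X: "\<forall>y\<in>X. \<exists>a\<in>A. T y = a *\<^sub>C y" and x: "x \<in> cvec.span X"
  shows "\<exists>F c. finite F \<and> F \<subseteq> A \<and> (\<forall>a\<in>F. T (c a) = a *\<^sub>C c a) \<and> x = (\<Sum>a\<in>F. c a)"
  using x
proof (induction rule: cvec.span_induct_alt)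
  case base
  show ?case by (rule exI[of _ "{}"]) simp
next
  case (step k y z)
  then obtain F c where F: "finite F" "F \<subseteq> A" "\<forall>a\<in>F. T (c a) = a *\<^sub>C c a" "z = (\<Sum>a\<in>F. c a)"
    by blast
  obtain a where a: "a \<in> A" "T y = a *\<^sub>C y" using X step by blast
  define d where "d b = (if b \<in> F then c b else 0)" for b
  define c' where "c' = d(a := d a + k *\<^sub>C y)"
  have "(\<Sum>b\<in>insert a F. c' b) = c' a + (\<Sum>b\<in>F - {a}. c' b)"
    using F(1) by (simp add: sum.insert_remove)
  also have "(\<Sum>b\<in>F - {a}. c' b) = (\<Sum>b\<in>F - {a}. c b)"
    by (rule sum.cong) (auto simp: c'_def d_def)
  also have "c' a + \<dots> = k *\<^sub>C y + z"
    using F(1,4) by (cases "a \<in> F") (auto simp: c'_def d_def sum.remove[of F a] add_ac)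
  finally have "k *\<^sub>C y + z = (\<Sum>b\<in>insert a F. c' b)" by simp
  moreover have "\<forall>b\<in>insert a F. T (c' b) = b *\<^sub>C c' b"
    using F(3) a by (auto simp: c'_def d_def linear_on_UNIV[OF T] cvec.scale_right_distrib mult.commute)
  ultimately show ?case using F a by (metis finite_insert insert_subset)
qed

lemma eigenvector_spans_disjoint:
  assumes T: "linear_on UNIV T"
    and X: "\<forall>y\<in>X. \<exists>a\<in>A. T y = a *\<^sub>C y" and Z: "\<forall>y\<in>Z. \<exists>a\<in>B. T y = a *\<^sub>C y" and AB: "A \<inter> B = {}"
    and x: "x \<in> cvec.span X" "x \<in> cvec.span Z"
  shows "x = 0"
proof -
  obtain F c where F: "finite F" "F \<subseteq> A" "\<forall>a\<in>F. T (c a) = a *\<^sub>C c a" "x = (\<Sum>a\<in>F. c a)"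
    using span_eigenvectors_sum[OF T X x(1)] by blast
  obtain G d where G: "finite G" "G \<subseteq> B" "\<forall>a\<in>G. T (d a) = a *\<^sub>C d a" "x = (\<Sum>a\<in>G. d a)"
    using span_eigenvectors_sum[OF T Z x(2)] by blast
  define e where "e a = (if a \<in> F then c a else - d a)" for a
  have dis: "F \<inter> G = {}" using F G AB by blast
  have "(\<Sum>a\<in>F \<union> G. e a) = (\<Sum>a\<in>F. e a) + (\<Sum>a\<in>G. e a)"
    using F G dis by (intro sum.union_disjoint) auto
  also have "(\<Sum>a\<in>G. e a) = (\<Sum>a\<in>G. - d a)" using dis by (intro sum.cong) (auto simp: e_def)
  also have "(\<Sum>a\<in>F. e a) = x" using F by (simp add: e_def)
  finally have "(\<Sum>a\<in>F \<union> G. e a) = 0" using G by (simp add: sum_negf)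
  then have "\<forall>a\<in>F \<union> G. e a = 0"
    using F G by (intro eigenvectors_independent[OF T, where l = "\<lambda>a. a"])
      (auto simp: e_def linear_on_UNIV[OF T])
  then have "\<forall>a\<in>F. c a = 0" by (auto simp: e_def split: if_splits)
  then show ?thesis using F by simp
qed

text \<open>
A spanning set of eigenvectors splits into those with eigenvalue \<open>c\<close> and the others, and the part of an
eigenvector carried by the others lies in two spans with disjoint eigenvalues.
\<close>

lemma eigenspace_subset_span:
  assumes T: "linear_on UNIV T" and span: "cvec.span X = UNIV" and X: "\<forall>x\<in>X. \<exists>a. T x = a *\<^sub>C x"
    and y: "T y = c *\<^sub>C y"
  shows "y \<in> cvec.span {x \<in> X. T x = c *\<^sub>C x}"
proof -
  let ?P = "{x \<in> X. T x = c *\<^sub>C x}" and ?Q = "{x \<in> X. T x \<noteq> c *\<^sub>C x}"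
  have "?P \<union> ?Q = X" by auto
  then have "y \<in> cvec.span (?P \<union> ?Q)" using span by simp
  then obtain a b where ab: "y = a + b" "a \<in> cvec.span ?P" "b \<in> cvec.span ?Q"
    unfolding cvec.span_Un by blast
  have "a \<in> cvec.span {x. T x = c *\<^sub>C x}" using ab(2) cvec.span_mono[of ?P "{x. T x = c *\<^sub>C x}"] by blast
  then have "y - a \<in> cvec.span {x. T x = c *\<^sub>C x}" using y
    by (intro cvec.span_diff) (auto intro: cvec.span_base)
  then have "b \<in> cvec.span {x. T x = c *\<^sub>C x}" using ab(1) by simp
  then have "b = 0"
    using X by (intro eigenvector_spans_disjoint[OF T, of "{x. T x = c *\<^sub>C x}" "{c}" ?Q "- {c}"])
      (use ab(3) in auto)
  with ab show ?thesis by simp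
qed

text \<open>
These are the families quantified over in \<^const>\<open>eigen_component\<close>. Uniqueness makes the definite
description there well defined, and closure under linear combinations makes it linear.
\<close>

definition rat_decomposition :: "('a::complex_vector \<Rightarrow> 'a) \<Rightarrow> 'a \<Rightarrow> (rat \<Rightarrow> 'a) \<Rightarrow> bool" where
  "rat_decomposition T x c \<longleftrightarrow>
     finite {q. c q \<noteq> 0} \<and> (\<forall>q. T (c q) = of_rat q *\<^sub>C c q) \<and> x = Sum_any c"

lemma rat_decomposition_unique:
  assumes T: "linear_on UNIV T" and "rat_decomposition T x c" "rat_decomposition T x d"
  shows "c = d"
proof
  fix q
  define F where "F = insert q ({q. c q \<noteq> 0} \<union> {q. d q \<noteq> 0})"
  have F: "finite F" using assms by (simp add: F_def rat_decomposition_def)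
  have "Sum_any c = sum c F" "Sum_any d = sum d F"
    using F by (auto simp: F_def intro!: Sum_any.expand_superset)
  then have "sum c F = sum d F" using assms by (simp add: rat_decomposition_def)
  then have "(\<Sum>a\<in>F. c a - d a) = 0" by (simp add: sum_subtractf)
  then have "\<forall>a\<in>F. c a - d a = 0"
    using assms F by (intro eigenvectors_independent[OF T, where l = of_rat])
      (auto simp: rat_decomposition_def linear_on_UNIV[OF T] cvec.scale_right_diff_distrib inj_on_def)
  then show "c q = d q" by (simp add: F_def)
qed

lemma eigen_component_eqI:
  assumes "linear_on UNIV T" "rat_decomposition T x c"
  shows "eigen_component T x = c"
  unfolding eigen_component_def
  using assms rat_decomposition_unique[OF assms(1)]
  by (intro the_equality) (auto simp: rat_decomposition_def)

lemma rat_decomposition_add: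
  assumes T: "linear_on UNIV T" and "rat_decomposition T x c" "rat_decomposition T y d"
  shows "rat_decomposition T (x + y) (\<lambda>q. c q + d q)"
proof -
  have f: "finite {q. c q \<noteq> 0}" "finite {q. d q \<noteq> 0}" using assms by (auto simp: rat_decomposition_def)
  have "finite {q. c q + d q \<noteq> 0}" 
    by (rule finite_subset[OF _ finite_UnI[OF f]]) auto
  then show ?thesis using assms Sum_any.distrib[OF f]
    by (auto simp: rat_decomposition_def linear_on_UNIV[OF T] cvec.scale_right_distrib)
qed

lemma rat_decomposition_scale:
  assumes T: "linear_on UNIV T" and "rat_decomposition T x c"
  shows "rat_decomposition T (k *\<^sub>C x) (\<lambda>q. k *\<^sub>C c q)"
proof -
  have f: "finite {q. c q \<noteq> 0}" using assms by (auto simp: rat_decomposition_def)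
  have f': "{q. k *\<^sub>C c q \<noteq> 0} \<subseteq> {q. c q \<noteq> 0}" by auto
  have "k *\<^sub>C Sum_any c = (\<Sum>q\<in>{q. c q \<noteq> 0}. k *\<^sub>C c q)"
    by (simp add: Sum_any.expand_set cvec.scale_sum_right)
  also have "\<dots> = Sum_any (\<lambda>q. k *\<^sub>C c q)" using Sum_any.expand_superset[OF f f'] by simp
  finally show ?thesis using assms finite_subset[OF f' f]
    by (auto simp: rat_decomposition_def linear_on_UNIV[OF T] mult.commute)
qed

lemma rat_decomposition_eigenvector:
  assumes T: "linear_on UNIV T" and "T x = of_rat a *\<^sub>C x"
  shows "rat_decomposition T x (\<lambda>q. if q = a then x else 0)"
proof -
  have "finite {q. (if q = a then x else 0) \<noteq> 0}"
    by (rule finite_subset[of _ "{a}"]) auto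
  then show ?thesis using assms by (auto simp: rat_decomposition_def linear_on_UNIV[OF T])
qed

section \<open>Modules over a vertex operator algebra\<close>

lemma Sum_any_nat_eq_sum:
  fixes f :: "nat \<Rightarrow> 'a::comm_monoid_add"
  assumes "\<And>n. n \<ge> N \<Longrightarrow> f n = 0"
  shows "Sum_any f = sum f {..<N}"
  using assms by (intro Sum_any.expand_superset) (auto simp: not_less[symmetric])

text \<open>
The Borcherds identity is an equality between sums over finite supports. Comparing partial sums up to
every sufficiently large bound is equivalent, and is stable under linear combinations and under
exchanging sums.
\<close>

lemma Sum_any_eq_iff_eventually:
  fixes f g :: "nat \<Rightarrow> 'a::comm_monoid_add"
  assumes "\<exists>N. \<forall>n\<ge>N. f n = 0" "\<exists>N. \<forall>n\<ge>N. g n = 0"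
  shows "Sum_any f = Sum_any g \<longleftrightarrow> (\<exists>N. \<forall>n\<ge>N. sum f {..<n} = sum g {..<n})"
proof -
  obtain N1 N2 where N: "\<forall>n\<ge>N1. f n = 0" "\<forall>n\<ge>N2. g n = 0" using assms by blast
  have "Sum_any f = sum f {..<n}" "Sum_any g = sum g {..<n}" if "n \<ge> max N1 N2" for n
    using N that by (auto intro!: Sum_any_nat_eq_sum)
  then show ?thesis by (metis max.cobounded1 max.bounded_iff nle_le)
qed

text \<open>
A module filling its ambient space, over an algebra filling its ambient space. The adjoint module is
an instance as well, which lets the same facts serve for \<open>L(k,0)\<close> and for \<open>L(k,i)\<close>.
\<close>

locale full_module =
  voa_module "UNIV :: 'v::complex_vector set" Y vac conf "UNIV :: 'm::complex_vector set" YW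
  for Y :: "'v::complex_vector \<Rightarrow> int \<Rightarrow> 'v \<Rightarrow> 'v" and vac conf :: 'v
    and YW :: "'v \<Rightarrow> int \<Rightarrow> 'm::complex_vector \<Rightarrow> 'm"
begin

sublocale V: vertex_operator_algebra "UNIV :: 'v set" Y vac conf by (rule algebra)

lemma linear_state': "linear_on UNIV (\<lambda>u. YW u n w)" using linear_state by simp
lemma linear_mode': "linear_on UNIV (YW u n)" using linear_mode by simp
lemma V_linear_state': "linear_on UNIV (\<lambda>u. Y u n w)" using V.linear_state by simp
lemma V_linear_mode': "linear_on UNIV (Y u n)" using V.linear_mode by simp

lemmas mode_simps = linear_on_UNIV[OF linear_state'] linear_on_UNIV[OF linear_mode']
lemmas V_mode_simps = linear_on_UNIV[OF V_linear_state'] linear_on_UNIV[OF V_linear_mode']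

definition borcherds_lhs :: "'v \<Rightarrow> 'v \<Rightarrow> 'm \<Rightarrow> int \<Rightarrow> int \<Rightarrow> int \<Rightarrow> nat \<Rightarrow> 'm" where
  "borcherds_lhs u v w p q r i =
     ((of_int p :: complex) gchoose i) *\<^sub>C YW (Y u (r + int i) v) (p + q - int i) w"

definition borcherds_rhs :: "'v \<Rightarrow> 'v \<Rightarrow> 'm \<Rightarrow> int \<Rightarrow> int \<Rightarrow> int \<Rightarrow> nat \<Rightarrow> 'm" where
  "borcherds_rhs u v w p q r i =
     ((-1) ^ i * ((of_int r :: complex) gchoose i)) *\<^sub>C
       (YW u (p + r - int i) (YW v (q + int i) w)
        - ((-1) powi r) *\<^sub>C YW v (q + r - int i) (YW u (p + int i) w))"

lemma truncation': "\<exists>N::nat. \<forall>i\<ge>N. YW u (p + int i) w = 0"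
proof -
  obtain N where "\<forall>n\<ge>N. YW u n w = 0" using truncation by blast
  then have "\<forall>i\<ge>nat (N - p). YW u (p + int i) w = 0" by auto
  then show ?thesis by blast
qed

lemma V_truncation': "\<exists>N::nat. \<forall>i\<ge>N. Y u (p + int i) v = 0"
proof -
  obtain N where "\<forall>n\<ge>N. Y u n v = 0" using V.truncation by blast
  then have "\<forall>i\<ge>nat (N - p). Y u (p + int i) v = 0" by auto
  then show ?thesis by blast
qed

lemma borcherds_eventually:
  "\<exists>I. \<forall>n\<ge>I. (\<Sum>i<n. borcherds_lhs u v w p q r i) = (\<Sum>i<n. borcherds_rhs u v w p q r i)"
proof -
  obtain N where N: "\<forall>i\<ge>N. Y u (r + int i) v = 0" using V_truncation' by blast
  then have "\<forall>i\<ge>N. borcherds_lhs u v w p q r i = 0"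
    by (auto simp: borcherds_lhs_def mode_simps)
  then have 1: "\<exists>N. \<forall>i\<ge>N. borcherds_lhs u v w p q r i = 0" by blast
  obtain N1 where N1: "\<forall>i\<ge>N1. YW u (p + int i) w = 0" using truncation' by blast
  obtain N2 where N2: "\<forall>i\<ge>N2. YW v (q + int i) w = 0" using truncation' by blast
  have "\<forall>i\<ge>max N1 N2. borcherds_rhs u v w p q r i = 0"
    using N1 N2 by (auto simp: borcherds_rhs_def mode_simps)
  then have 2: "\<exists>N. \<forall>i\<ge>N. borcherds_rhs u v w p q r i = 0" by blast
  have "Sum_any (borcherds_lhs u v w p q r) = Sum_any (borcherds_rhs u v w p q r)"
    using jacobi unfolding borcherds_identity_def borcherds_lhs_def borcherds_rhs_def by blast
  then show ?thesis using Sum_any_eq_iff_eventually[OF 1 2] by blast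
qed

text \<open>
The case \<open>r = 0\<close> of the Borcherds identity: only the first term of the right-hand side survives.
\<close>

lemma commutator:
  assumes N: "\<And>i. i \<ge> N \<Longrightarrow> Y u (int i) v = 0 \<or> (of_int p :: complex) gchoose i = 0"
  shows "YW u p (YW v q w) - YW v q (YW u p w) =
     (\<Sum>i<N. ((of_int p :: complex) gchoose i) *\<^sub>C YW (Y u (int i) v) (p + q - int i) w)"
proof -
  obtain I where I: "\<forall>n\<ge>I. (\<Sum>i<n. borcherds_lhs u v w p q 0 i) = (\<Sum>i<n. borcherds_rhs u v w p q 0 i)"
    using borcherds_eventually by blast
  define n where "n = max (Suc I) N"
  have "(\<Sum>i<n. borcherds_rhs u v w p q 0 i) = (\<Sum>i\<in>{0}. borcherds_rhs u v w p q 0 i)"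
    by (rule sum.mono_neutral_right) (auto simp: n_def borcherds_rhs_def gbinomial_0_left)
  moreover have "(\<Sum>i<n. borcherds_lhs u v w p q 0 i) = (\<Sum>i<N. borcherds_lhs u v w p q 0 i)"
  proof (rule sum.mono_neutral_right)
    show "\<forall>i\<in>{..<n} - {..<N}. borcherds_lhs u v w p q 0 i = 0"
    proof
      fix i assume "i \<in> {..<n} - {..<N}"
      then show "borcherds_lhs u v w p q 0 i = 0"
        using N[of i] by (auto simp: borcherds_lhs_def mode_simps)
    qed
  qed (auto simp: n_def)
  ultimately show ?thesis using I[rule_format, of n]
    by (simp add: n_def borcherds_lhs_def borcherds_rhs_def)
qed

lemma commutator_nonneg:
  "YW u (int j) (YW v q w) = YW v q (YW u (int j) w) +
     (\<Sum>t\<le>j. of_nat (j choose t) *\<^sub>C YW (Y u (int t) v) (int j + q - int t) w)"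
proof -
  have "YW u (int j) (YW v q w) - YW v q (YW u (int j) w) =
     (\<Sum>i<Suc j. ((of_int (int j) :: complex) gchoose i) *\<^sub>C YW (Y u (int i) v) (int j + q - int i) w)"
    by (rule commutator) (auto simp: binomial_gbinomial[symmetric])
  also have "\<dots> = (\<Sum>t\<le>j. of_nat (j choose t) *\<^sub>C YW (Y u (int t) v) (int j + q - int t) w)"
    by (simp add: lessThan_Suc_atMost binomial_gbinomial)
  finally show ?thesis by (simp add: diff_eq_eq add.commute)
qed

text \<open>
For \<open>p = 0\<close> the Borcherds identity writes the modes of \<open>u\<^sub>r v\<close> as combinations of products of modes
of \<open>u\<close> and \<open>v\<close>.
\<close>

lemma iterate_closed:
  assumes S: "cvec.subspace S" and u: "\<And>n w. w \<in> S \<Longrightarrow> YW u n w \<in> S"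
    and v: "\<And>n w. w \<in> S \<Longrightarrow> YW v n w \<in> S" and w: "w \<in> S"
  shows "YW (Y u r v) q w \<in> S"
proof -
  obtain I where I: "\<forall>n\<ge>I. (\<Sum>i<n. borcherds_lhs u v w 0 q r i) = (\<Sum>i<n. borcherds_rhs u v w 0 q r i)"
    using borcherds_eventually by blast
  have "(\<Sum>i<Suc I. borcherds_lhs u v w 0 q r i) = (\<Sum>i\<in>{0}. borcherds_lhs u v w 0 q r i)"
    by (rule sum.mono_neutral_right) (auto simp: borcherds_lhs_def gbinomial_0_left)
  then have "YW (Y u r v) q w = (\<Sum>i<Suc I. borcherds_rhs u v w 0 q r i)"
    using I[rule_format, of "Suc I"] by (simp add: borcherds_lhs_def)
  also have "\<dots> \<in> S" unfolding borcherds_rhs_def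
    using S u v w by (intro cvec.subspace_sum cvec.subspace_scale cvec.subspace_diff) auto
  finally show ?thesis .
qed

text \<open>
If \<open>p\<close> in the Borcherds identity is chosen so large that \<open>u(p + i) w = 0\<close>, the second half of the
right-hand side disappears and the left-hand side is a combination of vectors \<open>x(n) w\<close>. The first half
has the leading term \<open>u(p) v(q) w\<close> and further terms with larger \<open>q\<close>, which ends after finitely many
steps because \<open>v(q) w = 0\<close> for large \<open>q\<close>.
\<close>

lemma associativity_span:
  "YW u p (YW v q w) \<in> cvec.span {YW x n w | x n. True}" (is "_ \<in> cvec.span ?X")
proof -
  obtain N where N: "\<forall>n\<ge>N. YW u n w = 0" using truncation by blast
  obtain Q where Q: "\<forall>n\<ge>Q. YW v n w = 0" using truncation by blast
  have "\<forall>p. YW u p (YW v q w) \<in> cvec.span ?X" if "nat (Q - q) = d" for d q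
    using that
  proof (induction d arbitrary: q rule: less_induct)
    case (less d)
    show ?case
    proof
      fix p
      show "YW u p (YW v q w) \<in> cvec.span ?X"
      proof (cases "q \<ge> Q")
        case True
        then show ?thesis using Q by (simp add: mode_simps cvec.span_zero)
      next
        case False
        obtain I where I: "\<forall>n\<ge>I. (\<Sum>i<n. borcherds_lhs u v w N q (p - N) i)
            = (\<Sum>i<n. borcherds_rhs u v w N q (p - N) i)"
          using borcherds_eventually by blast
        let ?R = "borcherds_rhs u v w N q (p - N)"
        have R: "?R i = ((-1) ^ i * ((of_int (p - N) :: complex) gchoose i)) *\<^sub>C
            YW u (p - int i) (YW v (q + int i) w)" for i
          using N by (simp add: borcherds_rhs_def mode_simps)
        have "(\<Sum>i<Suc I. borcherds_lhs u v w N q (p - N) i) \<in> cvec.span ?X"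
          unfolding borcherds_lhs_def
          by (intro cvec.span_sum cvec.span_scale cvec.span_base) blast
        then have "(\<Sum>i<Suc I. ?R i) \<in> cvec.span ?X" using I[rule_format, of "Suc I"] by simp
        moreover have "(\<Sum>i<I. ?R (Suc i)) \<in> cvec.span ?X"
        proof (intro cvec.span_sum)
          fix i
          have "nat (Q - (q + int (Suc i))) < d" using less.prems False by simp
          then show "?R (Suc i) \<in> cvec.span ?X" unfolding R
            using less.IH by (intro cvec.span_scale) blast
        qed
        moreover have "(\<Sum>i<Suc I. ?R i) = ?R 0 + (\<Sum>i<I. ?R (Suc i))"
          by (rule sum.lessThan_Suc_shift)
        ultimately have "?R 0 \<in> cvec.span ?X"
          by (metis add_diff_cancel_right' cvec.span_diff)
        then show ?thesis by (simp add: R)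
      qed
    qed
  qed
  then show ?thesis by blast
qed

text \<open>
In an irreducible module every nonzero vector generates in a single step: no products of modes are
needed.
\<close>

lemma span_modes_eq_UNIV:
  assumes irr: "\<forall>S. S \<subseteq> UNIV \<longrightarrow> stable_subspace UNIV YW S \<longrightarrow> S = {0} \<or> S = UNIV" and w: "w \<noteq> 0"
  shows "cvec.span {YW x n w | x n. True} = UNIV" (is "cvec.span ?X = _")
proof -
  have "YW u p x \<in> cvec.span ?X" if "x \<in> cvec.span ?X" for u p x
    using that
  proof (induction rule: cvec.span_induct_alt)
    case base
    then show ?case by (simp add: mode_simps cvec.span_zero)
  next
    case (step c x y)
    then show ?case
      using associativity_span
      by (auto simp: mode_simps intro!: cvec.span_add cvec.span_scale)
  qed
  then have "stable_subspace UNIV YW (cvec.span ?X)"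
    by (auto simp: stable_subspace_def)
  moreover have "w \<in> cvec.span ?X"
    using vacuum[of w "-1"] by (intro cvec.span_base) (auto intro!: exI[of _ vac] exI[of _ "-1"])
  ultimately show ?thesis using irr w by blast
qed

lemma stable_if_generators_stable:
  assumes gen: "stable_subspace X Y hull {vac} = UNIV" and S: "cvec.subspace S"
    and X: "\<And>a n w. a \<in> X \<Longrightarrow> w \<in> S \<Longrightarrow> YW a n w \<in> S"
  shows "stable_subspace UNIV YW S"
proof -
  let ?T = "{u. \<forall>n. \<forall>w\<in>S. YW u n w \<in> S}"
  have "stable_subspace X Y ?T"
    unfolding stable_subspace_def
  proof (intro conjI ballI allI)
    show "cvec.subspace ?T"
      using S by (intro cvec.subspaceI)
        (auto simp: mode_simps intro: cvec.subspace_0 cvec.subspace_add cvec.subspace_scale)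
    show "Y u n x \<in> ?T" if "u \<in> X" "x \<in> ?T" for u n x
      using that X S by (auto intro!: iterate_closed)
  qed
  moreover have "{vac} \<subseteq> ?T" using S by (auto simp: vacuum intro: cvec.subspace_0)
  ultimately have "?T = UNIV" using gen hull_minimal[of "{vac}" ?T "stable_subspace X Y"] by blast
  then show ?thesis using S by (auto simp: stable_subspace_def)
qed

end

section \<open>The exponential of commuting modes\<close>

text \<open>
The index set of the sum defining \<^const>\<open>exp_coeff\<close>.
\<close>

definition compositions :: "nat \<Rightarrow> nat list set" where
  "compositions m = {ns. sum_list ns = m \<and> 0 \<notin> set ns}"

lemma length_le_sum_list: "0 \<notin> set ns \<Longrightarrow> length ns \<le> sum_list (ns :: nat list)"
  by (induction ns) auto

lemma finite_compositions: "finite (compositions m)"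
proof (rule finite_subset)
  show "compositions m \<subseteq> {ns. set ns \<subseteq> {..m} \<and> length ns \<le> m}"
    using length_le_sum_list member_le_sum_list by (fastforce simp: compositions_def)
  show "finite {ns. set ns \<subseteq> {..m} \<and> length ns \<le> m}" by (rule finite_lists_length_le) simp
qed

lemma sum_list_rotate: "sum_list (rotate j ns) = sum_list (ns :: nat list)"
proof (induction j)
  case (Suc j)
  have "sum_list (rotate1 xs) = sum_list xs" for xs :: "nat list" by (cases xs) auto
  then show ?case using Suc by simp
qed simp

lemma rotate_compositions: "bij_betw (rotate j) (compositions m) (compositions m)"
proof -
  have "inj (rotate j :: nat list \<Rightarrow> nat list)"
    unfolding rotate_def by (rule inj_fn[OF inj_rotate1])
  then have inj: "inj_on (rotate j) (compositions m)" by (rule inj_on_subset) simp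
  have "rotate j ` compositions m \<subseteq> compositions m"
    by (auto simp: compositions_def sum_list_rotate)
  then show ?thesis
    using endo_inj_surj[OF finite_compositions _ inj] inj by (auto simp: bij_betw_def)
qed

lemma sum_list_conv_hd_rotate: "sum_list (ns :: nat list) = (\<Sum>j<length ns. hd (rotate j ns))"
proof -
  have "(\<Sum>j<length ns. hd (rotate j ns)) = (\<Sum>j<length ns. ns ! j)"
  proof (rule sum.cong[OF refl])
    fix j assume "j \<in> {..<length ns}"
    moreover from this have "ns \<noteq> []" by auto
    ultimately show "hd (rotate j ns) = ns ! j" by (simp add: hd_rotate_conv_nth)
  qed
  then show ?thesis by (simp add: sum_list_sum_nth atLeast0LessThan)
qed

text \<open>
  Averaging over rotations: the sum of the parts of a composition may be replaced by its first part
  times its length. This turns the Euler operator on the exponential series into a recurrence.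
\<close>

lemma sum_compositions_rotate:
  fixes g :: "nat list \<Rightarrow> 'a::complex_vector"
  assumes g: "\<And>j ns. ns \<in> compositions s \<Longrightarrow> g (rotate j ns) = g ns"
  shows "(\<Sum>ns\<in>compositions s. of_nat (sum_list ns) *\<^sub>C g ns) =
    (\<Sum>ns\<in>compositions s. of_nat (length ns * hd ns) *\<^sub>C g ns)"
proof -
  let ?C = "compositions s"
  have len: "length ns \<le> s" if "ns \<in> ?C" for ns
    using that length_le_sum_list by (auto simp: compositions_def)
  have restrict: "(\<Sum>j<length ns. h j) = (\<Sum>j<s. if j < length ns then h j else 0)"
    if "ns \<in> ?C" for ns and h :: "nat \<Rightarrow> 'a"
  proof -
    have "{..<s} \<inter> {j. j < length ns} = {..<length ns}" using len[OF that] by auto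
    then show ?thesis by (simp add: sum.If_cases)
  qed
  have "(\<Sum>ns\<in>?C. of_nat (sum_list ns) *\<^sub>C g ns)
      = (\<Sum>ns\<in>?C. \<Sum>j<s. if j < length ns then of_nat (hd (rotate j ns)) *\<^sub>C g (rotate j ns) else 0)"
  proof (rule sum.cong[OF refl])
    fix ns assume ns: "ns \<in> ?C"
    have "of_nat (sum_list ns) *\<^sub>C g ns = (\<Sum>j<length ns. of_nat (hd (rotate j ns)) *\<^sub>C g (rotate j ns))"
      using g[OF ns] by (simp add: sum_list_conv_hd_rotate cvec.scale_sum_left)
    then show "of_nat (sum_list ns) *\<^sub>C g ns
        = (\<Sum>j<s. if j < length ns then of_nat (hd (rotate j ns)) *\<^sub>C g (rotate j ns) else 0)"
      using restrict[OF ns] by simp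
  qed
  also have "\<dots> = (\<Sum>j<s. \<Sum>ns\<in>?C. if j < length (rotate j ns)
      then of_nat (hd (rotate j ns)) *\<^sub>C g (rotate j ns) else 0)"
    by (subst sum.swap) simp
  also have "\<dots> = (\<Sum>j<s. \<Sum>ns\<in>?C. if j < length ns then of_nat (hd ns) *\<^sub>C g ns else 0)"
    by (intro sum.cong refl sum.reindex_bij_betw[OF rotate_compositions])
  also have "\<dots> = (\<Sum>ns\<in>?C. \<Sum>j<s. if j < length ns then of_nat (hd ns) *\<^sub>C g ns else 0)"
    by (rule sum.swap)
  also have "\<dots> = (\<Sum>ns\<in>?C. \<Sum>j<length ns. of_nat (hd ns) *\<^sub>C g ns)"
    by (intro sum.cong refl restrict[symmetric])
  also have "\<dots> = (\<Sum>ns\<in>?C. of_nat (length ns * hd ns) *\<^sub>C g ns)"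
    by (simp add: cvec.sum_constant_scale)
  finally show ?thesis .
qed

locale commuting_modes =
  fixes H :: "int \<Rightarrow> 'v::complex_vector \<Rightarrow> 'v"
  assumes H_linear: "linear_on UNIV (H n)"
    and H_commute: "m \<ge> 0 \<Longrightarrow> n \<ge> 0 \<Longrightarrow> H m (H n x) = H n (H m x)"
begin

lemmas H_simps = linear_on_UNIV[OF H_linear]

definition monomial :: "nat list \<Rightarrow> 'v \<Rightarrow> 'v" where
  "monomial ns x = foldr (\<lambda>n y. ((-1) ^ n / - of_nat n) *\<^sub>C H (int n) y) ns x"

lemma monomial_Nil [simp]: "monomial [] x = x"
  and monomial_Cons [simp]:
    "monomial (n # ns) x = ((-1) ^ n / - of_nat n) *\<^sub>C H (int n) (monomial ns x)"
  by (simp_all add: monomial_def)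

lemma exp_coeff_monomial:
  "exp_coeff H m x = (\<Sum>ns\<in>compositions m. (1 / fact (length ns)) *\<^sub>C monomial ns x)"
  by (simp add: exp_coeff_def compositions_def monomial_def)

lemma monomial_snoc:
  assumes "0 \<notin> set ns" "n \<ge> 1"
  shows "monomial (ns @ [n]) x = monomial (n # ns) x"
  using assms
proof (induction ns)
  case (Cons a ns)
  then have "H (int a) (H (int n) y) = H (int n) (H (int a) y)" for y by (intro H_commute) auto
  then show ?case using Cons by (simp add: H_simps mult.commute)
qed simp

lemma monomial_rotate: "0 \<notin> set ns \<Longrightarrow> monomial (rotate j ns) x = monomial ns x"
proof (induction j)
  case (Suc j)
  have "monomial (rotate1 xs) x = monomial xs x" if "0 \<notin> set xs" for xs
    using that monomial_snoc by (cases xs) (auto simp del: monomial_Cons)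
  then show ?case using Suc by simp
qed simp

lemma exp_coeff_0 [simp]: "exp_coeff H 0 x = x"
proof -
  have "compositions 0 = {[]}" unfolding compositions_def
    by (auto simp: sum_list_eq_0_iff) (metis list.set_intros(1) neq_Nil_conv)
  then show ?thesis by (simp add: exp_coeff_monomial)
qed

text \<open>
The coefficient form of \<open>z d/dz exp(A(z)) = (z d/dz A(z)) exp(A(z))\<close>. The degree \<open>s\<close> of a composition is
the sum of its parts; averaging over rotations trades it for the first part times the length, the length
cancels one factor of the factorial, and the first part cancels the denominator of \<open>H(n)/(-n)\<close>.
\<close>

lemma exp_coeff_recurrence:
  "of_nat s *\<^sub>C exp_coeff H s x =
     (\<Sum>n=1..s. (-1) ^ (n + 1) *\<^sub>C H (int n) (exp_coeff H (s - n) x))"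
proof (cases "s = 0")
  case False
  let ?g = "\<lambda>ns. (1 / fact (length ns)) *\<^sub>C monomial ns x"
  have bij: "bij_betw (\<lambda>(n, ns). n # ns) (SIGMA n:{1..s}. compositions (s - n)) (compositions s)"
  proof (rule bij_betwI[where g = "\<lambda>ns. (hd ns, tl ns)"])
    have "\<exists>n ms. ns = n # ms \<and> n \<in> {1..s} \<and> ms \<in> compositions (s - n)" if "ns \<in> compositions s" for ns
      using that False by (cases ns) (auto simp: compositions_def)
    then show "(\<lambda>ns. (hd ns, tl ns)) \<in> compositions s \<rightarrow> (SIGMA n:{1..s}. compositions (s - n))"
      "\<And>ns. ns \<in> compositions s \<Longrightarrow> (case (hd ns, tl ns) of (n, ns) \<Rightarrow> n # ns) = ns"
      by fastforce+
  qed (auto simp: compositions_def)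
  have "of_nat s *\<^sub>C exp_coeff H s x = (\<Sum>ns\<in>compositions s. of_nat (sum_list ns) *\<^sub>C ?g ns)"
    unfolding exp_coeff_monomial cvec.scale_sum_right
    by (intro sum.cong) (auto simp: compositions_def)
  also have "\<dots> = (\<Sum>ns\<in>compositions s. of_nat (length ns * hd ns) *\<^sub>C ?g ns)"
    by (rule sum_compositions_rotate) (simp add: compositions_def monomial_rotate)
  also have "\<dots> = (\<Sum>(n, ns)\<in>(SIGMA n:{1..s}. compositions (s - n)).
      of_nat (length (n # ns) * hd (n # ns)) *\<^sub>C ?g (n # ns))"
    using sum.reindex_bij_betw[OF bij, of "\<lambda>ns. of_nat (length ns * hd ns) *\<^sub>C ?g ns"]
    by (simp add: case_prod_beta)
  also have "\<dots> = (\<Sum>n=1..s. \<Sum>ns\<in>compositions (s - n).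
      of_nat (length (n # ns) * hd (n # ns)) *\<^sub>C ?g (n # ns))"
    by (rule sum.Sigma[symmetric]) (auto simp: finite_compositions)
  also have "\<dots> = (\<Sum>n=1..s. (-1) ^ (n + 1) *\<^sub>C H (int n) (exp_coeff H (s - n) x))"
  proof (intro sum.cong refl)
    fix n assume n: "n \<in> {1..s}"
    have "of_nat (length (n # ns) * hd (n # ns)) *\<^sub>C ?g (n # ns)
        = (-1) ^ (n + 1) *\<^sub>C H (int n) (?g ns)" for ns
    proof -
      have "complex_of_nat (length (n # ns) * hd (n # ns)) * (1 / fact (length (n # ns)))
          * ((-1) ^ n / - of_nat n) = (-1) ^ (n + 1) * (1 / fact (length ns))"
      proof -
        have "complex_of_nat (length (n # ns) * hd (n # ns)) * (1 / fact (length (n # ns)))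
            = of_nat n * (1 / fact (length ns))"
          using of_nat_neq_0[of "length ns", where 'a = complex] by (simp del: of_nat_Suc mult_Suc)
        then show ?thesis using n by simp
      qed
      then show ?thesis by (simp only: monomial_Cons H_simps cvec.scale_scale mult.assoc[symmetric])
    qed
    then show "(\<Sum>ns\<in>compositions (s - n). of_nat (length (n # ns) * hd (n # ns)) *\<^sub>C ?g (n # ns))
        = (-1) ^ (n + 1) *\<^sub>C H (int n) (exp_coeff H (s - n) x)"
      by (simp only: exp_coeff_monomial H_simps cvec.scale_sum_right)
  qed
  finally show ?thesis .
qed simp

lemma exp_coeff_eqI:
  assumes "s > 0" and "(\<Sum>n=1..s. (-1) ^ (n + 1) *\<^sub>C H (int n) (exp_coeff H (s - n) x)) = of_nat s *\<^sub>C y"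
  shows "exp_coeff H s x = y"
  using assms exp_coeff_recurrence[of s x] by simp

lemma exp_coeff_commute: "j \<ge> 0 \<Longrightarrow> H j (exp_coeff H s x) = exp_coeff H s (H j x)"
proof -
  assume j: "j \<ge> 0"
  have "H j (monomial ns x) = monomial ns (H j x)" for ns
    by (induction ns) (simp_all add: H_simps H_commute[OF j])
  then show ?thesis by (simp add: exp_coeff_monomial H_simps)
qed

lemma exp_coeff_linear: "linear_on UNIV (exp_coeff H s)"
proof -
  have "monomial ns (x + y) = monomial ns x + monomial ns y" "monomial ns (c *\<^sub>C x) = c *\<^sub>C monomial ns x" for ns x y c
    by (induction ns) (auto simp: H_simps cvec.scale_right_distrib mult.commute)
  then show ?thesis
    by (simp add: linear_on_def exp_coeff_monomial cvec.scale_right_distrib sum.distrib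
        cvec.scale_sum_right mult.commute)
qed

end

section \<open>Conjugation of vertex operators by the twisting exponential\<close>

text \<open>
The coefficient of \<open>x\<^sup>i\<close> in \<open>(1 + x)\<^bsup>-t-1\<^esup> (1 + x)\<^bsup>a\<^esup>\<close>.
\<close>

lemma gbinomial_alternating_Vandermonde:
  fixes a :: complex
  shows "(\<Sum>d=0..i. (-1) ^ d * of_nat ((t + d) choose t) * (a gchoose (i - d))) = (a - of_nat t - 1) gchoose i"
proof -
  have "(-1) ^ d * of_nat ((t + d) choose t) = (- (of_nat t + 1) :: complex) gchoose d" for d
  proof -
    have "(- (of_nat t + 1) :: complex) gchoose d = (-1) ^ d * ((of_nat t + 1 + of_nat d - 1) gchoose d)"
      by (rule gbinomial_minus)
    also have "(of_nat t + 1 + of_nat d - 1 :: complex) = of_nat (t + d)" by simp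
    also have "(of_nat (t + d) gchoose d :: complex) = of_nat ((t + d) choose d)"
      by (simp only: binomial_gbinomial)
    finally show ?thesis by (simp add: binomial_symmetric[of t "t + d"])
  qed
  then show ?thesis
    using gbinomial_Vandermonde[of "- (of_nat t + 1) :: complex" a i] by (simp add: algebra_simps)
qed

text \<open>
The identity between coefficients on which the induction step of the conjugation formula rests; there
\<open>b + m\<close> is the \<open>h\<^bsup>(r)\<^esup>(0)\<close>-eigenvalue of the first state.
\<close>

lemma gbinomial_weighted_Pascal:
  fixes b :: complex
  shows "(b + of_nat m) * (\<Sum>j=1..i. (-1) ^ (j + 1) * (b gchoose (i - j))) + of_nat m * ((b - 1) gchoose i)
    = of_nat (m + i) * (b gchoose i)"
proof (cases i)
  case (Suc n)
  have "(\<Sum>j=1..i. (-1) ^ (j + 1) * (b gchoose (i - j))) = (\<Sum>d=0..n. (-1) ^ d * (b gchoose (n - d)))"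
    by (rule sum.reindex_bij_witness[where i = Suc and j = "\<lambda>j. j - 1"]) (auto simp: Suc minus_one_power_iff)
  also have "\<dots> = (b - 1) gchoose n"
    using gbinomial_alternating_Vandermonde[of 0 b n] by simp
  finally have 1: "(\<Sum>j=1..i. (-1) ^ (j + 1) * (b gchoose (i - j))) = (b - 1) gchoose n" .
  have 2: "b gchoose Suc n = ((b - 1) gchoose n) + ((b - 1) gchoose Suc n)"
    using gbinomial_Suc_Suc[of "b - 1" n] by simp
  have 3: "of_nat (Suc n) * ((b - 1) gchoose Suc n) = (b - 1 - of_nat n) * ((b - 1) gchoose n)"
    using gbinomial_absorb_comp[of "b - 1" n] gbinomial_mult_1[of "b - 1" n] by (simp add: algebra_simps)
  show ?thesis using 3 unfolding 1 unfolding Suc 2 by (simp add: algebra_simps)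
qed simp

definition triples :: "nat \<Rightarrow> (nat \<times> nat \<times> nat) set" where
  "triples s = {(m, l, i). m + l + i = s}"

lemma finite_triples [simp]: "finite (triples s)"
  by (rule finite_subset[of _ "{..s} \<times> {..s} \<times> {..s}"]) (auto simp: triples_def)

lemma triples_0 [simp]: "triples 0 = {(0, 0, 0)}"
  by (auto simp: triples_def)

text \<open>
Vandermonde's identity with vector coefficients; the truncation of \<open>f\<close> makes the square range of
summation as good as the triangular one.
\<close>

lemma sum_gbinomial_convolution:
  fixes f :: "nat \<Rightarrow> 'a::complex_vector" and a b :: complex
  assumes "\<And>t. t \<ge> N \<Longrightarrow> f t = 0"
  shows "(\<Sum>i<N. \<Sum>j<N. ((a gchoose i) * (b gchoose j)) *\<^sub>C f (i + j)) = (\<Sum>t<N. ((a + b) gchoose t) *\<^sub>C f t)"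
proof -
  have "(\<Sum>t<N. ((a + b) gchoose t) *\<^sub>C f t)
      = (\<Sum>t<N. \<Sum>i=0..t. ((a gchoose i) * (b gchoose (t - i))) *\<^sub>C f t)"
    by (simp only: gbinomial_Vandermonde[symmetric] cvec.scale_sum_left)
  also have "\<dots> = (\<Sum>(t, i)\<in>(SIGMA t:{..<N}. {0..t}). ((a gchoose i) * (b gchoose (t - i))) *\<^sub>C f t)"
    by (rule sum.Sigma) auto
  also have "\<dots> = (\<Sum>(i, j)\<in>{..<N} \<times> {..<N}. ((a gchoose i) * (b gchoose j)) *\<^sub>C f (i + j))"
    by (rule sum.reindex_bij_witness_not_neutral[where i = "\<lambda>(i, j). (i + j, i)"
          and j = "\<lambda>(t, i). (i, t - i)" and S' = "{}"
          and T' = "{(i, j) \<in> {..<N} \<times> {..<N}. i + j \<ge> N}"])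
      (use assms in \<open>auto intro: finite_subset[of _ "{..<N} \<times> {..<N}"]\<close>)
  also have "\<dots> = (\<Sum>i<N. \<Sum>j<N. ((a gchoose i) * (b gchoose j)) *\<^sub>C f (i + j))"
    by (rule sum.cartesian_product[symmetric])
  finally show ?thesis by simp
qed

text \<open>
The state \<open>hr\<close> plays the role of \<open>h\<^bsup>(r)\<^esup>\<close>. Li's construction rests on the commutation of its
nonnegative modes on the algebra.
\<close>

locale twisting = full_module Y vac conf YW + adj: full_module Y vac conf Y
  for Y :: "'v::complex_vector \<Rightarrow> int \<Rightarrow> 'v \<Rightarrow> 'v" and vac conf :: 'v
    and YW :: "'v \<Rightarrow> int \<Rightarrow> 'm::complex_vector \<Rightarrow> 'm" +
  fixes hr :: 'v
  assumes hr_commute: "m \<ge> 0 \<Longrightarrow> n \<ge> 0 \<Longrightarrow> Y hr m (Y hr n x) = Y hr n (Y hr m x)"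
begin

sublocale exp: commuting_modes "Y hr"
  by unfold_locales (simp_all add: V_linear_mode' hr_commute)

abbreviation E :: "nat \<Rightarrow> 'v \<Rightarrow> 'v" where "E \<equiv> exp_coeff (Y hr)"

lemmas E_simps = linear_on_UNIV[OF exp.exp_coeff_linear]

text \<open>
Li's conjugation formula in coefficients. By \<open>exp_coeff_recurrence\<close>, \<open>s E\<^sub>s\<close> is a combination of the
\<open>H(j) E\<^bsub>s-j\<^esub>\<close> with \<open>j \<ge> 1\<close>. After the induction hypothesis, \<open>H(j)\<close> is moved past \<open>(E\<^sub>m u)\<^bsub>n+i\<^esub>\<close>. It
then acts on \<open>E\<^sub>l v\<close> (the sum \<open>S1\<close>), by the eigenvalue \<open>\<alpha>\<close> on \<open>u\<close> (the sum \<open>S2\<close>, from the term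
\<open>H(0)\<close> of the commutator), or by \<open>H(t)\<close> with \<open>t \<ge> 1\<close> on \<open>E\<^sub>m u\<close> (the sum \<open>S3\<close>). Read backwards, the
recurrence turns \<open>S1\<close> into the weight \<open>l\<close> and \<open>S3\<close> into a multiple of the weight \<open>m\<close>. The three
contributions add up to the weight \<open>s = m + l + i\<close>.
\<close>

theorem exp_coeff_mode:
  assumes u: "Y hr 0 u = \<alpha> *\<^sub>C u"
  shows "E s (Y u n v) =
    (\<Sum>(m, l, i)\<in>triples s. ((\<alpha> - of_nat m) gchoose i) *\<^sub>C Y (E m u) (n + int i) (E l v))"
proof (induction s rule: less_induct)
  case (less s)
  show ?case
  proof (cases "s = 0")
    case False
    define B where "B m l i = Y (E m u) (n + int i) (E l v)" for m l i
    define b where "b m = \<alpha> - of_nat m" for m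
    have u': "Y hr 0 (E m u) = \<alpha> *\<^sub>C E m u" for m
      using exp.exp_coeff_commute[of 0 m u] by (simp add: u E_simps)
    let ?T = "\<lambda>j. triples (s - j)"
    define S1 where "S1 j = (\<Sum>(m, l, i)\<in>?T j. ((-1) ^ (j + 1) * (b m gchoose i)) *\<^sub>C
        Y (E m u) (n + int i) (Y hr (int j) (E l v)))" for j
    define S2 where "S2 j = (\<Sum>(m, l, i)\<in>?T j. ((-1) ^ (j + 1) * (b m gchoose i)) *\<^sub>C \<alpha> *\<^sub>C B m l (i + j))" for j
    define S3 where "S3 j = (\<Sum>(m, l, i)\<in>?T j. \<Sum>t=1..j.
        ((-1) ^ (j + 1) * (b m gchoose i) * of_nat (j choose t)) *\<^sub>C
        Y (Y hr (int t) (E m u)) (n + int (i + (j - t))) (E l v))" for j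
    have split: "(-1) ^ (j + 1) *\<^sub>C Y hr (int j) (E (s - j) (Y u n v)) = S1 j + S2 j + S3 j"
      if j: "j \<in> {1..s}" for j
    proof -
      have "(-1) ^ (j + 1) *\<^sub>C Y hr (int j) (E (s - j) (Y u n v)) =
        (\<Sum>(m, l, i)\<in>?T j. ((-1) ^ (j + 1) * (b m gchoose i)) *\<^sub>C Y hr (int j) (Y (E m u) (n + int i) (E l v)))"
        using j by (simp add: less V_mode_simps case_prod_beta cvec.scale_sum_right b_def)
      also have "\<dots> = (\<Sum>(m, l, i)\<in>?T j. ((-1) ^ (j + 1) * (b m gchoose i)) *\<^sub>C
            Y (E m u) (n + int i) (Y hr (int j) (E l v))
          + ((-1) ^ (j + 1) * (b m gchoose i)) *\<^sub>C \<alpha> *\<^sub>C B m l (i + j)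
          + (\<Sum>t=1..j. ((-1) ^ (j + 1) * (b m gchoose i) * of_nat (j choose t)) *\<^sub>C
        Y (Y hr (int t) (E m u)) (n + int (i + (j - t))) (E l v)))"
      proof (intro sum.cong refl, clarify)
        fix m l i
        have "(\<Sum>t\<le>j. of_nat (j choose t) *\<^sub>C Y (Y hr (int t) (E m u)) (int j + (n + int i) - int t) (E l v))
            = (\<Sum>t\<in>insert 0 {1..j}. of_nat (j choose t) *\<^sub>C Y (Y hr (int t) (E m u)) (int j + (n + int i) - int t) (E l v))"
          by (intro sum.cong) auto
        also have "\<dots> = \<alpha> *\<^sub>C B m l (i + j) +
          (\<Sum>t=1..j. of_nat (j choose t) *\<^sub>C Y (Y hr (int t) (E m u)) (int j + (n + int i) - int t) (E l v))"
          by (subst sum.insert) (auto simp: u' V_mode_simps B_def add_ac)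
        also have "(\<Sum>t=1..j. of_nat (j choose t) *\<^sub>C Y (Y hr (int t) (E m u)) (int j + (n + int i) - int t) (E l v))
           = (\<Sum>t=1..j. of_nat (j choose t) *\<^sub>C Y (Y hr (int t) (E m u)) (n + int (i + (j - t))) (E l v))"
          by (intro sum.cong refl arg_cong2[where f = scaleC] arg_cong2[where f = "\<lambda>a b. Y a b _"])
            (auto simp: of_nat_diff)
        finally show "((-1) ^ (j + 1) * (b m gchoose i)) *\<^sub>C Y hr (int j) (Y (E m u) (n + int i) (E l v)) =
          ((-1) ^ (j + 1) * (b m gchoose i)) *\<^sub>C Y (E m u) (n + int i) (Y hr (int j) (E l v))
          + ((-1) ^ (j + 1) * (b m gchoose i)) *\<^sub>C \<alpha> *\<^sub>C B m l (i + j)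
          + (\<Sum>t=1..j. ((-1) ^ (j + 1) * (b m gchoose i) * of_nat (j choose t)) *\<^sub>C
              Y (Y hr (int t) (E m u)) (n + int (i + (j - t))) (E l v))"
          unfolding adj.commutator_nonneg
          by (simp only: cvec.scale_right_distrib cvec.scale_sum_right cvec.scale_scale add.assoc)
      qed
      also have "\<dots> = S1 j + S2 j + S3 j"
        unfolding S1_def S2_def S3_def by (simp only: case_prod_unfold sum.distrib)
      finally show ?thesis .
    qed
    \<comment> \<open>collected by the value of \<open>l + j\<close>\<close>
    have S1: "sum S1 {1..s} = (\<Sum>(m, l, i)\<in>triples s. (of_nat l * (b m gchoose i)) *\<^sub>C B m l i)"
    proof -
      have "sum S1 {1..s} = (\<Sum>(j, m, l, i)\<in>(SIGMA j:{1..s}. ?T j). ((-1) ^ (j + 1) * (b m gchoose i)) *\<^sub>C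
        Y (E m u) (n + int i) (Y hr (int j) (E l v)))"
        unfolding S1_def by (rule sum.Sigma) auto
      also have "\<dots> = (\<Sum>((m, l, i), j)\<in>(SIGMA x:triples s. {1..fst (snd x)}).
        ((-1) ^ (j + 1) * (b m gchoose i)) *\<^sub>C Y (E m u) (n + int i) (Y hr (int j) (E (l - j) v)))"
        by (rule sum.reindex_bij_witness[where i = "\<lambda>((m, l, i), j). (j, m, l - j, i)"
              and j = "\<lambda>(j, m, l, i). ((m, l + j, i), j)"]) (auto simp: triples_def)
      also have "\<dots> = (\<Sum>x\<in>triples s. \<Sum>j=1..fst (snd x). (case x of (m, l, i) \<Rightarrow>
        ((-1) ^ (j + 1) * (b m gchoose i)) *\<^sub>C Y (E m u) (n + int i) (Y hr (int j) (E (l - j) v))))"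
        by (subst sum.Sigma) (auto simp: case_prod_beta)
      also have "\<dots> = (\<Sum>(m, l, i)\<in>triples s. (of_nat l * (b m gchoose i)) *\<^sub>C B m l i)"
      proof (intro sum.cong refl, clarify, simp only: prod.case fst_conv snd_conv)
        fix m l i
        have "(\<Sum>j=1..l. ((-1) ^ (j + 1) * (b m gchoose i)) *\<^sub>C Y (E m u) (n + int i) (Y hr (int j) (E (l - j) v)))
          = (b m gchoose i) *\<^sub>C Y (E m u) (n + int i) (\<Sum>j=1..l. (-1) ^ (j + 1) *\<^sub>C Y hr (int j) (E (l - j) v))"
          by (simp only: V_mode_simps cvec.scale_sum_right cvec.scale_scale mult.commute)
        also have "\<dots> = (of_nat l * (b m gchoose i)) *\<^sub>C B m l i"
          by (simp only: exp.exp_coeff_recurrence[symmetric] V_mode_simps B_def cvec.scale_scale mult.commute)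
        finally show "(\<Sum>j=1..l. ((-1) ^ (j + 1) * (b m gchoose i)) *\<^sub>C Y (E m u) (n + int i) (Y hr (int j) (E (l - j) v)))
          = (of_nat l * (b m gchoose i)) *\<^sub>C B m l i" .
      qed
      finally show ?thesis .
    qed
    \<comment> \<open>collected by the value of \<open>i + j\<close>\<close>
    have S2: "sum S2 {1..s} = (\<Sum>(m, l, i)\<in>triples s.
        (\<alpha> * (\<Sum>j=1..i. (-1) ^ (j + 1) * (b m gchoose (i - j)))) *\<^sub>C B m l i)"
    proof -
      have "sum S2 {1..s} = (\<Sum>(j, m, l, i)\<in>(SIGMA j:{1..s}. ?T j).
          ((-1) ^ (j + 1) * (b m gchoose i)) *\<^sub>C \<alpha> *\<^sub>C B m l (i + j))"
        unfolding S2_def by (rule sum.Sigma) auto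
      also have "\<dots> = (\<Sum>((m, l, i), j)\<in>(SIGMA x:triples s. {1..snd (snd x)}).
        ((-1) ^ (j + 1) * (b m gchoose (i - j))) *\<^sub>C \<alpha> *\<^sub>C B m l i)"
        by (rule sum.reindex_bij_witness[where i = "\<lambda>((m, l, i), j). (j, m, l, i - j)"
              and j = "\<lambda>(j, m, l, i). ((m, l, i + j), j)"]) (auto simp: triples_def)
      also have "\<dots> = (\<Sum>x\<in>triples s. \<Sum>j=1..snd (snd x). (case x of (m, l, i) \<Rightarrow>
        ((-1) ^ (j + 1) * (b m gchoose (i - j))) *\<^sub>C \<alpha> *\<^sub>C B m l i))"
        by (subst sum.Sigma) (auto simp: case_prod_beta)
      also have "\<dots> = (\<Sum>(m, l, i)\<in>triples s.
        (\<alpha> * (\<Sum>j=1..i. (-1) ^ (j + 1) * (b m gchoose (i - j)))) *\<^sub>C B m l i)"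
        by (intro sum.cong refl)
          (auto simp: cvec.scale_sum_left sum_distrib_left mult_ac)
      finally show ?thesis .
    qed
    \<comment> \<open>collected by the values of \<open>m + t\<close> and \<open>i + d\<close>, where \<open>d = j - t\<close>\<close>
    have S3: "sum S3 {1..s} = (\<Sum>(m, l, i)\<in>triples s. (of_nat m * ((b m - 1) gchoose i)) *\<^sub>C B m l i)"
    proof -
      let ?F = "\<lambda>m l i t j. ((-1) ^ (j + 1) * (b m gchoose i) * of_nat (j choose t)) *\<^sub>C
        Y (Y hr (int t) (E m u)) (n + int (i + (j - t))) (E l v)"
      have "S3 j = (\<Sum>(x, t)\<in>?T j \<times> {1..j}. (case x of (m, l, i) \<Rightarrow> ?F m l i t j))" for j
        unfolding S3_def by (subst sum.cartesian_product[symmetric]) (auto simp: case_prod_beta)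
      then have "sum S3 {1..s} = (\<Sum>j=1..s. \<Sum>(x, t)\<in>?T j \<times> {1..j}. (case x of (m, l, i) \<Rightarrow> ?F m l i t j))"
        by simp
      also have "\<dots> = (\<Sum>(j, x, t)\<in>(SIGMA j:{1..s}. ?T j \<times> {1..j}). (case x of (m, l, i) \<Rightarrow> ?F m l i t j))"
        by (rule sum.Sigma) auto
      also have "\<dots> = (\<Sum>((m, l, i), t, d)\<in>(SIGMA x:triples s. {1..fst x} \<times> {0..snd (snd x)}).
          ?F (m - t) l (i - d) t (t + d))"
        by (rule sum.reindex_bij_witness[where i = "\<lambda>((m, l, i), t, d). (t + d, (m - t, l, i - d), t)"
              and j = "\<lambda>(j, (m, l, i), t). ((m + t, l, i + (j - t)), t, j - t)"])
          (auto simp: triples_def)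
      also have "\<dots> = (\<Sum>x\<in>triples s. \<Sum>(t, d)\<in>{1..fst x} \<times> {0..snd (snd x)}. (case x of (m, l, i) \<Rightarrow>
          ?F (m - t) l (i - d) t (t + d)))"
        by (subst sum.Sigma) (auto simp: case_prod_beta)
      also have "\<dots> = (\<Sum>(m, l, i)\<in>triples s. (of_nat m * ((b m - 1) gchoose i)) *\<^sub>C B m l i)"
      proof (intro sum.cong refl, clarify, simp only: prod.case fst_conv snd_conv)
        fix m l i
        have *: "(\<Sum>d=0..i. ?F (m - t) l (i - d) t (t + d))
            = ((b m - 1) gchoose i) *\<^sub>C Y ((-1) ^ (t + 1) *\<^sub>C Y hr (int t) (E (m - t) u)) (n + int i) (E l v)"
          if t: "t \<in> {1..m}" for t
        proof -
          have bt: "b (m - t) = b m + of_nat t" using t by (simp add: b_def of_nat_diff)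
          have "(\<Sum>d=0..i. ?F (m - t) l (i - d) t (t + d)) =
            (\<Sum>d=0..i. ((-1) ^ (t + 1) * ((-1) ^ d * of_nat ((t + d) choose t) * (b (m - t) gchoose (i - d)))) *\<^sub>C
               Y (Y hr (int t) (E (m - t) u)) (n + int i) (E l v))"
            by (intro sum.cong refl) (auto simp: power_add mult_ac)
          also have "\<dots> = ((-1) ^ (t + 1) * (\<Sum>d=0..i. (-1) ^ d * of_nat ((t + d) choose t) * (b (m - t) gchoose (i - d)))) *\<^sub>C
               Y (Y hr (int t) (E (m - t) u)) (n + int i) (E l v)"
            by (simp only: sum_distrib_left cvec.scale_sum_left)
          also have "\<dots> = ((-1) ^ (t + 1) * ((b m - 1) gchoose i)) *\<^sub>C
               Y (Y hr (int t) (E (m - t) u)) (n + int i) (E l v)"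
            by (simp only: gbinomial_alternating_Vandermonde bt) simp
          finally show ?thesis by (simp only: V_mode_simps cvec.scale_scale mult.commute)
        qed
        have "(\<Sum>(t, d)\<in>{1..m} \<times> {0..i}. ?F (m - t) l (i - d) t (t + d))
          = (\<Sum>t=1..m. \<Sum>d=0..i. ?F (m - t) l (i - d) t (t + d))"
          by (rule sum.cartesian_product[symmetric])
        also have "\<dots> = (\<Sum>t=1..m. ((b m - 1) gchoose i) *\<^sub>C
            Y ((-1) ^ (t + 1) *\<^sub>C Y hr (int t) (E (m - t) u)) (n + int i) (E l v))"
          by (intro sum.cong refl *)
        also have "\<dots> = ((b m - 1) gchoose i) *\<^sub>C
            Y (\<Sum>t=1..m. (-1) ^ (t + 1) *\<^sub>C Y hr (int t) (E (m - t) u)) (n + int i) (E l v)"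
          by (simp only: V_mode_simps cvec.scale_sum_right)
        also have "\<dots> = (of_nat m * ((b m - 1) gchoose i)) *\<^sub>C B m l i"
          by (simp only: exp.exp_coeff_recurrence[symmetric] V_mode_simps B_def cvec.scale_scale mult.commute)
        finally show "(\<Sum>(t, d)\<in>{1..m} \<times> {0..i}. ?F (m - t) l (i - d) t (t + d))
          = (of_nat m * ((b m - 1) gchoose i)) *\<^sub>C B m l i" .
      qed
      finally show ?thesis .
    qed
    have "(\<Sum>j=1..s. (-1) ^ (j + 1) *\<^sub>C Y hr (int j) (E (s - j) (Y u n v))) = (\<Sum>j=1..s. S1 j + S2 j + S3 j)"
      by (intro sum.cong refl split)
    also have "\<dots> = sum S1 {1..s} + sum S2 {1..s} + sum S3 {1..s}" by (simp only: sum.distrib)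
    also have "\<dots> = (\<Sum>(m, l, i)\<in>triples s. (of_nat l * (b m gchoose i)) *\<^sub>C B m l i
        + (\<alpha> * (\<Sum>j=1..i. (-1) ^ (j + 1) * (b m gchoose (i - j)))) *\<^sub>C B m l i
        + (of_nat m * ((b m - 1) gchoose i)) *\<^sub>C B m l i)"
      unfolding S1 S2 S3 by (simp only: case_prod_unfold sum.distrib)
    also have "\<dots> = (\<Sum>(m, l, i)\<in>triples s. of_nat s *\<^sub>C (b m gchoose i) *\<^sub>C B m l i)"
    proof (intro sum.cong refl, clarify)
      fix m l i assume "(m, l, i) \<in> triples s"
      then have s: "s = l + (m + i)" by (simp add: triples_def)
      have "of_nat l * (b m gchoose i) + \<alpha> * (\<Sum>j=1..i. (-1) ^ (j + 1) * (b m gchoose (i - j)))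
          + of_nat m * ((b m - 1) gchoose i) = of_nat s * (b m gchoose i)"
        using gbinomial_weighted_Pascal[of "b m" m i] unfolding s
        by (simp add: b_def algebra_simps)
      then show "(of_nat l * (b m gchoose i)) *\<^sub>C B m l i
        + (\<alpha> * (\<Sum>j=1..i. (-1) ^ (j + 1) * (b m gchoose (i - j)))) *\<^sub>C B m l i
        + (of_nat m * ((b m - 1) gchoose i)) *\<^sub>C B m l i = of_nat s *\<^sub>C (b m gchoose i) *\<^sub>C B m l i"
        by (simp only: cvec.scale_left_distrib[symmetric] cvec.scale_scale)
    qed
    also have "\<dots> = of_nat s *\<^sub>C (\<Sum>(m, l, i)\<in>triples s. (b m gchoose i) *\<^sub>C B m l i)"
      by (simp only: cvec.scale_sum_right case_prod_unfold)
    finally show ?thesis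
      using False by (intro exp.exp_coeff_eqI) (simp_all only: B_def b_def neq0_conv)
  qed simp
qed

end

context twisting
begin

text \<open>
The exponential has only finitely many nonzero terms on \<open>u\<close>.
\<close>

definition finite_exp :: "'v \<Rightarrow> bool" where
  "finite_exp u \<longleftrightarrow> (\<exists>K. \<forall>m\<ge>K. E m u = 0)"

text \<open>
On a state \<open>u\<close> with \<open>h\<^bsup>(r)\<^esup>(0) u = \<alpha> u\<close> the operator \<open>\<Delta>(h\<^bsup>(r)\<^esup>,z)\<close> is \<open>z\<^bsup>\<alpha>\<^esup>\<close> times the
exponential, so this is the coefficient of \<open>z\<^bsup>-n-1\<^esup>\<close> in \<open>Y(\<Delta>(h\<^bsup>(r)\<^esup>,z) u, z)\<close>.
\<close>

definition twist_mode :: "'v \<Rightarrow> int \<Rightarrow> int \<Rightarrow> 'm \<Rightarrow> 'm" where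
  "twist_mode u \<alpha> n w = Sum_any (\<lambda>m. YW (E m u) (n + \<alpha> - int m) w)"

lemma twist_mode_eq_sum:
  assumes "\<And>m. m \<ge> K \<Longrightarrow> E m u = 0"
  shows "twist_mode u \<alpha> n w = (\<Sum>m<K. YW (E m u) (n + \<alpha> - int m) w)"
  unfolding twist_mode_def using assms by (intro Sum_any_nat_eq_sum) (simp add: mode_simps)

text \<open>
On the right-hand side the twist replaces \<open>u, v, p, q\<close> by \<open>E\<^sub>m u, E\<^sub>l v, p + \<alpha> - m, q + \<beta> - l\<close>, so the
untwisted identity applies term by term and produces the binomial coefficient of \<open>p + \<alpha> - m\<close>. The
left-hand side produces the product of the one of \<open>p\<close> with the one of \<open>\<alpha> - m\<close> from
\<open>exp_coeff_mode\<close>, and Vandermonde's identity matches the two.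
\<close>

theorem twisted_borcherds:
  assumes u: "Y hr 0 u = of_int \<alpha> *\<^sub>C u" "finite_exp u" and v: "finite_exp v"
  shows "\<exists>I0. \<forall>I\<ge>I0.
    (\<Sum>i<I. ((of_int p :: complex) gchoose i) *\<^sub>C twist_mode (Y u (r + int i) v) (\<alpha> + \<beta>) (p + q - int i) w) =
    (\<Sum>i<I. ((-1) ^ i * ((of_int r :: complex) gchoose i)) *\<^sub>C
       (twist_mode u \<alpha> (p + r - int i) (twist_mode v \<beta> (q + int i) w)
        - ((-1) powi r) *\<^sub>C twist_mode v \<beta> (q + r - int i) (twist_mode u \<alpha> (p + int i) w)))"
proof -
  obtain Ku Kv where "\<forall>m\<ge>Ku. E m u = 0" "\<forall>m\<ge>Kv. E m v = 0"
    using u(2) v unfolding finite_exp_def by blast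
  then obtain K where K: "\<And>m. m \<ge> K \<Longrightarrow> E m u = 0" "\<And>m. m \<ge> K \<Longrightarrow> E m v = 0"
    by (metis max.bounded_iff[of Ku Kv])
  let ?P = "\<lambda>m l N. (\<forall>t\<ge>N. Y (E m u) (r + int t) (E l v) = 0) \<and>
    (\<forall>n\<ge>N. (\<Sum>i<n. borcherds_lhs (E m u) (E l v) w (p + \<alpha> - int m) (q + \<beta> - int l) r i)
          = (\<Sum>i<n. borcherds_rhs (E m u) (E l v) w (p + \<alpha> - int m) (q + \<beta> - int l) r i))"
  have "\<forall>m l. \<exists>N. ?P m l N"
  proof (intro allI)
    fix m l
    obtain N1 where N1: "\<forall>t\<ge>N1. Y (E m u) (r + int t) (E l v) = 0" using V_truncation' by blast
    obtain N2 where N2: "\<forall>n\<ge>N2.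
       (\<Sum>i<n. borcherds_lhs (E m u) (E l v) w (p + \<alpha> - int m) (q + \<beta> - int l) r i)
       = (\<Sum>i<n. borcherds_rhs (E m u) (E l v) w (p + \<alpha> - int m) (q + \<beta> - int l) r i)"
      using borcherds_eventually by blast
    show "\<exists>N. ?P m l N" using N1 N2 by (intro exI[of _ "max N1 N2"]) simp
  qed
  then obtain N where N: "\<And>m l. ?P m l (N m l)" by metis
  \<comment> \<open>beyond \<open>I0\<close> all the finitely many untwisted identities involved hold and are truncated\<close>
  define I0 where "I0 = Max ((\<lambda>(m, l). N m l) ` ({..<K} \<times> {..<K}) \<union> {0})"
  have I0: "N m l \<le> I0" if "m < K" "l < K" for m l
    unfolding I0_def using that by (intro Max_ge) auto
  have "(\<Sum>i<I. ((of_int p :: complex) gchoose i) *\<^sub>C twist_mode (Y u (r + int i) v) (\<alpha> + \<beta>) (p + q - int i) w) =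
    (\<Sum>i<I. ((-1) ^ i * ((of_int r :: complex) gchoose i)) *\<^sub>C
       (twist_mode u \<alpha> (p + r - int i) (twist_mode v \<beta> (q + int i) w)
        - ((-1) powi r) *\<^sub>C twist_mode v \<beta> (q + r - int i) (twist_mode u \<alpha> (p + int i) w)))"
    (is "?L = ?R") if I: "I \<ge> I0" for I
  proof -
    \<comment> \<open>the common summand: both sides become combinations of the \<open>f m l t\<close>\<close>
    define f where "f m l t = YW (Y (E m u) (r + int t) (E l v)) (p + q + \<alpha> + \<beta> - int m - int l - int t) w"
      for m l t
    define a where "a m = (of_int \<alpha> - of_nat m :: complex)" for m
    have f0: "f m l t = 0" if "m \<ge> K \<or> l \<ge> K \<or> t \<ge> I" for m l t
    proof (cases "m < K \<and> l < K")
      case True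
      then have "t \<ge> N m l" using that I I0[of m l] by auto
      then show ?thesis using N[of m l] by (simp add: f_def mode_simps)
    next
      case False
      then show ?thesis using K by (auto simp: f_def not_less V_mode_simps mode_simps)
    qed
    have Y0: "Y (E m u) (r + int i + int j) (E l v) = 0" if "m \<ge> K \<or> l \<ge> K \<or> j \<ge> I" for m l i j
    proof (cases "m < K \<and> l < K")
      case True
      then have "i + j \<ge> N m l" using that I I0[of m l] by auto
      then show ?thesis using N[of m l] by (metis (no_types, lifting) add.assoc of_nat_add)
    next
      case False
      then show ?thesis using K by (auto simp: not_less V_mode_simps)
    qed
    have E: "E s (Y u (r + int i) v) = (\<Sum>(m, l, j)\<in>triples s. (a m gchoose j) *\<^sub>C
        Y (E m u) (r + int i + int j) (E l v))" for s i
      using exp_coeff_mode[OF u(1)] by (simp add: a_def)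
    have tw: "twist_mode (Y u (r + int i) v) (\<alpha> + \<beta>) (p + q - int i) w
        = (\<Sum>m<K. \<Sum>l<K. \<Sum>j<I. (a m gchoose j) *\<^sub>C f m l (i + j))" for i
    proof -
      have "E s (Y u (r + int i) v) = 0" if s: "s \<ge> K + K + I" for s
        unfolding E
      proof (rule sum.neutral, clarify)
        fix m l j assume "(m, l, j) \<in> triples s"
        then have "m \<ge> K \<or> l \<ge> K \<or> j \<ge> I" using s by (auto simp: triples_def)
        then show "(a m gchoose j) *\<^sub>C Y (E m u) (r + int i + int j) (E l v) = 0" by (simp add: Y0)
      qed
      then have "twist_mode (Y u (r + int i) v) (\<alpha> + \<beta>) (p + q - int i) w
        = (\<Sum>s<K + K + I. YW (E s (Y u (r + int i) v)) (p + q - int i + (\<alpha> + \<beta>) - int s) w)"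
        by (rule twist_mode_eq_sum)
      also have "\<dots> = (\<Sum>s<K + K + I. \<Sum>(m, l, j)\<in>triples s. (a m gchoose j) *\<^sub>C f m l (i + j))"
      proof (rule sum.cong[OF refl])
        fix s
        have "YW (E s (Y u (r + int i) v)) (p + q - int i + (\<alpha> + \<beta>) - int s) w
          = (\<Sum>(m, l, j)\<in>triples s. (a m gchoose j) *\<^sub>C
             YW (Y (E m u) (r + int i + int j) (E l v)) (p + q - int i + (\<alpha> + \<beta>) - int s) w)"
          by (simp add: E mode_simps case_prod_unfold)
        also have "\<dots> = (\<Sum>(m, l, j)\<in>triples s. (a m gchoose j) *\<^sub>C f m l (i + j))"
          by (intro sum.cong refl) (auto simp: f_def triples_def algebra_simps)
        finally show "YW (E s (Y u (r + int i) v)) (p + q - int i + (\<alpha> + \<beta>) - int s) w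
          = (\<Sum>(m, l, j)\<in>triples s. (a m gchoose j) *\<^sub>C f m l (i + j))" .
      qed
      also have "\<dots> = (\<Sum>(s, m, l, j)\<in>(SIGMA s:{..<K + K + I}. triples s). (a m gchoose j) *\<^sub>C f m l (i + j))"
        by (rule sum.Sigma) auto
      also have "\<dots> = (\<Sum>(m, l, j)\<in>{..<K} \<times> {..<K} \<times> {..<I}. (a m gchoose j) *\<^sub>C f m l (i + j))"
      proof -
        define S' where
          "S' = {(s, m, l, j) \<in> (SIGMA s:{..<K + K + I}. triples s). \<not> (m < K \<and> l < K \<and> j < I)}"
        have fin: "finite S'"
          by (rule finite_subset[of _ "SIGMA s:{..<K + K + I}. triples s"]) (auto simp: S'_def)
        show ?thesis
          by (rule sum.reindex_bij_witness_not_neutral[where i = "\<lambda>(m, l, j). (m + l + j, m, l, j)"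
                and j = snd and T' = "{}" and S' = S', OF fin finite.emptyI])
            (auto simp: triples_def f0 S'_def)
      qed
      also have "\<dots> = (\<Sum>m<K. \<Sum>l<K. \<Sum>j<I. (a m gchoose j) *\<^sub>C f m l (i + j))"
        by (simp add: sum.cartesian_product)
      finally show ?thesis .
    qed
    have "?L = (\<Sum>i<I. \<Sum>m<K. \<Sum>l<K. \<Sum>j<I. ((of_int p gchoose i) * (a m gchoose j)) *\<^sub>C f m l (i + j))"
      by (simp add: tw cvec.scale_sum_right)
    also have "\<dots> = (\<Sum>m<K. \<Sum>i<I. \<Sum>l<K. \<Sum>j<I. ((of_int p gchoose i) * (a m gchoose j)) *\<^sub>C f m l (i + j))"
      by (rule sum.swap)
    also have "\<dots> = (\<Sum>m<K. \<Sum>l<K. \<Sum>i<I. \<Sum>j<I. ((of_int p gchoose i) * (a m gchoose j)) *\<^sub>C f m l (i + j))"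
      by (intro sum.cong refl sum.swap)
    also have "\<dots> = (\<Sum>m<K. \<Sum>l<K. \<Sum>t<I. ((of_int p + a m) gchoose t) *\<^sub>C f m l t)"
      by (intro sum.cong refl sum_gbinomial_convolution) (simp add: f0)
    also have "\<dots> = (\<Sum>m<K. \<Sum>l<K. \<Sum>t<I.
        borcherds_lhs (E m u) (E l v) w (p + \<alpha> - int m) (q + \<beta> - int l) r t)"
      by (intro sum.cong refl) (simp add: borcherds_lhs_def f_def a_def algebra_simps)
    also have "\<dots> = (\<Sum>m<K. \<Sum>l<K. \<Sum>t<I.
        borcherds_rhs (E m u) (E l v) w (p + \<alpha> - int m) (q + \<beta> - int l) r t)"
    proof (rule sum.cong[OF refl], rule sum.cong[OF refl])
      fix m l assume "m \<in> {..<K}" "l \<in> {..<K}"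
      then have "I \<ge> N m l" using I I0[of m l] by auto
      then show "(\<Sum>t<I. borcherds_lhs (E m u) (E l v) w (p + \<alpha> - int m) (q + \<beta> - int l) r t)
        = (\<Sum>t<I. borcherds_rhs (E m u) (E l v) w (p + \<alpha> - int m) (q + \<beta> - int l) r t)"
        using N[of m l] by blast
    qed
    also have "\<dots> = (\<Sum>m<K. \<Sum>t<I. \<Sum>l<K.
        borcherds_rhs (E m u) (E l v) w (p + \<alpha> - int m) (q + \<beta> - int l) r t)"
      by (intro sum.cong refl sum.swap)
    also have "\<dots> = (\<Sum>t<I. \<Sum>m<K. \<Sum>l<K.
        borcherds_rhs (E m u) (E l v) w (p + \<alpha> - int m) (q + \<beta> - int l) r t)"
      by (rule sum.swap)
    also have "\<dots> = ?R"
    proof (rule sum.cong[OF refl])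
      fix i
      let ?A = "\<lambda>m l. YW (E m u) (p + r - int i + \<alpha> - int m) (YW (E l v) (q + int i + \<beta> - int l) w)"
      let ?B = "\<lambda>m l. YW (E l v) (q + r - int i + \<beta> - int l) (YW (E m u) (p + int i + \<alpha> - int m) w)"
      let ?c = "(-1) ^ i * ((of_int r :: complex) gchoose i)"
      have "twist_mode u \<alpha> (p + r - int i) (twist_mode v \<beta> (q + int i) w) = (\<Sum>m<K. \<Sum>l<K. ?A m l)"
        by (simp add: twist_mode_eq_sum[OF K(1)] twist_mode_eq_sum[OF K(2)] mode_simps)
      moreover have "twist_mode v \<beta> (q + r - int i) (twist_mode u \<alpha> (p + int i) w) = (\<Sum>m<K. \<Sum>l<K. ?B m l)"
        by (subst sum.swap) (simp add: twist_mode_eq_sum[OF K(1)] twist_mode_eq_sum[OF K(2)] mode_simps)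
      moreover have "borcherds_rhs (E m u) (E l v) w (p + \<alpha> - int m) (q + \<beta> - int l) r i
          = ?c *\<^sub>C (?A m l - ((-1) powi r) *\<^sub>C ?B m l)" for m l
        unfolding borcherds_rhs_def by (simp add: algebra_simps)
      ultimately show "(\<Sum>m<K. \<Sum>l<K. borcherds_rhs (E m u) (E l v) w (p + \<alpha> - int m) (q + \<beta> - int l) r i)
        = ?c *\<^sub>C (twist_mode u \<alpha> (p + r - int i) (twist_mode v \<beta> (q + int i) w)
        - ((-1) powi r) *\<^sub>C twist_mode v \<beta> (q + r - int i) (twist_mode u \<alpha> (p + int i) w))"
        by (simp only: cvec.scale_sum_right sum_subtractf cvec.scale_right_diff_distrib)
    qed
    finally show ?thesis .
  qed
  then show ?thesis by blast
qed

end

section \<open>The twisted modes and the algebra they define\<close>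

text \<open>
These assumptions make \<^const>\<open>delta_coeff\<close> finite and linear on all states, so that the twisted modes
of an arbitrary state are determined by those of \<open>h\<^bsup>(r)\<^esup>(0)\<close>-eigenvectors.
\<close>

locale semisimple_twisting = twisting Y vac conf YW hr
  for Y :: "'v::complex_vector \<Rightarrow> int \<Rightarrow> 'v \<Rightarrow> 'v" and vac conf :: 'v
    and YW :: "'v \<Rightarrow> int \<Rightarrow> 'm::complex_vector \<Rightarrow> 'm" and hr :: 'v +
  assumes finite_exp: "finite_exp x" and decomposable: "\<exists>c. rat_decomposition (Y hr 0) x c"
begin

lemma rat_decomposition_eigen_component: "rat_decomposition (Y hr 0) x (eigen_component (Y hr 0) x)"
  using decomposable[of x] eigen_component_eqI[OF V_linear_mode'] by metis

lemma eigen_component_add: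
  "eigen_component (Y hr 0) (x + y) = (\<lambda>q. eigen_component (Y hr 0) x q + eigen_component (Y hr 0) y q)"
  by (intro eigen_component_eqI V_linear_mode' rat_decomposition_add rat_decomposition_eigen_component)

lemma eigen_component_scale:
  "eigen_component (Y hr 0) (k *\<^sub>C x) = (\<lambda>q. k *\<^sub>C eigen_component (Y hr 0) x q)"
  by (intro eigen_component_eqI V_linear_mode' rat_decomposition_scale rat_decomposition_eigen_component)

lemma eigen_component_zero: "eigen_component (Y hr 0) 0 = (\<lambda>q. 0)"
  using eigen_component_scale[of 0 0] by simp

lemma delta_coeff_eq_sum:
  assumes "\<And>m. m \<ge> K \<Longrightarrow> E m x = 0"
  shows "delta_coeff Y hr x q = (\<Sum>m<K. eigen_component (Y hr 0) (E m x) (q + of_nat m))"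
  unfolding delta_coeff_def using assms by (intro Sum_any_nat_eq_sum) (simp add: eigen_component_zero)

lemma finite_exp_common_bound: "\<exists>K. \<forall>m\<ge>K. E m x = 0 \<and> E m y = 0"
proof -
  obtain K1 K2 where "\<forall>m\<ge>K1. E m x = 0" "\<forall>m\<ge>K2. E m y = 0"
    using finite_exp[of x] finite_exp[of y] unfolding finite_exp_def by blast
  then show ?thesis by (intro exI[of _ "max K1 K2"]) auto
qed

lemma delta_coeff_linear: "linear_on UNIV (\<lambda>x. delta_coeff Y hr x q)"
  unfolding linear_on_def
proof (intro conjI ballI allI)
  fix x y
  obtain K where K: "\<And>m. m \<ge> K \<Longrightarrow> E m x = 0" "\<And>m. m \<ge> K \<Longrightarrow> E m y = 0"
    using finite_exp_common_bound[of x y] by blast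
  then have "\<And>m. m \<ge> K \<Longrightarrow> E m (x + y) = 0" by (simp add: E_simps)
  then show "delta_coeff Y hr (x + y) q = delta_coeff Y hr x q + delta_coeff Y hr y q"
    using K by (simp add: delta_coeff_eq_sum[of K] E_simps eigen_component_add sum.distrib)
next
  fix c x
  obtain K where K: "\<And>m. m \<ge> K \<Longrightarrow> E m x = 0" using finite_exp_common_bound[of x x] by blast
  then have "\<And>m. m \<ge> K \<Longrightarrow> E m (c *\<^sub>C x) = 0" by (simp add: E_simps)
  then show "delta_coeff Y hr (c *\<^sub>C x) q = c *\<^sub>C delta_coeff Y hr x q"
    using K by (simp add: delta_coeff_eq_sum[of K] E_simps eigen_component_scale cvec.scale_sum_right)
qed

lemma finite_delta_coeff: "finite {q. delta_coeff Y hr x q \<noteq> 0}"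
proof -
  obtain K where K: "\<And>m. m \<ge> K \<Longrightarrow> E m x = 0" using finite_exp_common_bound[of x x] by blast
  have "finite {q. eigen_component (Y hr 0) (E m x) (q + of_nat m) \<noteq> 0}" for m
  proof -
    have "{q. eigen_component (Y hr 0) (E m x) (q + of_nat m) \<noteq> 0}
      = (\<lambda>q. q - of_nat m) ` {q. eigen_component (Y hr 0) (E m x) q \<noteq> 0}"
      by (auto simp: image_iff intro!: exI[of _ "_ + of_nat m"])
    then show ?thesis
      using rat_decomposition_eigen_component[of "E m x"] by (simp add: rat_decomposition_def)
  qed
  then have "finite (\<Union>m<K. {q. eigen_component (Y hr 0) (E m x) (q + of_nat m) \<noteq> 0})" by blast
  then show ?thesis
  proof (rule finite_subset[rotated], safe)
    fix q assume "delta_coeff Y hr x q \<noteq> 0"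
    then have "(\<Sum>m<K. eigen_component (Y hr 0) (E m x) (q + of_nat m)) \<noteq> 0"
      using delta_coeff_eq_sum[of K x q] K by simp
    then obtain m where "m < K" "eigen_component (Y hr 0) (E m x) (q + of_nat m) \<noteq> 0"
      by (elim sum.not_neutral_contains_not_neutral) auto
    then show "q \<in> (\<Union>m<K. {q. eigen_component (Y hr 0) (E m x) (q + of_nat m) \<noteq> 0})" by blast
  qed
qed

abbreviation YT :: "'v \<Rightarrow> int \<Rightarrow> 'm \<Rightarrow> 'm" where "YT \<equiv> integral_twisted_mode Y hr YW"

lemma YT_eq_sum:
  assumes "finite F" "{q. delta_coeff Y hr x q \<noteq> 0} \<subseteq> F"
  shows "YT x n w = (\<Sum>q\<in>F. if of_int n + q \<in> \<int> then YW (delta_coeff Y hr x q) \<lfloor>of_int n + q\<rfloor> w else 0)"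
  unfolding integral_twisted_mode_def twisted_mode_def
  using assms by (intro Sum_any.expand_superset) (auto simp: mode_simps)

lemma YT_linear_state: "linear_on UNIV (\<lambda>x. YT x n w)"
  unfolding linear_on_def
proof (intro conjI ballI allI)
  fix x y
  let ?F = "{q. delta_coeff Y hr x q \<noteq> 0} \<union> {q. delta_coeff Y hr y q \<noteq> 0}"
  have "{q. delta_coeff Y hr (x + y) q \<noteq> 0} \<subseteq> ?F"
    by (auto simp: linear_on_UNIV[OF delta_coeff_linear])
  then show "YT (x + y) n w = YT x n w + YT y n w"
    by (simp add: YT_eq_sum[of ?F] finite_delta_coeff sum.distrib[symmetric] if_distrib
        linear_on_UNIV[OF delta_coeff_linear] mode_simps cong: if_cong)
next
  fix c x
  let ?F = "{q. delta_coeff Y hr x q \<noteq> 0}"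
  have "{q. delta_coeff Y hr (c *\<^sub>C x) q \<noteq> 0} \<subseteq> ?F"
    by (auto simp: linear_on_UNIV[OF delta_coeff_linear])
  then show "YT (c *\<^sub>C x) n w = c *\<^sub>C YT x n w"
    by (auto simp: YT_eq_sum[of ?F] finite_delta_coeff cvec.scale_sum_right
        linear_on_UNIV[OF delta_coeff_linear] mode_simps intro!: sum.cong)
qed

lemma YT_linear_mode: "linear_on UNIV (YT x n)"
proof -
  let ?F = "{q. delta_coeff Y hr x q \<noteq> 0}"
  show ?thesis
    by (auto simp: linear_on_def YT_eq_sum[of ?F] finite_delta_coeff cvec.scale_sum_right
        sum.distrib[symmetric] mode_simps intro!: sum.cong)
qed

lemmas YT_simps = linear_on_UNIV[OF YT_linear_state] linear_on_UNIV[OF YT_linear_mode]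

theorem YT_eigenvector:
  assumes u: "Y hr 0 u = of_int \<alpha> *\<^sub>C u"
  shows "YT u n w = twist_mode u \<alpha> n w"
proof -
  obtain K where K: "\<And>m. m \<ge> K \<Longrightarrow> E m u = 0" using finite_exp_common_bound[of u u] by blast
  have comp: "eigen_component (Y hr 0) (E m u) = (\<lambda>q. if q = of_int \<alpha> then E m u else 0)" for m
  proof (intro eigen_component_eqI V_linear_mode' rat_decomposition_eigenvector)
    show "Y hr 0 (E m u) = of_rat (of_int \<alpha>) *\<^sub>C E m u"
      using exp.exp_coeff_commute[of 0 m u] by (simp add: u E_simps)
  qed
  have delta: "delta_coeff Y hr u q = (\<Sum>m<K. if q + of_nat m = of_int \<alpha> then E m u else 0)" for q
    using delta_coeff_eq_sum[of K u q] K by (simp add: comp)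
  have delta_shift: "delta_coeff Y hr u (of_int \<alpha> - of_nat m) = E m u" if "m < K" for m
    using that by (simp add: delta sum.delta)
  let ?s = "\<lambda>m::nat. of_int \<alpha> - of_nat m :: rat"
  have "{q. delta_coeff Y hr u q \<noteq> 0} \<subseteq> ?s ` {..<K}"
  proof safe
    fix q assume "delta_coeff Y hr u q \<noteq> 0"
    then obtain m where "m < K" "q + of_nat m = of_int \<alpha>"
      unfolding delta by (elim sum.not_neutral_contains_not_neutral) (auto split: if_splits)
    then show "q \<in> ?s ` {..<K}" by (auto simp: image_iff eq_diff_eq)
  qed
  then have "YT u n w = (\<Sum>q\<in>?s ` {..<K}. if of_int n + q \<in> \<int>
      then YW (delta_coeff Y hr u q) \<lfloor>of_int n + q\<rfloor> w else 0)"
    by (intro YT_eq_sum) auto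
  also have "\<dots> = (\<Sum>m<K. if of_int n + ?s m \<in> \<int>
      then YW (delta_coeff Y hr u (?s m)) \<lfloor>of_int n + ?s m\<rfloor> w else 0)"
    by (subst sum.reindex) (auto simp: inj_on_def)
  also have "\<dots> = (\<Sum>m<K. YW (E m u) (n + \<alpha> - int m) w)"
  proof (rule sum.cong[OF refl])
    fix m assume "m \<in> {..<K}"
    moreover have "of_int n + ?s m = of_int (n + \<alpha> - int m)" by simp
    ultimately show "(if of_int n + ?s m \<in> \<int>
      then YW (delta_coeff Y hr u (?s m)) \<lfloor>of_int n + ?s m\<rfloor> w else 0) = YW (E m u) (n + \<alpha> - int m) w"
      by (simp only: Ints_of_int if_True floor_of_int delta_shift lessThan_iff)
  qed
  also have "\<dots> = twist_mode u \<alpha> n w" using twist_mode_eq_sum[OF K] by simp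
  finally show ?thesis .
qed

lemma twist_mode_truncation: "\<exists>N. \<forall>n\<ge>N. twist_mode u \<alpha> n w = 0"
proof -
  obtain K where K: "\<And>m. m \<ge> K \<Longrightarrow> E m u = 0" using finite_exp_common_bound[of u u] by blast
  have "\<forall>m. \<exists>N. \<forall>n\<ge>N. YW (E m u) n w = 0" using truncation by blast
  then obtain N where N: "\<And>m n. n \<ge> N m \<Longrightarrow> YW (E m u) n w = 0" by metis
  define M where "M = Max ((\<lambda>m. N m - \<alpha> + int m) ` {..<K} \<union> {0})"
  have "twist_mode u \<alpha> n w = 0" if "n \<ge> M" for n
  proof -
    have "N m \<le> n + \<alpha> - int m" if "m < K" for m
    proof -
      have "N m - \<alpha> + int m \<le> M" unfolding M_def using that by (intro Max_ge) auto
      then show ?thesis using \<open>n \<ge> M\<close> by linarith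
    qed
    then show ?thesis using twist_mode_eq_sum[OF K] N by simp
  qed
  then show ?thesis by blast
qed

end

context semisimple_twisting
begin

definition integral_states :: "'v set" where
  "integral_states = {u. \<exists>\<alpha>::int. Y hr 0 u = of_int \<alpha> *\<^sub>C u}"

lemma YT_truncation: "u \<in> cvec.span integral_states \<Longrightarrow> \<exists>N. \<forall>n\<ge>N. YT u n w = 0"
proof (induction rule: cvec.span_induct_alt)
  case base
  then show ?case by (simp add: YT_simps)
next
  case (step c x y)
  then obtain \<alpha> N where N: "Y hr 0 x = of_int \<alpha> *\<^sub>C x" "\<forall>n\<ge>N. YT y n w = 0"
    unfolding integral_states_def by blast
  obtain M where "\<forall>n\<ge>M. YT x n w = 0"
    using twist_mode_truncation[of x \<alpha> w] YT_eigenvector[OF N(1)] by metis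
  with N(2) show ?case by (intro exI[of _ "max N M"]) (simp add: YT_simps)
qed

definition YT_lhs :: "'v \<Rightarrow> 'v \<Rightarrow> 'm \<Rightarrow> int \<Rightarrow> int \<Rightarrow> int \<Rightarrow> nat \<Rightarrow> 'm" where
  "YT_lhs u v w p q r i =
     ((of_int p :: complex) gchoose i) *\<^sub>C YT (Y u (r + int i) v) (p + q - int i) w"

definition YT_rhs :: "'v \<Rightarrow> 'v \<Rightarrow> 'm \<Rightarrow> int \<Rightarrow> int \<Rightarrow> int \<Rightarrow> nat \<Rightarrow> 'm" where
  "YT_rhs u v w p q r i =
     ((-1) ^ i * ((of_int r :: complex) gchoose i)) *\<^sub>C
       (YT u (p + r - int i) (YT v (q + int i) w)
        - ((-1) powi r) *\<^sub>C YT v (q + r - int i) (YT u (p + int i) w))"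

text \<open>
The Borcherds identity in terms of partial sums, in which form it extends bilinearly from
\<open>h\<^bsup>(r)\<^esup>(0)\<close>-eigenvectors to their span.
\<close>

definition YT_borcherds :: "'v \<Rightarrow> 'v \<Rightarrow> 'm \<Rightarrow> int \<Rightarrow> int \<Rightarrow> int \<Rightarrow> bool" where
  "YT_borcherds u v w p q r \<longleftrightarrow>
     (\<exists>I0. \<forall>I\<ge>I0. (\<Sum>i<I. YT_lhs u v w p q r i) = (\<Sum>i<I. YT_rhs u v w p q r i))"

lemma YT_borcherds_linear:
  assumes "\<And>i. YT_lhs u v w p q r i = c *\<^sub>C YT_lhs u1 v1 w p q r i + YT_lhs u2 v2 w p q r i"
    and "\<And>i. YT_rhs u v w p q r i = c *\<^sub>C YT_rhs u1 v1 w p q r i + YT_rhs u2 v2 w p q r i"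
    and "YT_borcherds u1 v1 w p q r" "YT_borcherds u2 v2 w p q r"
  shows "YT_borcherds u v w p q r"
proof -
  obtain I1 I2 where "\<forall>I\<ge>I1. (\<Sum>i<I. YT_lhs u1 v1 w p q r i) = (\<Sum>i<I. YT_rhs u1 v1 w p q r i)"
    "\<forall>I\<ge>I2. (\<Sum>i<I. YT_lhs u2 v2 w p q r i) = (\<Sum>i<I. YT_rhs u2 v2 w p q r i)"
    using assms(3,4) unfolding YT_borcherds_def by blast
  then have "\<forall>I\<ge>max I1 I2. (\<Sum>i<I. YT_lhs u v w p q r i) = (\<Sum>i<I. YT_rhs u v w p q r i)"
    by (simp add: assms(1,2) sum.distrib cvec.scale_sum_right[symmetric])
  then show ?thesis unfolding YT_borcherds_def by blast
qed

lemma YT_borcherds_span: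
  assumes u: "u \<in> cvec.span integral_states" and v: "v \<in> cvec.span integral_states"
  shows "YT_borcherds u v w p q r"
proof -
  have 1: "YT_borcherds u v w p q r" if "u \<in> integral_states" "v \<in> integral_states" for u v
  proof -
    obtain \<alpha> \<beta> :: int where ab: "Y hr 0 u = of_int \<alpha> *\<^sub>C u" "Y hr 0 v = of_int \<beta> *\<^sub>C v"
      using \<open>u \<in> integral_states\<close> \<open>v \<in> integral_states\<close> unfolding integral_states_def by blast
    have "Y hr 0 (Y u n v) = of_int (\<alpha> + \<beta>) *\<^sub>C Y u n v" for n
      using adj.commutator_nonneg[of hr 0 u n v] ab
      by (simp add: V_mode_simps cvec.scale_left_distrib add.commute)
    then show ?thesis
      using twisted_borcherds[OF ab(1) finite_exp finite_exp, of p r v \<beta> q w]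
      by (simp add: YT_borcherds_def YT_lhs_def YT_rhs_def YT_eigenvector[OF ab(1)] YT_eigenvector[OF ab(2)]
          YT_eigenvector[of _ "\<alpha> + \<beta>"])
  qed
  have 2: "YT_borcherds u v w p q r" if "u \<in> integral_states" for u
    using v
  proof (induction rule: cvec.span_induct_alt)
    case base
    then show ?case
      by (simp add: YT_borcherds_def YT_lhs_def YT_rhs_def YT_simps V_mode_simps)
  next
    case (step c x y)
    show ?case
      by (rule YT_borcherds_linear[OF _ _ 1[OF that step(1)] step(2), where c = c])
        (simp_all add: YT_lhs_def YT_rhs_def YT_simps V_mode_simps cvec.scale_right_distrib
          cvec.scale_right_diff_distrib mult.commute)
  qed
  show ?thesis
    using u
  proof (induction rule: cvec.span_induct_alt)
    case base
    then show ?case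
      by (simp add: YT_borcherds_def YT_lhs_def YT_rhs_def YT_simps V_mode_simps)
  next
    case (step c x y)
    show ?case
      by (rule YT_borcherds_linear[OF _ _ 2[OF step(1)] step(2), where c = c])
        (simp_all add: YT_lhs_def YT_rhs_def YT_simps V_mode_simps cvec.scale_right_distrib
          cvec.scale_right_diff_distrib mult.commute)
  qed
qed

theorem YT_jacobi:
  assumes "U \<subseteq> cvec.span integral_states"
  shows "borcherds_identity U Y W YT"
  unfolding borcherds_identity_def
proof (intro ballI allI)
  fix u v w p q r
  assume "u \<in> U" "v \<in> U"
  then have u: "u \<in> cvec.span integral_states" and v: "v \<in> cvec.span integral_states"
    using assms by auto
  have tr: "\<exists>N::nat. \<forall>i\<ge>N. YT x (p + int i) w = 0" if x: "x \<in> cvec.span integral_states" for x p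
  proof -
    obtain N where "\<forall>n\<ge>N. YT x n w = 0" using YT_truncation[OF x] by blast
    then have "\<forall>i\<ge>nat (N - p). YT x (p + int i) w = 0" by auto
    then show ?thesis by blast
  qed
  obtain N where N: "\<forall>i\<ge>N. Y u (r + int i) v = 0" using V_truncation' by blast
  then have "\<forall>i\<ge>N. YT_lhs u v w p q r i = 0" by (simp add: YT_lhs_def YT_simps)
  then have 1: "\<exists>N. \<forall>i\<ge>N. YT_lhs u v w p q r i = 0" by blast
  obtain N1 where N1: "\<forall>i\<ge>N1. YT u (p + int i) w = 0" using tr[OF u] by blast
  obtain N2 where N2: "\<forall>i\<ge>N2. YT v (q + int i) w = 0" using tr[OF v] by blast
  have "\<forall>i\<ge>max N1 N2. YT_rhs u v w p q r i = 0"
    using N1 N2 by (simp add: YT_rhs_def YT_simps)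
  then have 2: "\<exists>N. \<forall>i\<ge>N. YT_rhs u v w p q r i = 0" by blast
  have "Sum_any (YT_lhs u v w p q r) = Sum_any (YT_rhs u v w p q r)"
    using Sum_any_eq_iff_eventually[OF 1 2] YT_borcherds_span[OF u v] unfolding YT_borcherds_def by blast
  then show "Sum_any (\<lambda>i::nat. ((of_int p :: complex) gchoose i) *\<^sub>C
                   YT (Y u (r + int i) v) (p + q - int i) w) =
        Sum_any (\<lambda>i::nat. ((-1) ^ i * ((of_int r :: complex) gchoose i)) *\<^sub>C
                   (YT u (p + r - int i) (YT v (q + int i) w)
                    - ((-1) powi r) *\<^sub>C YT v (q + r - int i) (YT u (p + int i) w)))"
    by (simp add: YT_lhs_def[abs_def] YT_rhs_def[abs_def])
qed

lemma stable_subspace_span: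
  assumes lin: "\<And>n w. linear_on UNIV (\<lambda>u. Z u n w)" and S: "cvec.subspace S"
    and X: "\<And>u n w. u \<in> X \<Longrightarrow> w \<in> S \<Longrightarrow> Z u n w \<in> S"
  shows "stable_subspace (cvec.span X) Z S"
proof -
  have "Z u n w \<in> S" if "u \<in> cvec.span X" "w \<in> S" for u n w
    using that(1)
  proof (induction rule: cvec.span_induct_alt)
    case base
    then show ?case using S by (simp add: linear_on_UNIV[OF lin] cvec.subspace_0)
  next
    case (step c x y)
    then show ?case using S X \<open>w \<in> S\<close>
      by (auto simp: linear_on_UNIV[OF lin] intro!: cvec.subspace_add cvec.subspace_scale)
  qed
  then show ?thesis using S by (simp add: stable_subspace_def)
qed

text \<open>
The layers \<open>X n\<close> filter the algebra in such a way that the terms \<open>E\<^sub>m u\<close> with \<open>m \<ge> 1\<close> lie in lower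
layers. Since \<open>E\<^sub>0 u = u\<close>, an untwisted mode of \<open>u\<close> is a twisted mode of \<open>u\<close> up to untwisted modes of
states in lower layers.
\<close>

theorem stable_subspace_YT_iff:
  fixes X :: "nat \<Rightarrow> 'v set"
  assumes int: "\<And>n. X n \<subseteq> integral_states"
    and E: "\<And>u n m. u \<in> X n \<Longrightarrow> m \<ge> 1 \<Longrightarrow> E m u = 0 \<or> (\<exists>n'<n. E m u \<in> X n')"
  shows "stable_subspace (cvec.span (\<Union>n. X n)) YT S \<longleftrightarrow> stable_subspace (cvec.span (\<Union>n. X n)) YW S"
proof
  assume st: "stable_subspace (cvec.span (\<Union>n. X n)) YT S"
  then have S: "cvec.subspace S" by (simp add: stable_subspace_def)
  have "\<forall>u\<in>X n. \<forall>p. \<forall>w\<in>S. YW u p w \<in> S" for n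
  proof (induction n rule: less_induct)
    case (less n)
    show ?case
    proof (intro ballI allI)
      fix u p w assume u: "u \<in> X n" and w: "w \<in> S"
      obtain \<alpha> :: int where \<alpha>: "Y hr 0 u = of_int \<alpha> *\<^sub>C u" using u int unfolding integral_states_def by blast
      obtain K where K: "\<And>m. m \<ge> Suc K \<Longrightarrow> E m u = 0"
        using finite_exp_common_bound[of u u] by (meson Suc_leD)
      have "YT u (p - \<alpha>) w = (\<Sum>m<Suc K. YW (E m u) (p - int m) w)"
        using twist_mode_eq_sum[OF K, where \<alpha> = \<alpha> and n = "p - \<alpha>"] by (simp add: YT_eigenvector[OF \<alpha>])
      also have "\<dots> = YW u p w + (\<Sum>m<K. YW (E (Suc m) u) (p - int (Suc m)) w)"
        by (subst sum.lessThan_Suc_shift) simp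
      finally have "YW u p w = YT u (p - \<alpha>) w - (\<Sum>m<K. YW (E (Suc m) u) (p - int (Suc m)) w)" by simp
      moreover have "YT u (p - \<alpha>) w \<in> S"
        using st u w unfolding stable_subspace_def by (blast intro: cvec.span_base)
      moreover have "YW (E (Suc m) u) (p - int (Suc m)) w \<in> S" for m
        using E[OF u, of "Suc m"] less w S by (auto simp: mode_simps cvec.subspace_0)
      ultimately show "YW u p w \<in> S"
        using S by (auto intro!: cvec.subspace_diff cvec.subspace_sum)
    qed
  qed
  then show "stable_subspace (cvec.span (\<Union>n. X n)) YW S"
    by (intro stable_subspace_span linear_state' S) blast
next
  assume st: "stable_subspace (cvec.span (\<Union>n. X n)) YW S"
  then have S: "cvec.subspace S" by (simp add: stable_subspace_def)
  have "YT u p w \<in> S" if u: "u \<in> X n" and w: "w \<in> S" for u n p w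
  proof -
    obtain \<alpha> :: int where \<alpha>: "Y hr 0 u = of_int \<alpha> *\<^sub>C u" using u int unfolding integral_states_def by blast
    obtain K where K: "\<And>m. m \<ge> K \<Longrightarrow> E m u = 0" using finite_exp_common_bound[of u u] by blast
    have EX: "E m u = 0 \<or> E m u \<in> cvec.span (\<Union>n. X n)" for m
      using E[OF u, of m] u by (cases "m = 0") (auto intro: cvec.span_base)
    have "YW (E m u) q w \<in> S" for m q
      using EX[of m] st w S by (auto simp: stable_subspace_def mode_simps cvec.subspace_0)
    then show ?thesis
      using S by (simp add: YT_eigenvector[OF \<alpha>] twist_mode_eq_sum[OF K] cvec.subspace_sum)
  qed
  then show "stable_subspace (cvec.span (\<Union>n. X n)) YT S"
    by (intro stable_subspace_span YT_linear_state S) blast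
qed

end

section \<open>Currents of the affine algebra\<close>

lemma mat2_eq_iff: "(a :: mat2) = b \<longleftrightarrow>
    a $ 1 $ 1 = b $ 1 $ 1 \<and> a $ 1 $ 2 = b $ 1 $ 2 \<and> a $ 2 $ 1 = b $ 2 $ 1 \<and> a $ 2 $ 2 = b $ 2 $ 2"
  by (auto simp: vec_eq_iff forall_2)

lemma mat2_mult_entry: "((a :: mat2) ** b) $ i $ j = a $ i $ 1 * b $ 1 $ j + a $ i $ 2 * b $ 2 $ j"
  by (simp add: matrix_matrix_mult_def sum_2)

lemma trace_mat2: "trace (a :: mat2) = a $ 1 $ 1 + a $ 2 $ 2"
  by (simp add: trace_def sum_2)

lemma chevalley_entries [simp]:
  "mat_h $ 1 $ 1 = 1" "mat_h $ 1 $ 2 = 0" "mat_h $ 2 $ 1 = 0" "mat_h $ 2 $ 2 = -1"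
  "mat_e $ 1 $ 1 = 0" "mat_e $ 1 $ 2 = 1" "mat_e $ 2 $ 1 = 0" "mat_e $ 2 $ 2 = 0"
  "mat_f $ 1 $ 1 = 0" "mat_f $ 1 $ 2 = 0" "mat_f $ 2 $ 1 = 1" "mat_f $ 2 $ 2 = 0"
  by (simp_all add: mat_h_def mat_e_def mat_f_def vector_2)

lemmas mat2_simps = mat2_eq_iff mat2_mult_entry trace_mat2 lie_bracket_def sl2_def mat_def

lemma sl2_chevalley [simp]: "mat_h \<in> sl2" "mat_e \<in> sl2" "mat_f \<in> sl2"
  by (simp_all add: mat2_simps)

lemma sl2_closed:
  "a \<in> sl2 \<Longrightarrow> b \<in> sl2 \<Longrightarrow> a + b \<in> sl2" "a \<in> sl2 \<Longrightarrow> mat c ** a \<in> sl2"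
  "a \<in> sl2 \<Longrightarrow> b \<in> sl2 \<Longrightarrow> lie_bracket a b \<in> sl2"
  by (auto simp: mat2_simps algebra_simps) (metis distrib_left mult_zero_right)

lemma sl2_expansion:
  "a \<in> sl2 \<Longrightarrow> a = (mat (a $ 1 $ 1) ** mat_h + mat (a $ 1 $ 2) ** mat_e) + mat (a $ 2 $ 1) ** mat_f"
  by (auto simp: mat2_simps add_eq_0_iff2)

lemma chevalley_brackets:
  "lie_bracket mat_h mat_h = mat 0 ** mat_h"
  "lie_bracket mat_e mat_e = mat 0 ** mat_h"
  "lie_bracket mat_f mat_f = mat 0 ** mat_h"
  "lie_bracket mat_h mat_e = mat 2 ** mat_e"
  "lie_bracket mat_e mat_h = mat (-2) ** mat_e"
  "lie_bracket mat_h mat_f = mat (-2) ** mat_f"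
  "lie_bracket mat_f mat_h = mat 2 ** mat_f"
  "lie_bracket mat_e mat_f = mat 1 ** mat_h"
  "lie_bracket mat_f mat_e = mat (-1) ** mat_h"
  by (simp_all add: mat2_simps)

lemma chevalley_traces:
  "trace (mat_h ** mat_h) = 2" "trace (mat_e ** mat_e) = 0" "trace (mat_f ** mat_f) = 0"
  "trace (mat_h ** mat_e) = 0" "trace (mat_e ** mat_h) = 0"
  "trace (mat_h ** mat_f) = 0" "trace (mat_f ** mat_h) = 0"
  "trace (mat_e ** mat_f) = 1" "trace (mat_f ** mat_e) = 1"
  by (simp_all add: mat2_simps)

context simple_affine_sl2_voa
begin

lemma adjoint_module: "full_module Y vac conf Y"
  using simple by (simp add: simple_voa_def irreducible_module_def full_module_def)

sublocale adj: full_module Y vac conf Y by (rule adjoint_module)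

abbreviation "hh \<equiv> \<iota> mat_h"
abbreviation "ee \<equiv> \<iota> mat_e"
abbreviation "ff \<equiv> \<iota> mat_f"

lemma \<iota>_brackets:
  "\<iota> (lie_bracket mat_h mat_h) = 0" "\<iota> (lie_bracket mat_e mat_e) = 0" "\<iota> (lie_bracket mat_f mat_f) = 0"
  "\<iota> (lie_bracket mat_h mat_e) = 2 *\<^sub>C ee" "\<iota> (lie_bracket mat_e mat_h) = - (2 *\<^sub>C ee)"
  "\<iota> (lie_bracket mat_h mat_f) = - (2 *\<^sub>C ff)" "\<iota> (lie_bracket mat_f mat_h) = 2 *\<^sub>C ff"
  "\<iota> (lie_bracket mat_e mat_f) = hh" "\<iota> (lie_bracket mat_f mat_e) = - hh"
  by (simp_all only: chevalley_brackets current_scale sl2_chevalley) simp_all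

lemma \<iota>_expansion: "a \<in> sl2 \<Longrightarrow> \<exists>x y z. \<iota> a = x *\<^sub>C hh + y *\<^sub>C ee + z *\<^sub>C ff"
  by (subst sl2_expansion, assumption) (auto simp: current_add current_scale sl2_closed)

lemma current_products:
  assumes "a \<in> sl2" "b \<in> sl2"
  shows "Y (\<iota> a) 0 (\<iota> b) = \<iota> (lie_bracket a b)"
    and "Y (\<iota> a) 1 (\<iota> b) = (trace (a ** b) * of_nat k) *\<^sub>C vac"
    and "n \<ge> 2 \<Longrightarrow> Y (\<iota> a) n (\<iota> b) = 0"
proof -
  have *: "Y (\<iota> a) n (\<iota> b) = Y (\<iota> (lie_bracket a b)) (n - 1) vac
      + (if n = 1 then (of_int n * trace (a ** b) * of_nat k) *\<^sub>C vac else 0)" if "n \<ge> 0" for n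
    using affine_commutator[OF assms, of n "-1" vac] adj.V.creation[of "\<iota> b"] adj.V.creation(2)[of "\<iota> a" n] that
    by (simp add: adj.V_mode_simps)
  show "Y (\<iota> a) 0 (\<iota> b) = \<iota> (lie_bracket a b)"
    using *[of 0] by (simp add: adj.V.creation)
  show "Y (\<iota> a) 1 (\<iota> b) = (trace (a ** b) * of_nat k) *\<^sub>C vac"
    using *[of 1] by (simp add: adj.V.creation)
  show "n \<ge> 2 \<Longrightarrow> Y (\<iota> a) n (\<iota> b) = 0"
    using *[of n] by (simp add: adj.V.creation)
qed

lemma current_quadratic:
  assumes "a \<in> sl2" "x \<in> sl2" "y \<in> sl2"
  shows "Y (\<iota> a) n (Y (\<iota> x) (-1) (\<iota> y)) = Y (\<iota> x) (-1) (Y (\<iota> a) n (\<iota> y))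
    + Y (\<iota> (lie_bracket a x)) (n - 1) (\<iota> y) + (if n = 1 then (trace (a ** x) * of_nat k) *\<^sub>C \<iota> y else 0)"
  using affine_commutator[OF assms(1,2), of n "-1" "\<iota> y"] by (auto simp: diff_eq_eq add_ac)

lemma level_nonzero: "2 * (of_nat k + 2 :: complex) \<noteq> 0"
  by (metis mult_eq_0_iff of_nat_add of_nat_eq_0_iff of_nat_numeral add_is_0 zero_neq_numeral)

text \<open>
The currents are primary of weight 1. This is Sugawara's computation: for \<open>n = 1\<close> the level contributes
\<open>2k\<close>, and the double brackets contribute the Casimir eigenvalue 4 of the adjoint representation; the
sum is cancelled by the normalisation \<open>2(k + 2)\<close>.
\<close>

lemma current_conf:
  assumes a: "a \<in> {mat_h, mat_e, mat_f}" and n: "n \<ge> 0"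
  shows "Y (\<iota> a) n conf = (if n = 1 then \<iota> a else 0)"
proof -
  let ?S = "(1/2) *\<^sub>C Y hh (-1) hh + Y ee (-1) ff + Y ff (-1) ee"
  have conf: "Y (\<iota> a) n conf = (1 / (2 * (of_nat k + 2))) *\<^sub>C Y (\<iota> a) n ?S"
    by (subst sugawara) (simp add: adj.V_mode_simps)
  have S: "Y (\<iota> a) n ?S = (if n = 1 then (2 * (of_nat k + 2)) *\<^sub>C \<iota> a else 0)"
  proof -
    consider "n = 0" | "n = 1" | "n = 2" | "n \<ge> 3" using n by linarith
    then show ?thesis
    proof cases
      case 1
      then show ?thesis using a
        by (auto simp: adj.V_mode_simps current_quadratic current_products \<iota>_brackets
            cvec.scale_right_distrib cvec.scale_right_diff_distrib)
    next
      case 2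
      have comb: "of_nat k *\<^sub>C x + (of_nat k *\<^sub>C x + (2 *\<^sub>C x + 2 *\<^sub>C x)) = 4 *\<^sub>C x + (of_nat k * 2) *\<^sub>C x"
        for x :: 'v
        by (simp add: cvec.scale_left_distrib[symmetric])
      show ?thesis using a 2
        by (auto simp: adj.V_mode_simps current_quadratic current_products \<iota>_brackets chevalley_traces
            adj.V.creation cvec.scale_right_distrib cvec.scale_left_distrib algebra_simps comb)
    next
      case 3
      then show ?thesis using a
        by (auto simp: adj.V_mode_simps current_quadratic current_products \<iota>_brackets chevalley_traces)
    next
      case 4
      then show ?thesis using a
        by (auto simp: adj.V_mode_simps current_quadratic current_products \<iota>_brackets)
    qed
  qed
  show ?thesis using level_nonzero by (simp add: conf S)
qed

end

locale affine_module = simple_affine_sl2_voa k Y vac conf \<iota> + full_module Y vac conf YW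
  for k :: nat and Y :: "'v::complex_vector \<Rightarrow> int \<Rightarrow> 'v \<Rightarrow> 'v" and vac conf :: 'v
    and \<iota> :: "mat2 \<Rightarrow> 'v" and YW :: "'v \<Rightarrow> int \<Rightarrow> 'm::complex_vector \<Rightarrow> 'm"
begin

lemma current_commutator:
  assumes "a \<in> sl2" "b \<in> sl2"
  shows "YW (\<iota> a) m (YW (\<iota> b) n w) = YW (\<iota> b) n (YW (\<iota> a) m w) + YW (\<iota> (lie_bracket a b)) (m + n) w
    + (if m + n = 0 then (of_int m * trace (a ** b) * of_nat k) *\<^sub>C w else 0)"
proof -
  have "YW (\<iota> a) m (YW (\<iota> b) n w) - YW (\<iota> b) n (YW (\<iota> a) m w) =
     (\<Sum>i<2. ((of_int m :: complex) gchoose i) *\<^sub>C YW (Y (\<iota> a) (int i) (\<iota> b)) (m + n - int i) w)"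
    by (rule commutator) (simp add: current_products(3)[OF assms])
  also have "\<dots> = YW (\<iota> (lie_bracket a b)) (m + n) w
    + (if m + n = 0 then (of_int m * trace (a ** b) * of_nat k) *\<^sub>C w else 0)"
    using assms by (auto simp: numeral_2_eq_2 current_products mode_simps vacuum)
  finally show ?thesis by (simp add: diff_eq_eq add_ac)
qed

text \<open>
Commuting the current past the conformal vector, instead of the other way round, needs only
\<open>current_conf\<close>.
\<close>

lemma conformal_weight_current:
  assumes "a \<in> {mat_h, mat_e, mat_f}"
  shows "YW conf 1 (YW (\<iota> a) n w) = YW (\<iota> a) n (YW conf 1 w) - of_int n *\<^sub>C YW (\<iota> a) n w"
proof -
  have "YW (\<iota> a) n (YW conf 1 w) - YW conf 1 (YW (\<iota> a) n w) =
     (\<Sum>i<2. ((of_int n :: complex) gchoose i) *\<^sub>C YW (Y (\<iota> a) (int i) conf) (n + 1 - int i) w)"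
    by (rule commutator) (simp add: current_conf[OF assms])
  also have "\<dots> = of_int n *\<^sub>C YW (\<iota> a) n w"
    using assms by (simp add: numeral_2_eq_2 current_conf mode_simps)
  finally show ?thesis by (simp add: algebra_simps)
qed

lemma h_weight_current:
  "YW hh 0 (YW hh n w) = YW hh n (YW hh 0 w)"
  "YW hh 0 (YW ee n w) = YW ee n (YW hh 0 w) + 2 *\<^sub>C YW ee n w"
  "YW hh 0 (YW ff n w) = YW ff n (YW hh 0 w) - 2 *\<^sub>C YW ff n w"
  using current_commutator[of mat_h mat_h 0 n w] current_commutator[of mat_h mat_e 0 n w]
    current_commutator[of mat_h mat_f 0 n w]
  by (simp_all add: \<iota>_brackets mode_simps)

lemma current_closed:
  assumes S: "cvec.subspace S" and "\<And>a. a \<in> {mat_h, mat_e, mat_f} \<Longrightarrow> YW (\<iota> a) n w \<in> S" and "a \<in> sl2"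
  shows "YW (\<iota> a) n w \<in> S"
proof -
  obtain x y z where "\<iota> a = x *\<^sub>C hh + y *\<^sub>C ee + z *\<^sub>C ff" using \<iota>_expansion assms(3) by blast
  then show ?thesis using assms
    by (auto simp: mode_simps intro!: cvec.subspace_add cvec.subspace_scale)
qed

lemma stable_if_chevalley_stable:
  assumes S: "cvec.subspace S"
    and X: "\<And>a n w. a \<in> {mat_h, mat_e, mat_f} \<Longrightarrow> w \<in> S \<Longrightarrow> YW (\<iota> a) n w \<in> S"
  shows "stable_subspace UNIV YW S"
  using current_closed[OF S] X
  by (intro stable_if_generators_stable[OF affine_generated S]) blast

end

section \<open>The automorphism and its fixed points\<close>

context commuting_modes
begin

lemma exp_coeff_intertwine:
  assumes T: "linear_on UNIV T" and TH: "\<And>n x. T (H n x) = H n (T x)"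
  shows "T (exp_coeff H m x) = exp_coeff H m (T x)"
proof -
  have "T (monomial ns x) = monomial ns (T x)" for ns
    by (induction ns) (simp_all add: linear_on_UNIV[OF T] TH)
  then show ?thesis by (simp add: exp_coeff_monomial linear_on_UNIV[OF T])
qed

text \<open>
Each \<open>H(n)\<close> lowers the eigenvalue by \<open>n\<close>, and the parts of a composition of \<open>m\<close> sum to \<open>m\<close>.
\<close>

lemma exp_coeff_lowers:
  assumes T: "linear_on UNIV T" and TH: "\<And>n x. T (H n x) = H n (T x) - of_int n *\<^sub>C H n x"
    and x: "T x = a *\<^sub>C x"
  shows "T (exp_coeff H m x) = (a - of_nat m) *\<^sub>C exp_coeff H m x"
proof -
  have "T (monomial ns x) = (a - of_nat (sum_list ns)) *\<^sub>C monomial ns x" for ns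
  proof (induction ns)
    case (Cons n ns)
    have "T (H (int n) (monomial ns x)) = (a - of_nat (sum_list ns) - of_nat n) *\<^sub>C H (int n) (monomial ns x)"
      by (simp add: TH Cons H_simps cvec.scale_left_diff_distrib)
    then show ?case by (simp add: linear_on_UNIV[OF T] mult.commute diff_diff_eq add.commute)
  qed (simp add: x)
  then show ?thesis
    by (simp add: exp_coeff_monomial linear_on_UNIV[OF T] cvec.scale_sum_right compositions_def mult.commute)
qed

end

definition omega :: complex where "omega = (-1 + \<i> * of_real (sqrt 3)) / 2"

lemma omega_inverse: "inverse omega = (-1 - \<i> * of_real (sqrt 3)) / 2"
  and omega_nonzero: "omega \<noteq> 0" and omega_cubed: "omega ^ 3 = 1" and omega_sum: "1 + omega + omega ^ 2 = 0"
proof -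
  define s where "s = complex_of_real (sqrt 3)"
  have s: "s * s = 3" unfolding s_def by (simp flip: of_real_mult)
  have om: "omega = (-1 + \<i> * s) / 2" by (simp add: omega_def s_def)
  have "omega * ((-1 - \<i> * s) / 2) = (1 - \<i> * \<i> * (s * s)) / 4" unfolding om by (simp add: field_simps)
  then have prod: "omega * ((-1 - \<i> * s) / 2) = 1" by (simp add: s)
  then show "inverse omega = (-1 - \<i> * of_real (sqrt 3)) / 2" unfolding s_def by (metis inverse_unique)
  show nz: "omega \<noteq> 0" using prod by auto
  have "omega ^ 2 = (1 - 2 * \<i> * s + \<i> * \<i> * (s * s)) / 4" unfolding om by (simp add: field_simps power2_eq_square)
  also have "\<dots> = (-1 - \<i> * s) / 2" by (simp add: s field_simps)
  finally have square: "omega ^ 2 = (-1 - \<i> * s) / 2" .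
  show sum: "1 + omega + omega ^ 2 = 0" unfolding square by (simp add: om field_simps)
  have "omega ^ 3 - 1 = (omega - 1) * (1 + omega + omega ^ 2)" by (simp add: algebra_simps power2_eq_square power3_eq_cube)
  then show "omega ^ 3 = 1" using sum by simp
qed

lemma omega_powi_3: "omega powi (3 * m) = 1"
  by (simp add: power_int_mult omega_cubed)

lemma omega_powi_sum:
  assumes "\<not> 3 dvd (m :: int)"
  shows "1 + omega powi m + omega powi m * omega powi m = 0"
proof -
  obtain q t where m: "m = 3 * q + t" "t = 1 \<or> t = 2"
  proof -
    have "m = 3 * (m div 3) + m mod 3" "m mod 3 = 1 \<or> m mod 3 = 2"
      using assms by presburger+
    then show ?thesis using that by blast
  qed
  have "omega powi m = omega powi t" using m(1) by (simp add: power_int_add omega_nonzero omega_powi_3)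
  then consider "omega powi m = omega" | "omega powi m = omega ^ 2" using m(2) by auto
  then show ?thesis
  proof cases
    case 1
    then show ?thesis using omega_sum by (simp add: power2_eq_square)
  next
    case 2
    have "omega ^ 2 * omega ^ 2 = omega * omega ^ 3" by (simp add: power2_eq_square power3_eq_cube)
    then show ?thesis using 2 omega_sum by (simp add: omega_cubed add_ac)
  qed
qed

locale affine_automorphism = simple_affine_sl2_voa k Y vac conf \<iota>
  for k :: nat and Y :: "'v::complex_vector \<Rightarrow> int \<Rightarrow> 'v \<Rightarrow> 'v" and vac conf :: 'v and \<iota> :: "mat2 \<Rightarrow> 'v" +
  fixes \<sigma> :: "'v \<Rightarrow> 'v"
  assumes lifts: "lifts_sigma Y vac conf \<iota> \<sigma>"
begin

sublocale ad: affine_module k Y vac conf \<iota> Y by unfold_locales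

lemma \<sigma>_linear: "linear_on UNIV \<sigma>"
  and \<sigma>_mode: "\<sigma> (Y u n v) = Y (\<sigma> u) n (\<sigma> v)"
  and \<sigma>_vac: "\<sigma> vac = vac" and \<sigma>_conf: "\<sigma> conf = conf"
  and \<sigma>_h: "\<sigma> hh = hh" and \<sigma>_e: "\<sigma> ee = omega *\<^sub>C ee" and \<sigma>_f: "\<sigma> ff = inverse omega *\<^sub>C ff"
  using lifts by (simp_all add: lifts_sigma_def voa_automorphism_def omega_inverse) (simp add: omega_def)

lemmas \<sigma>_simps = linear_on_UNIV[OF \<sigma>_linear]

text \<open>
The states of conformal weight \<open>N\<close> and \<open>h(0)\<close>-weight \<open>2 m\<close> on which \<open>\<sigma>\<close> acts by the corresponding
power of \<open>\<omega>\<close>. That these span the algebra says that \<open>\<sigma>\<close> is \<open>\<omega>\<close> to the power \<open>h(0)/2\<close>.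
\<close>

definition homogeneous :: "int \<Rightarrow> int \<Rightarrow> 'v set" where
  "homogeneous N m = {x. Y conf 1 x = of_int N *\<^sub>C x \<and> Y hh 0 x = of_int (2 * m) *\<^sub>C x \<and> \<sigma> x = (omega powi m) *\<^sub>C x}"

lemma homogeneous_current:
  assumes x: "x \<in> homogeneous N m"
  shows "Y hh n x \<in> homogeneous (N - n) m" "Y ee n x \<in> homogeneous (N - n) (m + 1)"
    "Y ff n x \<in> homogeneous (N - n) (m - 1)"
proof -
  have L: "Y conf 1 x = of_int N *\<^sub>C x" and h: "Y hh 0 x = of_int (2 * m) *\<^sub>C x"
    and s: "\<sigma> x = (omega powi m) *\<^sub>C x" using x by (simp_all add: homogeneous_def)
  have "Y conf 1 (Y (\<iota> a) n x) = of_int (N - n) *\<^sub>C Y (\<iota> a) n x" if "a \<in> {mat_h, mat_e, mat_f}" for a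
    using that by (simp add: ad.conformal_weight_current L adj.V_mode_simps cvec.scale_left_diff_distrib)
  moreover have "Y hh 0 (Y hh n x) = of_int (2 * m) *\<^sub>C Y hh n x"
    "Y hh 0 (Y ee n x) = of_int (2 * (m + 1)) *\<^sub>C Y ee n x"
    "Y hh 0 (Y ff n x) = of_int (2 * (m - 1)) *\<^sub>C Y ff n x"
    unfolding ad.h_weight_current h adj.V_mode_simps
    by (simp_all add: cvec.scale_left_diff_distrib cvec.scale_left_distrib ring_distribs)
  moreover have "\<sigma> (Y hh n x) = (omega powi m) *\<^sub>C Y hh n x"
    "\<sigma> (Y ee n x) = (omega powi (m + 1)) *\<^sub>C Y ee n x"
    "\<sigma> (Y ff n x) = (omega powi (m - 1)) *\<^sub>C Y ff n x"
  proof -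
    have "omega powi (m + 1) = omega powi m * omega" "omega powi (m - 1) = omega powi m * inverse omega"
      by (simp_all add: power_int_add power_int_diff omega_nonzero divide_inverse)
    then show "\<sigma> (Y ee n x) = (omega powi (m + 1)) *\<^sub>C Y ee n x"
      "\<sigma> (Y ff n x) = (omega powi (m - 1)) *\<^sub>C Y ff n x"
      by (simp_all only: \<sigma>_mode \<sigma>_e \<sigma>_f s adj.V_mode_simps cvec.scale_scale)
    show "\<sigma> (Y hh n x) = (omega powi m) *\<^sub>C Y hh n x"
      by (simp only: \<sigma>_mode \<sigma>_h s adj.V_mode_simps)
  qed
  ultimately show "Y hh n x \<in> homogeneous (N - n) m" "Y ee n x \<in> homogeneous (N - n) (m + 1)"
    "Y ff n x \<in> homogeneous (N - n) (m - 1)"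
    unfolding homogeneous_def by blast+
qed

lemma vac_homogeneous: "vac \<in> homogeneous 0 0"
  using adj.V.creation(2) by (simp add: homogeneous_def \<sigma>_vac)

lemma span_homogeneous: "cvec.span (\<Union>N m. homogeneous N m) = UNIV"
proof -
  let ?S = "cvec.span (\<Union>N m. homogeneous N m)"
  have "Y (\<iota> a) n x \<in> ?S" if a: "a \<in> {mat_h, mat_e, mat_f}" and "x \<in> ?S" for a n x
    using that(2)
  proof (induction rule: cvec.span_induct_alt)
    case base
    then show ?case by (simp add: adj.V_mode_simps cvec.span_zero)
  next
    case (step c x y)
    then obtain N m where "x \<in> homogeneous N m" by blast
    then have "\<exists>N' m'. Y (\<iota> a) n x \<in> homogeneous N' m'"
      using homogeneous_current[of x N m n] a by blast
    then have "Y (\<iota> a) n x \<in> (\<Union>N m. homogeneous N m)" by simp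
    then show ?case using step
      by (auto simp: adj.V_mode_simps intro!: cvec.span_add cvec.span_scale intro: cvec.span_base)
  qed
  then have "stable_subspace UNIV Y ?S" by (intro ad.stable_if_chevalley_stable) auto
  then have st: "stable_subspace (\<iota> ` sl2) Y ?S" by (simp add: stable_subspace_def)
  have "{vac} \<subseteq> ?S" using vac_homogeneous by (auto intro: cvec.span_base)
  then show ?thesis using affine_generated hull_minimal[of "{vac}" ?S "stable_subspace (\<iota> ` sl2) Y"] st by auto
qed

definition fixed :: "'v set" where "fixed = fixed_points {id, \<sigma>, \<sigma> \<circ> \<sigma>} UNIV"

lemma fixed_iff: "x \<in> fixed \<longleftrightarrow> \<sigma> x = x"
  by (auto simp: fixed_def fixed_points_def)

text \<open>
The projection \<open>(1 + \<sigma> + \<sigma>\<^sup>2)/3\<close> onto the fixed points is the identity on homogeneous states with \<open>m\<close>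
divisible by 3 and kills the others.
\<close>

lemma span_fixed_homogeneous: "fixed = cvec.span (\<Union>N m. homogeneous N (3 * m))" (is "_ = ?S")
proof
  show "?S \<subseteq> fixed"
    by (rule cvec.span_minimal)
      (auto simp: homogeneous_def fixed_iff omega_powi_3 \<sigma>_simps intro!: cvec.subspaceI)
  show "fixed \<subseteq> ?S"
  proof
    fix x assume "x \<in> fixed"
    then have x: "\<sigma> x = x" by (simp add: fixed_iff)
    have "x + \<sigma> x + \<sigma> (\<sigma> x) \<in> ?S" if "x \<in> cvec.span (\<Union>N m. homogeneous N m)" for x
      using that
    proof (induction rule: cvec.span_induct_alt)
      case base
      then show ?case by (simp add: \<sigma>_simps cvec.span_zero)
    next
      case (step c x y)
      then obtain N m where xm: "x \<in> homogeneous N m" by blast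
      have "x + \<sigma> x + \<sigma> (\<sigma> x) \<in> ?S"
      proof (cases "3 dvd m")
        case True
        then obtain q where "m = 3 * q" by blast
        then have "x \<in> ?S" using xm by (auto intro!: cvec.span_base)
        moreover have "\<sigma> x = x" using xm \<open>m = 3 * q\<close> by (simp add: homogeneous_def omega_powi_3)
        ultimately show ?thesis by (simp add: cvec.span_add)
      next
        case False
        have "x + \<sigma> x + \<sigma> (\<sigma> x) = (1 + omega powi m + omega powi m * omega powi m) *\<^sub>C x"
          using xm by (simp add: homogeneous_def \<sigma>_simps cvec.scale_left_distrib)
        then show ?thesis using omega_powi_sum[OF False] by (simp add: cvec.span_zero)
      qed
      then have "c *\<^sub>C (x + \<sigma> x + \<sigma> (\<sigma> x)) + (y + \<sigma> y + \<sigma> (\<sigma> y)) \<in> ?S"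
        by (rule cvec.span_add[OF cvec.span_scale step(2)])
      then show ?case by (simp add: \<sigma>_simps cvec.scale_right_distrib add_ac)
    qed
    then have "x + x + x \<in> ?S" using x span_homogeneous by (metis UNIV_I)
    then have "(1/3) *\<^sub>C (x + x + x) \<in> ?S" by (rule cvec.span_scale)
    then show "x \<in> ?S" by (simp add: cvec.scale_right_distrib cvec.scale_left_distrib[symmetric])
  qed
qed

lemma subspace_fixed: "cvec.subspace fixed"
  unfolding span_fixed_homogeneous by simp

lemma fixed_vertex_operator_algebra: "vertex_operator_algebra fixed Y vac conf"
proof
  show "cvec.subspace fixed" by (rule subspace_fixed)
  show "Y u n w \<in> fixed" if "u \<in> fixed" "w \<in> fixed" for u n w
    using that by (simp add: fixed_iff \<sigma>_mode)
  show "linear_on fixed (\<lambda>u. Y u n w)" for n w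
    by (simp add: linear_on_def adj.V_mode_simps)
  show "linear_on fixed (Y u n)" for n u
    by (simp add: linear_on_def adj.V_mode_simps)
  show "\<exists>N. \<forall>n\<ge>N. Y u n w = 0" for u w by (rule adj.truncation) auto
  show "vac \<in> fixed" "conf \<in> fixed" by (simp_all add: fixed_iff \<sigma>_vac \<sigma>_conf)
  show "Y vac n u = (if n = -1 then u else 0)" for n u by (rule adj.V.vacuum) auto
  show "Y u (-1) vac = u" for u by (rule adj.V.creation) auto
  show "Y u n vac = 0" if "n \<ge> 0" for u n using that by (intro adj.V.creation) auto
  show "borcherds_identity fixed Y fixed Y"
    using adj.V.jacobi unfolding borcherds_identity_def by blast
  show "\<exists>c::complex. \<forall>m n. \<forall>u\<in>fixed.
          Y conf (m + 1) (Y conf (n + 1) u) - Y conf (n + 1) (Y conf (m + 1) u) =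
          of_int (m - n) *\<^sub>C Y conf (m + n + 1) u
          + (if m + n = 0 then (of_int (m ^ 3 - m) / 12 * c) *\<^sub>C u else 0)"
    using adj.V.virasoro by blast
  show "Y (Y conf 0 u) n w = - of_int n *\<^sub>C Y u (n - 1) w" for u n w
    by (rule adj.V.translation) auto
  have sub: "homogeneous N (3 * m) \<subseteq> eigenspace fixed (Y conf 1) (of_int N)" for N m
    by (auto simp: homogeneous_def eigenspace_def fixed_iff omega_powi_3)
  have "fixed = cvec.span (\<Union>N m. homogeneous N (3 * m))" by (rule span_fixed_homogeneous)
  also have "\<dots> \<subseteq> cvec.span (\<Union>n::int. eigenspace fixed (Y conf 1) (of_int n))"
    using sub by (intro cvec.span_mono) blast
  finally show "fixed \<subseteq> cvec.span (\<Union>n::int. eigenspace fixed (Y conf 1) (of_int n))" .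
  show "finite_dim (eigenspace fixed (Y conf 1) (of_int n))" for n
    using adj.V.weight_finite_dim[of n] unfolding finite_dim_def eigenspace_def by blast
  obtain N :: int where "\<forall>n<N. eigenspace UNIV (Y conf 1) (of_int n) = {0}"
    using adj.V.weight_bounded by blast
  then have "\<forall>n<N. eigenspace fixed (Y conf 1) (of_int n) = {0}"
    using subspace_fixed adj.V_mode_simps unfolding eigenspace_def
    by (auto simp: cvec.subspace_0)
  then show "\<exists>N::int. \<forall>n<N. eigenspace fixed (Y conf 1) (of_int n) = {0}" by blast
qed

definition lowest_weight :: int where
  "lowest_weight = (SOME N::int. \<forall>n<N. eigenspace UNIV (Y conf 1) (of_int n) = {0})"

lemma homogeneous_below: "N < lowest_weight \<Longrightarrow> x \<in> homogeneous N m \<Longrightarrow> x = 0"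
  using someI_ex[OF adj.V.weight_bounded] unfolding lowest_weight_def homogeneous_def eigenspace_def by blast

text \<open>
The fixed point algebra by conformal weight, counted from a lower bound of the weights so that the
index can serve for induction.
\<close>

definition fixed_layer :: "nat \<Rightarrow> 'v set" where
  "fixed_layer n = (\<Union>m. homogeneous (lowest_weight + int n) (3 * m))"

lemma span_fixed_layers: "fixed = cvec.span (\<Union>n. fixed_layer n)"
  unfolding span_fixed_homogeneous
proof (rule subset_antisym; rule cvec.span_minimal)
  show "(\<Union>N m. homogeneous N (3 * m)) \<subseteq> cvec.span (\<Union>n. fixed_layer n)"
  proof clarify
    fix x N m assume x: "x \<in> homogeneous N (3 * m)"
    show "x \<in> cvec.span (\<Union>n. fixed_layer n)"
    proof (cases "N < lowest_weight")
      case True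
      then show ?thesis using homogeneous_below[OF _ x] by (simp add: cvec.span_zero)
    next
      case False
      then have "lowest_weight + int (nat (N - lowest_weight)) = N" by simp
      then have "x \<in> fixed_layer (nat (N - lowest_weight))"
        using x unfolding fixed_layer_def by auto
      then show ?thesis by (blast intro: cvec.span_base)
    qed
  qed
  show "(\<Union>n. fixed_layer n) \<subseteq> cvec.span (\<Union>N m. homogeneous N (3 * m))"
    by (auto simp: fixed_layer_def intro!: cvec.span_base)
qed auto

end

section \<open>The twisted action of the fixed point algebra\<close>

text \<open>
If only \<open>H(1)\<close> acts nontrivially on \<open>x\<close> among the positive modes, the recurrence has a single term. This
is the case for \<open>\<one>\<close>, \<open>h\<close> and the conformal vector.
\<close>

lemma (in commuting_modes) exp_coeff_step:
  assumes "\<And>n. n \<ge> 2 \<Longrightarrow> H n x = 0" and "m \<ge> 1"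
  shows "of_nat m *\<^sub>C exp_coeff H m x = exp_coeff H (m - 1) (H 1 x)"
proof -
  have "of_nat m *\<^sub>C exp_coeff H m x = (\<Sum>n=1..m. (-1) ^ (n + 1) *\<^sub>C exp_coeff H (m - n) (H (int n) x))"
    by (simp add: exp_coeff_recurrence exp_coeff_commute)
  also have "\<dots> = (\<Sum>n\<in>{1}. (-1) ^ (n + 1) *\<^sub>C exp_coeff H (m - n) (H (int n) x))"
    using assms by (intro sum.mono_neutral_right) (auto simp: linear_on_UNIV[OF exp_coeff_linear])
  finally show ?thesis by simp
qed

locale twisted_affine = affine_automorphism k Y vac conf \<iota> \<sigma> + affine_module k Y vac conf \<iota> YW
  for k :: nat and Y :: "'v::complex_vector \<Rightarrow> int \<Rightarrow> 'v \<Rightarrow> 'v" and vac conf :: 'v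
    and \<iota> :: "mat2 \<Rightarrow> 'v" and \<sigma> :: "'v \<Rightarrow> 'v" and YW :: "'v \<Rightarrow> int \<Rightarrow> 'm::complex_vector \<Rightarrow> 'm" +
  fixes r :: nat
begin

lemma h_twist_mode: "Y (h_twist \<iota> r) n x = (of_nat r / 6) *\<^sub>C Y hh n x"
  "YW (h_twist \<iota> r) n w = (of_nat r / 6) *\<^sub>C YW hh n w"
  by (simp_all add: h_twist_def adj.V_mode_simps mode_simps)

sublocale twisting Y vac conf YW "h_twist \<iota> r"
proof
  show "Y (h_twist \<iota> r) m (Y (h_twist \<iota> r) n x) = Y (h_twist \<iota> r) n (Y (h_twist \<iota> r) m x)"
    if "m \<ge> 0" "n \<ge> 0" for m n x
  proof -
    have "m = 0" if "m + n = 0" using that \<open>m \<ge> 0\<close> \<open>n \<ge> 0\<close> by simp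
    then show ?thesis
      using affine_commutator[of mat_h mat_h m n x]
      by (auto simp: h_twist_mode adj.V_mode_simps \<iota>_brackets split: if_splits)
  qed
qed

lemma exp_coeff_homogeneous:
  assumes "x \<in> homogeneous N m"
  shows "E s x \<in> homogeneous (N - int s) m"
proof -
  have L: "Y conf 1 (E s x) = (of_int N - of_nat s) *\<^sub>C E s x"
    using assms by (intro exp.exp_coeff_lowers)
      (simp_all add: adj.linear_mode' h_twist_mode homogeneous_def adj.V_mode_simps
        ad.conformal_weight_current cvec.scale_right_diff_distrib mult.commute)
  have h: "Y hh 0 (E s x) = E s (Y hh 0 x)"
    by (rule exp.exp_coeff_intertwine)
      (simp_all add: adj.linear_mode' h_twist_mode adj.V_mode_simps ad.h_weight_current)
  have s: "\<sigma> (E s x) = E s (\<sigma> x)"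
    by (rule exp.exp_coeff_intertwine)
      (simp_all add: \<sigma>_linear h_twist_mode \<sigma>_simps \<sigma>_mode \<sigma>_h)
  show ?thesis using assms L h s by (simp add: homogeneous_def E_simps)
qed

lemma exp_coeff_homogeneous_zero:
  assumes "x \<in> homogeneous N m" "N - int s < lowest_weight"
  shows "E s x = 0"
  using homogeneous_below[OF assms(2) exp_coeff_homogeneous[OF assms(1)]] .

sublocale semisimple_twisting Y vac conf YW "h_twist \<iota> r"
proof
  fix x
  have x: "x \<in> cvec.span (\<Union>N m. homogeneous N m)" using span_homogeneous by simp
  show "finite_exp x" using x
  proof (induction rule: cvec.span_induct_alt)
    case base
    then show ?case by (simp add: finite_exp_def E_simps)
  next
    case (step c x y)
    then obtain N m where "x \<in> homogeneous N m" by blast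
    then have "E s x = 0" if "s \<ge> nat (N - lowest_weight + 1)" for s
      using that by (intro exp_coeff_homogeneous_zero) auto
    moreover obtain K where "\<forall>s\<ge>K. E s y = 0" using step unfolding finite_exp_def by blast
    ultimately have "\<forall>s\<ge>max K (nat (N - lowest_weight + 1)). E s (c *\<^sub>C x + y) = 0"
      by (simp add: E_simps)
    then show ?case unfolding finite_exp_def by blast
  qed
  show "\<exists>c. rat_decomposition (Y (h_twist \<iota> r) 0) x c" using x
  proof (induction rule: cvec.span_induct_alt)
    case base
    have "rat_decomposition (Y (h_twist \<iota> r) 0) 0 (\<lambda>_. 0)"
      by (simp add: rat_decomposition_def adj.V_mode_simps)
    then show ?case by blast
  next
    case (step c x y)
    then obtain N m where "x \<in> homogeneous N m" by blast
    then have "Y (h_twist \<iota> r) 0 x = of_rat (of_int (int r * m) / 3) *\<^sub>C x"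
      by (simp add: h_twist_mode homogeneous_def of_rat_divide of_rat_mult)
    then have "\<exists>d. rat_decomposition (Y (h_twist \<iota> r) 0) x d"
      using rat_decomposition_eigenvector[OF adj.linear_mode'] by blast
    then show ?case
      using step rat_decomposition_add[OF adj.linear_mode' rat_decomposition_scale[OF adj.linear_mode']]
      by blast
  qed
qed

lemma fixed_layer_integral: "fixed_layer n \<subseteq> integral_states"
proof
  fix x assume "x \<in> fixed_layer n"
  then obtain m where "x \<in> homogeneous (lowest_weight + int n) (3 * m)" by (auto simp: fixed_layer_def)
  then have "Y (h_twist \<iota> r) 0 x = of_int (int r * m) *\<^sub>C x" by (simp add: h_twist_mode homogeneous_def)
  then show "x \<in> integral_states" unfolding integral_states_def by blast
qed

lemma fixed_integral: "fixed \<subseteq> cvec.span integral_states"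
  unfolding span_fixed_layers using fixed_layer_integral by (intro cvec.span_mono) blast

text \<open>
The bridge between the twisted and the untwisted action of the fixed point algebra.
\<close>

theorem stable_fixed_iff: "stable_subspace fixed YT S \<longleftrightarrow> stable_subspace fixed YW S"
  unfolding span_fixed_layers
proof (rule stable_subspace_YT_iff)
  show "fixed_layer n \<subseteq> integral_states" for n by (rule fixed_layer_integral)
  fix u n and m :: nat assume "u \<in> fixed_layer n" and m: "m \<ge> 1"
  then obtain q where u: "u \<in> homogeneous (lowest_weight + int n) (3 * q)" by (auto simp: fixed_layer_def)
  show "E m u = 0 \<or> (\<exists>n'<n. E m u \<in> fixed_layer n')"
  proof (cases "m \<le> n")
    case True
    then have "E m u \<in> fixed_layer (n - m)"
      using exp_coeff_homogeneous[OF u, of m] unfolding fixed_layer_def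
      by (auto simp: of_nat_diff algebra_simps)
    then show ?thesis using True m by (metis diff_less less_le_trans zero_less_one)
  next
    case False
    then show ?thesis using exp_coeff_homogeneous_zero[OF u, of m] by simp
  qed
qed

lemma current_conf_twist: "n \<ge> 0 \<Longrightarrow> Y (h_twist \<iota> r) n conf = (if n = 1 then h_twist \<iota> r else 0)"
  by (simp add: h_twist_mode current_conf) (simp add: h_twist_def)

lemma exp_coeff_vac: "m \<ge> 1 \<Longrightarrow> E m vac = 0"
  using exp.exp_coeff_step[of vac m] by (simp add: h_twist_mode adj.V.creation E_simps)

lemma exp_coeff_h:
  "E 1 hh = (of_nat r * of_nat k / 3) *\<^sub>C vac" "m \<ge> 2 \<Longrightarrow> E m hh = 0"
proof -
  have 1: "Y (h_twist \<iota> r) 1 hh = (of_nat r * of_nat k / 3) *\<^sub>C vac"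
    by (simp add: h_twist_mode current_products chevalley_traces)
  have *: "of_nat m *\<^sub>C E m hh = E (m - 1) ((of_nat r * of_nat k / 3) *\<^sub>C vac)" if "m \<ge> 1" for m
    using exp.exp_coeff_step[of hh m] that by (simp add: 1) (simp add: h_twist_mode current_products)
  show "E 1 hh = (of_nat r * of_nat k / 3) *\<^sub>C vac" using *[of 1] by simp
  show "E m hh = 0" if "m \<ge> 2" using *[of m] exp_coeff_vac[of "m - 1"] that by (simp add: E_simps)
qed

lemma exp_coeff_conf:
  "E 1 conf = h_twist \<iota> r" "E 2 conf = (of_nat r ^ 2 * of_nat k / 36) *\<^sub>C vac" "m \<ge> 3 \<Longrightarrow> E m conf = 0"
proof -
  have *: "of_nat m *\<^sub>C E m conf = E (m - 1) ((of_nat r / 6) *\<^sub>C hh)" if "m \<ge> 1" for m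
    using exp.exp_coeff_step[of conf m] that by (simp add: current_conf_twist) (simp add: h_twist_def)
  have "E 1 conf = (of_nat r / 6) *\<^sub>C hh" using *[of 1] by simp
  also have "\<dots> = h_twist \<iota> r" by (rule h_twist_def[symmetric])
  finally show "E 1 conf = h_twist \<iota> r" .
  have "(1/2) *\<^sub>C 2 *\<^sub>C E 2 conf = (1/2) *\<^sub>C (of_nat r / 6) *\<^sub>C E 1 hh" using *[of 2] by (simp add: E_simps)
  then show "E 2 conf = (of_nat r ^ 2 * of_nat k / 36) *\<^sub>C vac"
    unfolding exp_coeff_h by (simp add: power2_eq_square)
  show "E m conf = 0" if "m \<ge> 3" using *[of m] exp_coeff_h(2)[of "m - 1"] that by (simp add: E_simps)
qed

lemma YT_vac: "YT vac n w = (if n = -1 then w else 0)"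
proof -
  have "YT vac n w = twist_mode vac 0 n w"
    by (rule YT_eigenvector) (simp add: h_twist_mode adj.V.creation)
  also have "\<dots> = (\<Sum>m<1. YW (E m vac) (n + 0 - int m) w)"
    by (rule twist_mode_eq_sum) (rule exp_coeff_vac)
  finally show ?thesis by (simp add: vacuum)
qed

lemma YT_h: "YT hh 0 w = YW hh 0 w + (of_nat r * of_nat k / 3) *\<^sub>C w"
proof -
  have "YT hh 0 w = twist_mode hh 0 0 w"
    by (rule YT_eigenvector) (simp add: h_twist_mode current_products \<iota>_brackets)
  also have "\<dots> = (\<Sum>m<2. YW (E m hh) (0 + 0 - int m) w)"
    by (rule twist_mode_eq_sum) (rule exp_coeff_h)
  finally show ?thesis
    using exp_coeff_h(1) by (simp add: numeral_2_eq_2 mode_simps vacuum)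
qed

text \<open>
The exponential contributes two corrections: \<open>E\<^sub>1\<close> maps the conformal vector to \<open>h\<^bsup>(r)\<^esup>\<close> and \<open>E\<^sub>2\<close>
maps it to a multiple of the vacuum. This is the spectral flow of \<open>L(0)\<close>.
\<close>

lemma YT_conf:
  "YT conf 1 w = YW conf 1 w + (of_nat r / 6) *\<^sub>C YW hh 0 w + (of_nat r ^ 2 * of_nat k / 36) *\<^sub>C w"
proof -
  have "YT conf 1 w = twist_mode conf 0 1 w"
    by (rule YT_eigenvector) (simp add: current_conf_twist)
  also have "\<dots> = (\<Sum>m<3. YW (E m conf) (1 + 0 - int m) w)"
    by (rule twist_mode_eq_sum) (rule exp_coeff_conf)
  also have "{..<3} = {0, 1, 2 :: nat}" by auto
  finally show ?thesis
    using exp_coeff_conf(1,2) by (simp add: mode_simps vacuum h_twist_mode(2) add.assoc)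
qed

end

section \<open>Weights of the highest weight module\<close>

locale highest_weight_module = affine_module k Y vac conf \<iota> YM + affine_sl2_module Y vac conf \<iota> YM i v
  for k :: nat and Y :: "'v::complex_vector \<Rightarrow> int \<Rightarrow> 'v \<Rightarrow> 'v" and vac conf :: 'v
    and \<iota> :: "mat2 \<Rightarrow> 'v" and YM :: "'v \<Rightarrow> int \<Rightarrow> 'm::complex_vector \<Rightarrow> 'm" and i :: nat and v :: "nat \<Rightarrow> 'm"
begin

lemma irreducibleD: "stable_subspace UNIV YM S \<Longrightarrow> S = {0} \<or> S = UNIV"
  by (rule irreducible[unfolded irreducible_module_def, THEN conjunct2, THEN conjunct2, rule_format, OF subset_UNIV])

lemma top_nonzero: "j \<le> i \<Longrightarrow> v j \<noteq> 0"
proof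
  assume "j \<le> i" "v j = 0"
  then have "0 \<in> v ` {..i}" by (metis atMost_iff imageI)
  from cvec.dependent_zero[OF this] show False using top_basis(2) by simp
qed

definition \<kappa> :: complex where "\<kappa> = (SOME c. \<forall>j\<le>i. YM conf 1 (v j) = c *\<^sub>C v j)"

lemma conf_top: "j \<le> i \<Longrightarrow> YM conf 1 (v j) = \<kappa> *\<^sub>C v j"
proof -
  obtain c where c: "eigenspace UNIV (YM conf 1) c = cvec.span (v ` {..i})"
    using lowest_weight_space by (elim exE conjE) (rule that)
  have "\<forall>j\<le>i. YM conf 1 (v j) = c *\<^sub>C v j"
  proof (intro allI impI)
    fix j assume "j \<le> i"
    then have "v j \<in> eigenspace UNIV (YM conf 1) c" unfolding c by (intro cvec.span_base) simp
    then show "YM conf 1 (v j) = c *\<^sub>C v j" by (simp add: eigenspace_def)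
  qed
  then have "\<forall>j\<le>i. YM conf 1 (v j) = \<kappa> *\<^sub>C v j" unfolding \<kappa>_def by (rule someI)
  then show "j \<le> i \<Longrightarrow> YM conf 1 (v j) = \<kappa> *\<^sub>C v j" by blast
qed

text \<open>
Words in negative modes suffice to span the module, and along such words the \<open>h(0)\<close>-weight grows at
most twice as fast as the conformal weight.
\<close>

inductive_set creation_words :: "'m set" where
  top: "j \<le> i \<Longrightarrow> v j \<in> creation_words"
| create: "w \<in> creation_words \<Longrightarrow> a \<in> {mat_h, mat_e, mat_f} \<Longrightarrow> n < 0 \<Longrightarrow> YM (\<iota> a) n w \<in> creation_words"

lemma zero_mode_top:
  assumes "a \<in> {mat_h, mat_e, mat_f}" "j \<le> i"
  shows "YM (\<iota> a) 0 (v j) \<in> cvec.span (v ` {..i})"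
proof -
  have v: "v l \<in> cvec.span (v ` {..i})" if "l \<le> i" for l using that by (intro cvec.span_base) simp
  consider "a = mat_h" | "a = mat_e" "j = 0" | "a = mat_e" "j \<ge> 1" | "a = mat_f" "j = i" | "a = mat_f" "j < i"
    using assms by fastforce
  then show ?thesis
  proof cases
    case 1
    then show ?thesis using assms v by (simp add: h_top cvec.span_scale)
  next
    case 2
    then show ?thesis by (simp add: e_top cvec.span_zero)
  next
    case 3
    then show ?thesis using assms v by (simp add: e_top cvec.span_scale)
  next
    case 4
    then show ?thesis by (simp add: f_top cvec.span_zero)
  next
    case 5
    then have "v (j + 1) \<in> cvec.span (v ` {..i})" by (intro v) simp
    then show ?thesis using 5 by (simp only: f_top cvec.span_scale)
  qed
qed

text \<open>
A nonnegative mode is moved to the right through the word. The commutator with each letter is a mode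
acting on a shorter word, and on the lowest weight space the remaining mode is known.
\<close>

lemma creation_words_stable:
  "w \<in> creation_words \<Longrightarrow> a \<in> {mat_h, mat_e, mat_f} \<Longrightarrow> YM (\<iota> a) n w \<in> cvec.span creation_words"
proof (induction arbitrary: a n rule: creation_words.induct)
  case (top j)
  have sub: "cvec.span (v ` {..i}) \<subseteq> cvec.span creation_words"
    by (intro cvec.span_mono) (auto intro: creation_words.top)
  have "n < 0 \<or> n = 0 \<or> n \<ge> 1" by linarith
  then consider "n < 0" | "n = 0" | "n \<ge> 1" by blast
  then show ?case
  proof cases
    case 1
    then show ?thesis using creation_words.intros top by (intro cvec.span_base) blast
  next
    case 2
    then show ?thesis using zero_mode_top[of a j] top sub by blast
  next
    case 3
    then show ?thesis using positive_modes[of a n j] top by (simp add: cvec.span_zero)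
  qed
next
  case (create w b m)
  let ?S = "cvec.span creation_words"
  have neg: "YM (\<iota> b) m x \<in> ?S" if "x \<in> ?S" for x
    using that
  proof (induction rule: cvec.span_induct_alt)
    case base
    then show ?case by (simp add: mode_simps cvec.span_zero)
  next
    case (step c x y)
    then show ?case using create.hyps
      by (auto simp: mode_simps intro!: cvec.span_add cvec.span_scale intro: cvec.span_base creation_words.intros)
  qed
  have sl: "a \<in> sl2" "b \<in> sl2" using create by auto
  have "w \<in> ?S" using create by (simp add: cvec.span_base)
  moreover have "YM (\<iota> b) m (YM (\<iota> a) n w) \<in> ?S" using create by (intro neg) blast
  moreover have "YM (\<iota> (lie_bracket a b)) (n + m) w \<in> ?S"
    using create.IH by (intro current_closed[OF cvec.subspace_span _ sl2_closed(3)[OF sl]]) blast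
  ultimately show ?case
    unfolding current_commutator[OF sl] by (intro cvec.span_add) (simp_all add: cvec.span_scale cvec.span_zero)
qed

lemma span_creation_words: "cvec.span creation_words = UNIV"
proof -
  have "YM (\<iota> a) n x \<in> cvec.span creation_words"
    if a: "a \<in> {mat_h, mat_e, mat_f}" and x: "x \<in> cvec.span creation_words" for a n x
    using x
  proof (induction rule: cvec.span_induct_alt)
    case base
    then show ?case by (simp add: mode_simps cvec.span_zero)
  next
    case (step c x y)
    then show ?case using creation_words_stable a
      by (auto simp: mode_simps intro!: cvec.span_add cvec.span_scale)
  qed
  then have "stable_subspace UNIV YM (cvec.span creation_words)"
    by (intro stable_if_chevalley_stable) auto
  moreover have "v 0 \<in> cvec.span creation_words" by (intro cvec.span_base creation_words.top) simp
  ultimately show ?thesis using irreducibleD top_nonzero[of 0] by blast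
qed

definition weight_space :: "nat \<Rightarrow> int \<Rightarrow> 'm set" where
  "weight_space N m = {x. YM conf 1 x = (\<kappa> + of_nat N) *\<^sub>C x \<and> YM hh 0 x = of_int m *\<^sub>C x}"

definition weights :: "(nat \<times> int) set" where
  "weights = {(N, m). \<bar>m\<bar> \<le> int i + 2 * int N \<and> even (m - int i)}"

lemma creation_words_weight: "w \<in> creation_words \<Longrightarrow> \<exists>(N, m) \<in> weights. w \<in> weight_space N m"
proof (induction rule: creation_words.induct)
  case (top j)
  then show ?case
    by (intro bexI[of _ "(0, int i - 2 * int j)"]) (auto simp: weights_def weight_space_def conf_top h_top)
next
  case (create w a n)
  then obtain N m where w: "(N, m) \<in> weights" "w \<in> weight_space N m" by blast
  have L: "YM conf 1 (YM (\<iota> a) n w) = (\<kappa> + of_nat (N + nat (- n))) *\<^sub>C YM (\<iota> a) n w"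
    using w create by (simp add: conformal_weight_current weight_space_def mode_simps
        cvec.scale_left_distrib cvec.scale_left_diff_distrib)
  obtain d where d: "YM hh 0 (YM (\<iota> a) n w) = of_int (m + d) *\<^sub>C YM (\<iota> a) n w" "d = 0 \<or> d = 2 \<or> d = -2"
  proof -
    have "YM hh 0 (YM hh n w) = of_int (m + 0) *\<^sub>C YM hh n w"
      "YM hh 0 (YM ee n w) = of_int (m + 2) *\<^sub>C YM ee n w"
      "YM hh 0 (YM ff n w) = of_int (m + (-2)) *\<^sub>C YM ff n w"
      using w(2) by (simp_all add: h_weight_current weight_space_def mode_simps cvec.scale_left_distrib
          cvec.scale_left_diff_distrib)
    then show ?thesis using that create.hyps(2) by blast
  qed
  have "(N + nat (- n), m + d) \<in> weights" using w(1) d(2) create.hyps(3) by (auto simp: weights_def)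
  then show ?case using L d(1) by (intro bexI) (auto simp: weight_space_def)
qed

lemma span_weight_spaces: "cvec.span (\<Union>(N, m)\<in>weights. weight_space N m) = UNIV"
proof -
  have "creation_words \<subseteq> (\<Union>(N, m)\<in>weights. weight_space N m)" using creation_words_weight by blast
  then show ?thesis using span_creation_words cvec.span_mono by blast
qed

end

section \<open>Decomposition by charge\<close>

locale twisted_highest_weight =
  twisted_affine k Y vac conf \<iota> \<sigma> YM r + highest_weight_module k Y vac conf \<iota> YM i v
  for k :: nat and Y :: "'v::complex_vector \<Rightarrow> int \<Rightarrow> 'v \<Rightarrow> 'v" and vac conf :: 'v
    and \<iota> :: "mat2 \<Rightarrow> 'v" and \<sigma> :: "'v \<Rightarrow> 'v" and YM :: "'v \<Rightarrow> int \<Rightarrow> 'm::complex_vector \<Rightarrow> 'm"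
    and r i :: nat and v :: "nat \<Rightarrow> 'm" +
  assumes level_pos: "k \<ge> 1" and i_le: "i \<le> k" and r_cases: "r \<in> {1, 2}"
begin

text \<open>
The class of \<open>h(0)\<close>-weights congruent to \<open>2 d - i\<close> modulo 6. It depends on \<open>d\<close> modulo 3 only, and
\<open>d = 0\<close> is the class of the vector \<open>v\<^bsup>i,i\<^esup>\<close>.
\<close>

definition charge :: "int \<Rightarrow> 'm set" where
  "charge d = cvec.span {x. \<exists>m. 6 dvd (m + int i - 2 * d) \<and> YM hh 0 x = of_int m *\<^sub>C x}"

definition other_charges :: "int \<Rightarrow> 'm set" where
  "other_charges d = cvec.span {x. \<exists>m. \<not> 6 dvd (m + int i - 2 * d) \<and> YM hh 0 x = of_int m *\<^sub>C x}"

lemma subspace_charge: "cvec.subspace (charge d)" "cvec.subspace (other_charges d)"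
  by (simp_all add: charge_def other_charges_def)

lemma chargeI: "YM hh 0 x = of_int m *\<^sub>C x \<Longrightarrow> 6 dvd (m + int i - 2 * d) \<Longrightarrow> x \<in> charge d"
  unfolding charge_def by (intro cvec.span_base) blast

lemma other_chargesI: "YM hh 0 x = of_int m *\<^sub>C x \<Longrightarrow> \<not> 6 dvd (m + int i - 2 * d) \<Longrightarrow> x \<in> other_charges d"
  unfolding other_charges_def by (intro cvec.span_base) blast

lemma charge_disjoint:
  assumes "x \<in> charge d" "x \<in> other_charges d"
  shows "x = 0"
proof (rule eigenvector_spans_disjoint[OF linear_mode'[of hh 0] _ _ _ assms[unfolded charge_def other_charges_def]])
  show "\<forall>y\<in>{x. \<exists>m. 6 dvd (m + int i - 2 * d) \<and> YM hh 0 x = of_int m *\<^sub>C x}.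
      \<exists>a\<in>of_int ` {m. 6 dvd (m + int i - 2 * d)}. YM hh 0 y = a *\<^sub>C y" by blast
  show "\<forall>y\<in>{x. \<exists>m. \<not> 6 dvd (m + int i - 2 * d) \<and> YM hh 0 x = of_int m *\<^sub>C x}.
      \<exists>a\<in>of_int ` {m. \<not> 6 dvd (m + int i - 2 * d)}. YM hh 0 y = a *\<^sub>C y" by blast
qed auto

lemma charge_subset_other:
  assumes "\<not> 3 dvd (d - d')"
  shows "charge d' \<subseteq> other_charges d"
proof -
  have "\<not> 6 dvd (m + int i - 2 * d)" if "6 dvd (m + int i - 2 * d')" for m
    using that assms by presburger
  then show ?thesis unfolding charge_def other_charges_def by (intro cvec.span_mono) blast
qed

lemma weight_space_charge:
  assumes "x \<in> weight_space N m"
  shows "6 dvd (m + int i - 2 * d) \<Longrightarrow> x \<in> charge d" "\<not> 6 dvd (m + int i - 2 * d) \<Longrightarrow> x \<in> other_charges d"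
  using assms by (auto simp: weight_space_def intro: chargeI other_chargesI)

text \<open>
The components of a vector in weight spaces of the other classes add up to a vector whose weights are
both in the class and outside it. This refines the \<open>h(0)\<close>-eigenvectors in the definition of the class to
joint eigenvectors of \<open>h(0)\<close> and \<open>L(0)\<close>.
\<close>

lemma charge_weight_spaces:
  "charge d = cvec.span (\<Union>(N, m)\<in>{(N, m) \<in> weights. 6 dvd (m + int i - 2 * d)}. weight_space N m)"
    (is "_ = cvec.span ?A")
proof
  let ?B = "\<Union>(N, m)\<in>{(N, m) \<in> weights. \<not> 6 dvd (m + int i - 2 * d)}. weight_space N m"
  have A: "cvec.span ?A \<subseteq> charge d"
    by (rule cvec.span_minimal[OF _ subspace_charge(1)]) (auto intro: weight_space_charge)
  then show "cvec.span ?A \<subseteq> charge d" .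
  have B: "cvec.span ?B \<subseteq> other_charges d"
    by (rule cvec.span_minimal[OF _ subspace_charge(2)]) (auto intro: weight_space_charge)
  show "charge d \<subseteq> cvec.span ?A"
  proof
    fix y assume y: "y \<in> charge d"
    have "(\<Union>(N, m)\<in>weights. weight_space N m) = ?A \<union> ?B" by auto
    then have "y \<in> cvec.span (?A \<union> ?B)" using span_weight_spaces by simp
    then obtain a b where ab: "y = a + b" "a \<in> cvec.span ?A" "b \<in> cvec.span ?B"
      unfolding cvec.span_Un by blast
    then have "y - a \<in> charge d" using y A by (intro cvec.subspace_diff[OF subspace_charge(1)]) auto
    moreover have "y - a \<in> other_charges d" using ab B by auto
    ultimately have "y - a = 0" by (rule charge_disjoint)
    then show "y \<in> cvec.span ?A" using ab by simp
  qed
qed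

lemma homogeneous_mode_charge:
  assumes u: "u \<in> homogeneous N m" and w: "w \<in> charge d"
  shows "3 dvd m \<Longrightarrow> YM u n w \<in> charge d" and "\<not> 3 dvd m \<Longrightarrow> YM u n w \<in> other_charges d"
proof -
  have h: "YM hh 0 (YM u n x) = of_int (l + 2 * m) *\<^sub>C YM u n x" if "YM hh 0 x = of_int l *\<^sub>C x" for x l
    using commutator_nonneg[of hh 0 u n x] u that
    by (simp add: homogeneous_def mode_simps cvec.scale_left_distrib)
  have "(3 dvd m \<longrightarrow> YM u n w \<in> charge d) \<and> (\<not> 3 dvd m \<longrightarrow> YM u n w \<in> other_charges d)"
    using w unfolding charge_def[of d]
  proof (induction rule: cvec.span_induct_alt)
    case base
    then show ?case by (simp add: mode_simps cvec.subspace_0 subspace_charge cvec.span_zero)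
  next
    case (step c x y)
    then obtain l where l: "6 dvd (l + int i - 2 * d)" "YM hh 0 x = of_int l *\<^sub>C x" by blast
    have "3 dvd m \<Longrightarrow> 6 dvd (l + 2 * m + int i - 2 * d)" "\<not> 3 dvd m \<Longrightarrow> \<not> 6 dvd (l + 2 * m + int i - 2 * d)"
      using l(1) by presburger+
    then have "3 dvd m \<Longrightarrow> YM u n x \<in> charge d" "\<not> 3 dvd m \<Longrightarrow> YM u n x \<in> other_charges d"
      using h[OF l(2)] chargeI other_chargesI by blast+
    then show ?case using step(2) unfolding charge_def[of d, symmetric]
      by (simp add: mode_simps cvec.subspace_add cvec.subspace_scale subspace_charge)
  qed
  then show "3 dvd m \<Longrightarrow> YM u n w \<in> charge d" and "\<not> 3 dvd m \<Longrightarrow> YM u n w \<in> other_charges d" by blast+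
qed

lemma charge_stable: "stable_subspace fixed YM (charge d)"
  unfolding span_fixed_homogeneous
  by (intro stable_subspace_span linear_state' subspace_charge) (auto intro: homogeneous_mode_charge)

text \<open>
The vectors \<open>u(n) w\<close> span the whole module. If \<open>u\<close> is homogeneous, \<open>u(n) w\<close> lies in \<open>S\<close> when \<open>u\<close> is
fixed by \<open>\<sigma>\<close> and in another class otherwise. So the module is \<open>S\<close> plus the other classes, and a vector
in the class of \<open>w\<close> has no component in the latter.
\<close>

lemma charge_irreducible:
  assumes S: "S \<subseteq> charge d" "stable_subspace fixed YM S" and ne: "S \<noteq> {0}"
  shows "S = charge d"
proof
  show "S \<subseteq> charge d" by fact
  have sub: "cvec.subspace S" using S by (simp add: stable_subspace_def)
  obtain w where w: "w \<in> S" "w \<noteq> 0" using ne cvec.subspace_0[OF sub] by blast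
  let ?D = "cvec.span (S \<union> other_charges d)"
  have D: "YM u n w \<in> ?D" for u n
  proof -
    have "u \<in> cvec.span (\<Union>N m. homogeneous N m)" using span_homogeneous by simp
    then show ?thesis
    proof (induction rule: cvec.span_induct_alt)
      case base
      then show ?case by (simp add: mode_simps cvec.span_zero)
    next
      case (step c x y)
      then obtain N m where x: "x \<in> homogeneous N m" by blast
      have "YM x n w \<in> S \<union> other_charges d"
      proof (cases "3 dvd m")
        case True
        then obtain q where "m = 3 * q" by blast
        then have "x \<in> fixed" unfolding span_fixed_homogeneous using x by (auto intro!: cvec.span_base)
        then show ?thesis using S(2) w(1) by (auto simp: stable_subspace_def)
      next
        case False
        then show ?thesis using homogeneous_mode_charge(2)[OF x] w S(1) by blast
      qed
      then have "YM x n w \<in> ?D" by (rule cvec.span_base)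
      then show ?case using step(2) by (simp add: mode_simps cvec.span_add cvec.span_scale)
    qed
  qed
  have "cvec.span {YM u n w | u n. True} = UNIV"
    using irreducibleD w(2) by (intro span_modes_eq_UNIV) blast+
  moreover have "cvec.span {YM u n w | u n. True} \<subseteq> ?D"
    using D by (intro cvec.span_minimal) auto
  ultimately have "?D = UNIV" by blast
  show "charge d \<subseteq> S"
  proof
    fix y assume y: "y \<in> charge d"
    have "y \<in> ?D" using \<open>?D = UNIV\<close> by blast
    then obtain a b where ab: "y = a + b" "a \<in> cvec.span S" "b \<in> cvec.span (other_charges d)"
      unfolding cvec.span_Un by blast
    have a: "a \<in> S" using ab(2) sub by (simp add: cvec.span_eq_iff[THEN iffD2])
    have "b \<in> other_charges d" using ab(3) subspace_charge(2) by (simp add: cvec.span_eq_iff[THEN iffD2])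
    moreover have "b = y - a" using ab(1) by simp
    moreover have "y - a \<in> charge d" using y a S(1) by (intro cvec.subspace_diff subspace_charge) auto
    ultimately have "b = 0" using charge_disjoint by blast
    then show "y \<in> S" using ab(1) a by simp
  qed
qed

definition conformal_shift :: complex where "conformal_shift = \<kappa> + of_nat r ^ 2 * of_nat k / 36"

lemma YT_conf_weight:
  "x \<in> weight_space N m \<Longrightarrow> YT conf 1 x = (conformal_shift + of_real (real N + real r * of_int m / 6)) *\<^sub>C x"
  by (simp add: YT_conf weight_space_def conformal_shift_def cvec.scale_left_distrib add_ac)

lemma YT_conf_eigenspace:
  assumes y: "YT conf 1 y = c *\<^sub>C y"
  shows "y \<in> cvec.span (\<Union>(N, m)\<in>{(N, m) \<in> weights. c = conformal_shift + of_real (real N + real r * of_int m / 6)}.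
    weight_space N m)" (is "_ \<in> cvec.span ?A")
proof -
  let ?X = "\<Union>(N, m)\<in>weights. weight_space N m"
  have "\<forall>x\<in>?X. \<exists>a. YT conf 1 x = a *\<^sub>C x" using YT_conf_weight by blast
  then have "y \<in> cvec.span {x \<in> ?X. YT conf 1 x = c *\<^sub>C x}"
    using y by (intro eigenspace_subset_span YT_linear_mode span_weight_spaces)
  moreover have "{x \<in> ?X. YT conf 1 x = c *\<^sub>C x} \<subseteq> cvec.span ?A"
  proof clarify
    fix x N m assume x: "(N, m) \<in> weights" "x \<in> weight_space N m" "YT conf 1 x = c *\<^sub>C x"
    then have "x = 0 \<or> c = conformal_shift + of_real (real N + real r * of_int m / 6)"
      using YT_conf_weight[OF x(2)] by (metis cvec.scale_right_imp_eq)
    then show "x \<in> cvec.span ?A"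
    proof
      assume "c = conformal_shift + of_real (real N + real r * of_int m / 6)"
      then show ?thesis using x by (intro cvec.span_base) blast
    qed (simp add: cvec.span_zero)
  qed
  ultimately show ?thesis using cvec.span_minimal[OF _ cvec.subspace_span] by blast
qed

text \<open>
The extreme case is \<open>r = 2\<close> with \<open>m = - i - 2 N\<close>, where the twisted energy is \<open>(N - i)/3\<close>.
\<close>

lemma twisted_weight_bound:
  assumes "(N, m) \<in> weights"
  shows "real N \<le> 3 * (real N + real r * of_int m / 6) + real i"
proof -
  have m: "- (real i + 2 * real N) \<le> of_int m"
  proof -
    have "- (int i + 2 * int N) \<le> m" using assms by (auto simp: weights_def)
    then have "of_int (- (int i + 2 * int N)) \<le> (of_int m :: real)" by (rule of_int_le_iff[THEN iffD2])
    then show ?thesis by simp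
  qed
  have "r = 1 \<or> r = 2" using r_cases by auto
  then show ?thesis using m by auto
qed

lemma YT_conf_finite_dim: "finite_dim (eigenspace W (YT conf 1) c)"
proof -
  \<comment> \<open>only finitely many levels \<open>N\<close> can contribute to a given twisted energy\<close>
  define B where "B = nat \<lceil>3 * Re (c - conformal_shift) + real i\<rceil>"
  have "\<forall>N. \<exists>F. finite F \<and> eigenspace UNIV (YM conf 1) (\<kappa> + of_nat N) \<subseteq> cvec.span F"
    using weight_finite_dim unfolding finite_dim_def by blast
  then obtain F where F: "\<And>N. finite (F N)" "\<And>N. eigenspace UNIV (YM conf 1) (\<kappa> + of_nat N) \<subseteq> cvec.span (F N)"
    by metis
  let ?F = "\<Union>N\<le>B. F N"
  have "eigenspace W (YT conf 1) c \<subseteq> cvec.span ?F"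
  proof
    fix y assume "y \<in> eigenspace W (YT conf 1) c"
    then have "y \<in> cvec.span (\<Union>(N, m)\<in>{(N, m) \<in> weights. c = conformal_shift + of_real (real N + real r * of_int m / 6)}.
        weight_space N m)" (is "_ \<in> cvec.span ?A") by (intro YT_conf_eigenspace) (simp add: eigenspace_def)
    moreover have "?A \<subseteq> cvec.span ?F"
    proof clarify
      fix x N m assume x: "(N, m) \<in> weights" "x \<in> weight_space N m"
        "c = conformal_shift + of_real (real N + real r * of_int m / 6)"
      have "real N \<le> 3 * Re (c - conformal_shift) + real i" using twisted_weight_bound[OF x(1)] by (simp add: x(3))
      then have "N \<le> B" unfolding B_def by linarith
      moreover have "x \<in> cvec.span (F N)"
        using F(2)[of N] x(2) by (auto simp: weight_space_def eigenspace_def)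
      ultimately show "x \<in> cvec.span ?F" using cvec.span_mono[of "F N" ?F] by blast
    qed
    ultimately show "y \<in> cvec.span ?F" using cvec.span_minimal[OF _ cvec.subspace_span] by blast
  qed
  then show ?thesis unfolding finite_dim_def using F(1) by (intro exI[of _ ?F]) auto
qed

lemma YT_conf_bounded:
  assumes W: "0 \<in> W"
  shows "\<exists>N::int. \<forall>n<N. eigenspace W (YT conf 1) (c + of_int n) = {0}"
proof (intro exI allI impI)
  fix n assume n: "n < \<lceil>Re (conformal_shift - c) - real i / 3\<rceil>"
  \<comment> \<open>all twisted energies have real part at least \<open>Re conformal_shift - i/3\<close>\<close>
  have "y = 0" if y: "YT conf 1 y = (c + of_int n) *\<^sub>C y" for y
  proof -
    have no_weight: "{(N, m) \<in> weights. c + of_int n = conformal_shift + of_real (real N + real r * of_int m / 6)} = {}"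
    proof (rule ccontr)
      assume "\<not> ?thesis"
      then obtain N m where *: "(N, m) \<in> weights" "c + of_int n = conformal_shift + of_real (real N + real r * of_int m / 6)"
        by blast
      define s where "s = real N + real r * of_int m / 6"
      have "Re c + of_int n = Re conformal_shift + s"
        using arg_cong[OF *(2), of Re] by (simp add: s_def)
      moreover have "0 \<le> 3 * s + real i"
        using twisted_weight_bound[OF *(1)] unfolding s_def[symmetric] by linarith
      ultimately have "Re (conformal_shift - c) - real i / 3 \<le> of_int n" by simp
      then show False using n by (simp add: less_ceiling_iff)
    qed
    then show "y = 0" using YT_conf_eigenspace[OF y] unfolding no_weight by simp
  qed
  then show "eigenspace W (YT conf 1) (c + of_int n) = {0}"
    using W by (auto simp: eigenspace_def YT_simps)
qed

lemma charge_voa_module: "voa_module fixed Y vac conf (charge d) YT"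
proof (intro voa_module.intro vertex_operators.intro voa_module_axioms.intro)
  have st: "stable_subspace fixed YT (charge d)" using charge_stable stable_fixed_iff by blast
  show "cvec.subspace fixed" "cvec.subspace (charge d)" by (rule subspace_fixed subspace_charge)+
  show "YT u n w \<in> charge d" if "u \<in> fixed" "w \<in> charge d" for u n w
    using st that unfolding stable_subspace_def by blast
  show "linear_on fixed (\<lambda>u. YT u n w)" for n w by (simp add: linear_on_def YT_simps)
  show "linear_on (charge d) (YT u n)" for u n by (simp add: linear_on_def YT_simps)
  show "\<exists>N. \<forall>n\<ge>N. YT u n w = 0" if "u \<in> fixed" for u w
    using that fixed_integral by (intro YT_truncation) blast
  show "vertex_operator_algebra fixed Y vac conf" by (rule fixed_vertex_operator_algebra)
  show "YT vac n w = (if n = -1 then w else 0)" for n w by (rule YT_vac)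
  show "borcherds_identity fixed Y (charge d) YT" by (rule YT_jacobi[OF fixed_integral])
  show "charge d \<subseteq> cvec.span (\<Union>c. eigenspace (charge d) (YT conf 1) c)"
  proof -
    have "x \<in> (\<Union>c. eigenspace (charge d) (YT conf 1) c)"
      if "6 dvd (m + int i - 2 * d)" "x \<in> weight_space N m" for N m x
      using YT_conf_weight[OF that(2)] weight_space_charge(1)[OF that(2,1)] by (auto simp: eigenspace_def)
    then have "(\<Union>(N, m)\<in>{(N, m) \<in> weights. 6 dvd (m + int i - 2 * d)}. weight_space N m)
        \<subseteq> (\<Union>c. eigenspace (charge d) (YT conf 1) c)" by blast
    from cvec.span_mono[OF this] show ?thesis by (simp only: charge_weight_spaces[symmetric])
  qed
  show "finite_dim (eigenspace (charge d) (YT conf 1) c)" for c by (rule YT_conf_finite_dim)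
  show "\<exists>N::int. \<forall>n<N. eigenspace (charge d) (YT conf 1) (c + of_int n) = {0}" for c
    by (intro YT_conf_bounded cvec.subspace_0 subspace_charge)
qed

theorem charge_irreducible_module:
  assumes "charge d \<noteq> {0}"
  shows "irreducible_module fixed Y vac conf (charge d) YT"
  unfolding irreducible_module_def
  using assms charge_voa_module charge_irreducible stable_fixed_iff by blast

theorem generated_submodule_charge:
  assumes g: "g \<in> charge d" "g \<noteq> 0"
  shows "generated_submodule fixed YT g = charge d"
proof (rule charge_irreducible)
  have st: "stable_subspace fixed YT (charge d)" using charge_stable stable_fixed_iff by blast
  show "generated_submodule fixed YT g \<subseteq> charge d"
    unfolding generated_submodule_def using g st by (intro hull_minimal) auto
  have "stable_subspace fixed YT (generated_submodule fixed YT g)"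
    unfolding generated_submodule_def
    by (rule hull_in) (auto simp: stable_subspace_def intro: cvec.subspace_Inter)
  then show "stable_subspace fixed YM (generated_submodule fixed YT g)" using stable_fixed_iff by blast
  have "g \<in> generated_submodule fixed YT g" unfolding generated_submodule_def by (rule hull_inc) simp
  then show "generated_submodule fixed YT g \<noteq> {0}" using g by auto
qed

text \<open>
An equivalence commutes with the twisted zero mode of \<open>h\<close>, which is \<open>h(0)\<close> shifted by the same constant
on both sides. It would map an \<open>h(0)\<close>-eigenvector to an eigenvector of the same weight in the other class.
\<close>

theorem charges_inequivalent:
  assumes d: "\<not> 3 dvd (d - d')" and ne: "charge d \<noteq> {0}"
  shows "\<not> equivalent_modules fixed (charge d) YT (charge d') YT"
proof
  assume "equivalent_modules fixed (charge d) YT (charge d') YT"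
  then obtain \<phi> where \<phi>: "linear_on (charge d) \<phi>" "bij_betw \<phi> (charge d) (charge d')"
    "\<And>u n w. u \<in> fixed \<Longrightarrow> w \<in> charge d \<Longrightarrow> \<phi> (YT u n w) = YT u n (\<phi> w)"
    unfolding equivalent_modules_def by blast
  let ?X = "{x. \<exists>m. 6 dvd (m + int i - 2 * d) \<and> YM hh 0 x = of_int m *\<^sub>C x}"
  have "\<not> ?X \<subseteq> {0}"
    using ne cvec.span_mono[of ?X "{0}"] cvec.subspace_0[OF subspace_charge(1)[of d]]
    unfolding charge_def by auto
  then obtain x m where x: "x \<noteq> 0" "6 dvd (m + int i - 2 * d)" "YM hh 0 x = of_int m *\<^sub>C x" by blast
  have xd: "x \<in> charge d" using chargeI[OF x(3,2)] .
  let ?c = "of_int m + of_nat r * of_nat k / 3"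
  have "YT hh 0 x = ?c *\<^sub>C x" by (simp add: YT_h x(3) cvec.scale_left_distrib)
  moreover have "hh \<in> fixed" by (simp add: fixed_iff \<sigma>_h)
  ultimately have "YT hh 0 (\<phi> x) = ?c *\<^sub>C \<phi> x"
    using \<phi>(1) \<phi>(3)[of hh x 0] xd by (simp add: linear_on_def)
  then have "YM hh 0 (\<phi> x) = of_int m *\<^sub>C \<phi> x" by (simp add: YT_h cvec.scale_left_distrib)
  then have "\<phi> x \<in> charge d" using x(2) by (rule chargeI)
  moreover have "\<phi> x \<in> charge d'" using \<phi>(2) xd by (rule bij_betwE[rule_format])
  ultimately have "\<phi> x = 0" using charge_disjoint charge_subset_other[OF d] by blast
  moreover have "\<phi> 0 = 0"
  proof -
    have "\<phi> (0 *\<^sub>C x) = 0 *\<^sub>C \<phi> x" using \<phi>(1) xd unfolding linear_on_def by blast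
    then show ?thesis by simp
  qed
  ultimately have "x = 0"
    using \<phi>(2) xd cvec.subspace_0[OF subspace_charge(1)[of d]]
    unfolding bij_betw_def inj_on_def by metis
  then show False using x by simp
qed

text \<open>
Modulo 6, the generator of index \<open>j\<close> has \<open>h(0)\<close>-weight \<open>2 j - i\<close> for \<open>r = 1\<close> and \<open>- 2 j - i\<close> for
\<open>r = 2\<close>.
\<close>

definition charge_of :: "nat \<Rightarrow> int" where
  "charge_of j = (if r = 1 then int j else - int j)"

lemma charge_of_distinct:
  "j \<in> {0, 1, 2} \<Longrightarrow> j' \<in> {0, 1, 2} \<Longrightarrow> j \<noteq> j' \<Longrightarrow> \<not> 3 dvd (charge_of j - charge_of j')"
  by (auto simp: charge_of_def)

theorem charge_direct_sum: "direct_sum (UNIV :: 'm set) {0, 1, 2} (\<lambda>j. charge (charge_of j))"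
  unfolding direct_sum_def
proof (intro conjI ballI)
  let ?C = "\<lambda>j. charge (charge_of j)" and ?J = "{0, 1, 2} :: nat set"
  show "cvec.subspace (?C j)" "?C j \<subseteq> UNIV" for j by (simp_all add: subspace_charge)
  fix y :: 'm
  have ex: "\<exists>a b c. a \<in> ?C 0 \<and> b \<in> ?C 1 \<and> c \<in> ?C 2 \<and> y = a + b + c"
  proof -
    have "y \<in> cvec.span (\<Union>(N, m)\<in>weights. weight_space N m)" using span_weight_spaces by simp
    then show ?thesis
    proof (induction rule: cvec.span_induct_alt)
      case base
      then show ?case using subspace_charge
        by (intro exI[of _ 0]) (simp add: cvec.subspace_0)
    next
      case (step s x y)
      then obtain N m a b c where x: "x \<in> weight_space N m" "(N, m) \<in> weights"
        and abc: "a \<in> ?C 0" "b \<in> ?C 1" "c \<in> ?C 2" "y = a + b + c" by blast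
      have "even (m - int i)" using x by (simp add: weights_def)
      then have "6 dvd (m + int i - 2 * charge_of 0) \<or> 6 dvd (m + int i - 2 * charge_of 1)
          \<or> 6 dvd (m + int i - 2 * charge_of 2)"
        unfolding charge_of_def by (cases "r = 1"; simp; presburger)
      then consider "x \<in> ?C 0" | "x \<in> ?C 1" | "x \<in> ?C 2" using weight_space_charge(1)[OF x(1)] by blast
      then show ?case
      proof cases
        case 1
        then have "s *\<^sub>C x + a \<in> ?C 0" using abc by (intro cvec.subspace_add cvec.subspace_scale subspace_charge)
        then show ?thesis using abc by (intro exI[of _ "s *\<^sub>C x + a"] exI[of _ b] exI[of _ c]) (simp add: add_ac)
      next
        case 2
        then have "s *\<^sub>C x + b \<in> ?C 1" using abc by (intro cvec.subspace_add cvec.subspace_scale subspace_charge)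
        then show ?thesis using abc by (intro exI[of _ a] exI[of _ "s *\<^sub>C x + b"] exI[of _ c]) (simp add: add_ac)
      next
        case 3
        then have "s *\<^sub>C x + c \<in> ?C 2" using abc by (intro cvec.subspace_add cvec.subspace_scale subspace_charge)
        then show ?thesis using abc by (intro exI[of _ a] exI[of _ b] exI[of _ "s *\<^sub>C x + c"]) (simp add: add_ac)
      qed
    qed
  qed
  show "\<exists>!c. c \<in> (\<Pi>\<^sub>E j\<in>?J. ?C j) \<and> y = (\<Sum>j\<in>?J. c j)"
  proof (rule ex_ex1I)
    obtain a b c where abc: "a \<in> ?C 0" "b \<in> ?C 1" "c \<in> ?C 2" "y = a + b + c" using ex by blast
    define f where "f = (\<lambda>j::nat. if j = 0 then a else if j = 1 then b else if j = 2 then c else undefined)"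
    have "f \<in> (\<Pi>\<^sub>E j\<in>?J. ?C j)" using abc by (auto simp: f_def PiE_iff extensional_def)
    moreover have "y = (\<Sum>j\<in>?J. f j)" using abc by (simp add: f_def add.assoc)
    ultimately show "\<exists>c. c \<in> (\<Pi>\<^sub>E j\<in>?J. ?C j) \<and> y = (\<Sum>j\<in>?J. c j)" by blast
  next
    fix f g assume f: "f \<in> (\<Pi>\<^sub>E j\<in>?J. ?C j) \<and> y = (\<Sum>j\<in>?J. f j)"
      and g: "g \<in> (\<Pi>\<^sub>E j\<in>?J. ?C j) \<and> y = (\<Sum>j\<in>?J. g j)"
    define e where "e j = f j - g j" for j
    have e: "e j \<in> ?C j" if "j \<in> ?J" for j
      unfolding e_def using f g that by (intro cvec.subspace_diff subspace_charge) (auto simp: PiE_iff)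
    have sum: "(\<Sum>j\<in>?J. e j) = 0" using f g by (simp only: e_def sum_subtractf) simp
    have "e j = 0" if j: "j \<in> ?J" for j
    proof -
      have "(\<Sum>l\<in>?J - {j}. e l) \<in> other_charges (charge_of j)"
      proof (intro cvec.subspace_sum subspace_charge)
        fix l assume "l \<in> ?J - {j}"
        then have l: "l \<in> ?J" "j \<noteq> l" by auto
        have "?C l \<subseteq> other_charges (charge_of j)"
          by (rule charge_subset_other[OF charge_of_distinct[OF j l]])
        then show "e l \<in> other_charges (charge_of j)" using e[OF l(1)] by (rule subsetD)
      qed
      moreover have "e j = - (\<Sum>l\<in>?J - {j}. e l)"
      proof -
        have "(\<Sum>l\<in>?J. e l) = e j + (\<Sum>l\<in>?J - {j}. e l)" by (rule sum.remove[OF _ j]) simp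
        then have "e j + (\<Sum>l\<in>?J - {j}. e l) = 0" using sum by (rule trans[OF sym])
        then show ?thesis by (rule eq_neg_iff_add_eq_0[THEN iffD2])
      qed
      ultimately have "e j \<in> other_charges (charge_of j)"
        by (simp add: cvec.subspace_neg subspace_charge)
      then show ?thesis using e[OF j] charge_disjoint by blast
    qed
    then show "f = g" using f g by (intro PiE_ext[of f ?J ?C g]) (auto simp: e_def)
  qed
qed

lemma h_weight_shift:
  assumes "YM hh 0 w = of_int m *\<^sub>C w"
  shows "YM hh 0 (YM ee n w) = of_int (m + 2) *\<^sub>C YM ee n w" "YM hh 0 (YM ff n w) = of_int (m - 2) *\<^sub>C YM ff n w"
  using assms by (simp_all add: h_weight_current mode_simps cvec.scale_left_distrib cvec.scale_left_diff_distrib)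

lemma raise_lower:
  "n > 0 \<Longrightarrow> YM ee n (YM ff (- n) w) = YM ff (- n) (YM ee n w) + YM hh 0 w + (of_int n * of_nat k) *\<^sub>C w"
  "n > 0 \<Longrightarrow> YM ff n (YM ee (- n) w) = YM ee (- n) (YM ff n w) - YM hh 0 w + (of_int n * of_nat k) *\<^sub>C w"
  using current_commutator[of mat_e mat_f n "- n" w] current_commutator[of mat_f mat_e n "- n" w]
  by (simp_all add: \<iota>_brackets chevalley_traces mode_simps)

lemma nonzero_if_image: "YM u n w = c *\<^sub>C x \<Longrightarrow> c \<noteq> 0 \<Longrightarrow> x \<noteq> 0 \<Longrightarrow> w \<noteq> 0"
  by (auto simp: mode_simps)

text \<open>
By the commutation relations \<open>e(n) f(-n) v\<^bsup>i,i\<^esup> = (n k - i) v\<^bsup>i,i\<^esup>\<close>, which vanishes exactly for \<open>n = 1\<close>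
and \<open>i = k\<close>. This is why the generators use \<open>f(-2)\<close> in that case.
\<close>

lemma lower_bottom_nonzero:
  "n > 0 \<Longrightarrow> int i < n * int k \<Longrightarrow> YM ff (- n) (v i) \<noteq> 0"
proof -
  assume n: "n > 0" "int i < n * int k"
  have "YM ee n (YM ff (- n) (v i)) = of_int (n * int k - int i) *\<^sub>C v i"
    using n by (simp add: raise_lower positive_modes mode_simps h_top cvec.scale_left_diff_distrib)
  then show ?thesis
    by (rule nonzero_if_image) (use n in \<open>simp_all add: top_nonzero del: of_int_diff\<close>)
qed

lemma raise_vacuum_nonzero: "i = 0 \<Longrightarrow> YM ee (- 1) (v 0) \<noteq> 0"
proof -
  assume i: "i = 0"
  have "YM ff 1 (YM ee (- 1) (v 0)) = of_nat k *\<^sub>C v 0"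
    using raise_lower(2)[of 1 "v 0"] i by (simp add: positive_modes mode_simps h_top)
  then show ?thesis by (rule nonzero_if_image) (use level_pos in \<open>simp_all add: top_nonzero\<close>)
qed

text \<open>
Here \<open>e(1)\<close> gives \<open>2 (k - 1) f(-1) v\<^bsup>0,0\<^esup>\<close>; for \<open>k = 1\<close> the vector is a null vector.
\<close>

lemma lower_vacuum_twice_nonzero: "i = 0 \<Longrightarrow> k > 1 \<Longrightarrow> YM ff (- 1) (YM ff (- 1) (v 0)) \<noteq> 0"
proof -
  assume i: "i = 0" and k: "k > 1"
  let ?w = "YM ff (- 1) (v 0)"
  have e: "YM ee 1 ?w = of_nat k *\<^sub>C v 0"
    using raise_lower(1)[of 1 "v 0"] i by (simp add: positive_modes mode_simps h_top)
  have h: "YM hh 0 ?w = of_int (-2) *\<^sub>C ?w"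
    using h_weight_shift(2)[of "v 0" 0 "-1"] h_top[of 0] i by simp
  have "YM ee 1 (YM ff (- 1) ?w) = of_int (2 * int k - 2) *\<^sub>C ?w"
    using raise_lower(1)[of 1 ?w]
    by (simp add: e h mode_simps cvec.scale_left_distrib[symmetric] cvec.scale_left_diff_distrib[symmetric]
        del: cvec.scale_minus_left)
  moreover have "?w \<noteq> 0" using lower_bottom_nonzero[of 1] i k by simp
  ultimately show ?thesis by (elim nonzero_if_image) (use k in \<open>simp_all del: of_int_diff\<close>)
qed

lemma twisted_generator_charge:
  assumes j: "j \<in> {0, 1, 2}"
  defines "g \<equiv> twisted_generator k i r j (YM ee) (YM ff) v"
  shows "g \<in> charge (charge_of j)" "g \<noteq> 0"
proof -
  have w0: "YM hh 0 (v i) = of_int (- int i) *\<^sub>C v i" using h_top[of i] by simp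
  have w1: "YM hh 0 (v (i - 1)) = of_int (2 - int i) *\<^sub>C v (i - 1)" if "i \<ge> 1"
    using h_top[of "i - 1"] that by (simp add: of_nat_diff algebra_simps)
  have w2: "YM hh 0 (v (i - 2)) = of_int (4 - int i) *\<^sub>C v (i - 2)" if "i \<ge> 2"
    using h_top[of "i - 2"] that by (simp add: of_nat_diff algebra_simps)
  have lower: "YM hh 0 (YM ff n (v i)) = of_int (- int i - 2) *\<^sub>C YM ff n (v i)" for n
    using h_weight_shift(2)[OF w0] .
  define c where "c = charge_of j"
  have c: "c = (if r = 1 then int j else - int j)" by (simp add: c_def charge_of_def)
  have "\<exists>m. YM hh 0 g = of_int m *\<^sub>C g \<and> 6 dvd (m + int i - 2 * c) \<and> g \<noteq> 0"
  proof -
    consider "r = 1" "j = 0" | "r = 1" "j = 1" "i = 0" | "r = 1" "j = 1" "i \<ge> 1"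
      | "r = 1" "j = 2" "i = 0" | "r = 1" "j = 2" "i = 1" "k = 1" | "r = 1" "j = 2" "i = 1" "k > 1"
      | "r = 1" "j = 2" "i \<ge> 2"
      | "r = 2" "j = 0" | "r = 2" "j = 1" "i < k" | "r = 2" "j = 1" "i = k"
      | "r = 2" "j = 2" "i = 0" "k = 1" | "r = 2" "j = 2" "i = 0" "k > 1" | "r = 2" "j = 2" "i \<ge> 1"
    proof -
      have r: "r = 1 \<or> r = 2" and j': "j = 0 \<or> j = 1 \<or> j = 2" and i: "i = 0 \<or> i = 1 \<or> i \<ge> 2"
        and k: "k = 1 \<or> k > 1" and ik: "i < k \<or> i = k"
        using r_cases j level_pos i_le by auto
      show ?thesis
      proof (cases "r = 1")
        case True
        then show ?thesis using that(1-7) j' i k by fastforce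
      next
        case False
        then show ?thesis using that(8-13) r j' i k ik by fastforce
      qed
    qed
    then show ?thesis
    proof cases
      case 1
      then show ?thesis using w0 top_nonzero[of i]
        by (intro exI[of _ "- int i"]) (simp add: g_def twisted_generator_def c)
    next
      case 2
      then show ?thesis using h_weight_shift(1)[OF w0, of "-1"] raise_vacuum_nonzero
        by (intro exI[of _ 2]) (simp add: g_def twisted_generator_def c)
    next
      case 3
      then show ?thesis using w1 top_nonzero[of "i - 1"]
        by (intro exI[of _ "2 - int i"]) (simp add: g_def twisted_generator_def c)
    next
      case 4
      then show ?thesis using lower[of "-1"] lower_bottom_nonzero[of 1] level_pos
        by (intro exI[of _ "-2"]) (simp add: g_def twisted_generator_def c)
    next
      case 5
      then show ?thesis using lower[of "-2"] lower_bottom_nonzero[of 2]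
        by (intro exI[of _ "-3"]) (simp add: g_def twisted_generator_def c)
    next
      case 6
      then show ?thesis using lower[of "-1"] lower_bottom_nonzero[of 1]
        by (intro exI[of _ "-3"]) (simp add: g_def twisted_generator_def c)
    next
      case 7
      then show ?thesis using w2 top_nonzero[of "i - 2"]
        by (intro exI[of _ "4 - int i"]) (simp add: g_def twisted_generator_def c)
    next
      case 8
      then show ?thesis using w0 top_nonzero[of i]
        by (intro exI[of _ "- int i"]) (simp add: g_def twisted_generator_def c)
    next
      case 9
      then show ?thesis using lower[of "-1"] lower_bottom_nonzero[of 1]
        by (intro exI[of _ "- int i - 2"]) (simp add: g_def twisted_generator_def c)
    next
      case 10
      then show ?thesis using lower[of "-2"] lower_bottom_nonzero[of 2] level_pos
        by (intro exI[of _ "- int i - 2"]) (simp add: g_def twisted_generator_def c)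
    next
      case 11
      then show ?thesis using h_weight_shift(1)[OF w0, of "-1"] raise_vacuum_nonzero
        by (intro exI[of _ 2]) (simp add: g_def twisted_generator_def c)
    next
      case 12
      then show ?thesis using h_weight_shift(2)[OF lower, of "-1" "-1"] lower_vacuum_twice_nonzero
        by (intro exI[of _ "-4"]) (simp add: g_def twisted_generator_def c)
    next
      case 13
      then show ?thesis using w1 top_nonzero[of "i - 1"]
        by (intro exI[of _ "2 - int i"]) (simp add: g_def twisted_generator_def c)
    qed
  qed
  then show "g \<in> charge (charge_of j)" "g \<noteq> 0" using chargeI unfolding c_def by blast+
qed

end

theorem theorem3p11:
  fixes k i r :: nat
    and Y :: "'v::complex_vector \<Rightarrow> int \<Rightarrow> 'v \<Rightarrow> 'v" and vac conf :: 'v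
    and \<iota> :: "mat2 \<Rightarrow> 'v" and \<sigma> :: "'v \<Rightarrow> 'v"
    and YM :: "'v \<Rightarrow> int \<Rightarrow> 'm::complex_vector \<Rightarrow> 'm" and v :: "nat \<Rightarrow> 'm"
  assumes "k \<ge> 1" and "i \<le> k" and "r \<in> {1, 2}"
    and "simple_affine_sl2_voa k Y vac conf \<iota>"
    and "lifts_sigma Y vac conf \<iota> \<sigma>"
    and "affine_sl2_module Y vac conf \<iota> YM i v"
  shows "let U = fixed_points {id, \<sigma>, \<sigma> \<circ> \<sigma>} UNIV;
             YT = integral_twisted_mode Y (h_twist \<iota> r) YM;
             L = (\<lambda>j. generated_submodule U YT
                        (twisted_generator k i r j (YM (\<iota> mat_e)) (YM (\<iota> mat_f)) v))
         in direct_sum (UNIV :: 'm set) {0, 1, 2} L \<and>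
            (\<forall>j\<in>{0, 1, 2}. irreducible_module U Y vac conf (L j) YT) \<and>
            (\<forall>j\<in>{0, 1, 2}. \<forall>j'\<in>{0, 1, 2}. j \<noteq> j' \<longrightarrow>
               \<not> equivalent_modules U (L j) YT (L j') YT)"
proof -
  have voa_module: "voa_module UNIV Y vac conf UNIV YM"
    using affine_sl2_module.irreducible[OF assms(6)] unfolding irreducible_module_def by (rule conjunct1)
  interpret twisted_highest_weight k Y vac conf \<iota> \<sigma> YM r i v
    by (intro twisted_highest_weight.intro twisted_affine.intro affine_automorphism.intro
        affine_automorphism_axioms.intro affine_module.intro full_module.intro highest_weight_module.intro
        twisted_highest_weight_axioms.intro assms voa_module)
  let ?L = "\<lambda>j. generated_submodule fixed YT (twisted_generator k i r j (YM ee) (YM ff) v)"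
  have L: "?L j = charge (charge_of j)" and ne: "charge (charge_of j) \<noteq> {0}" if "j \<in> {0, 1, 2}" for j
    using twisted_generator_charge[OF that] generated_submodule_charge by auto
  have "direct_sum UNIV {0, 1, 2} ?L"
  proof -
    have "(\<Pi>\<^sub>E j\<in>{0, 1, 2}. ?L j) = (\<Pi>\<^sub>E j\<in>{0, 1, 2}. charge (charge_of j))" using L by (intro PiE_cong)
    then show ?thesis using charge_direct_sum L unfolding direct_sum_def by simp
  qed
  moreover have "\<forall>j\<in>{0, 1, 2}. irreducible_module fixed Y vac conf (?L j) YT"
    using L ne charge_irreducible_module by simp
  moreover have "\<forall>j\<in>{0, 1, 2}. \<forall>j'\<in>{0, 1, 2}. j \<noteq> j' \<longrightarrow> \<not> equivalent_modules fixed (?L j) YT (?L j') YT"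
    using L ne charges_inequivalent charge_of_distinct by (metis (no_types, lifting))
  ultimately show ?thesis unfolding Let_def fixed_def by blast
qed

end
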